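(* Consider a square invertible system $\dot x=f(x)+g(x)u$, $y=h(x)$ on the open set $U$, i.e. a regular system with $m=p=\rho_{k^\star}=m_{\rm d}$, with infinite zeros $q=\{q_1\le q_2\le\dots\le q_m\}$. Suppose that the Jacobian $d\bar\Phi_{\rm d}(x)$ has full row rank for every $x\in U$ (Assumption $\mathcal B$), and that the distribution spanned by the column vectors of $g(x)$ is involutive for $x\in U$. Then, under a new set of coordinates (a diffeomorphic state transformation $x\mapsto\mathrm{col}\{\eta,\xi\}$ with $\xi=\mathrm{col}\{\xi_{i,j}:1\le j\le q_i,1\le i\le m\}$, together with a constant nonsingular output transformation, the new outputs being again denoted $y_i$), the system takes the form $$\begin{aligned} \dot\eta&=f_{\rm e}(x)+\sum_{l=1}^m\varphi_l(x)v_l,\\ \dot\xi_{i,j}&=\xi_{i,j+1}+\sum_{l=1}^{i-1}\delta_{i,j,l}(x)v_l,\quad j=1,\dots,q_i-1,\\ \dot\xi_{i,q_i}&=v_i,\qquad y_i=\xi_{i,1},\qquad i=1,\dots,m, \end{aligned}$$ with smooth coefficient functions, where $v_i=a_i(x)+b_i(x)u$ with $\mathrm{col}\{b_1(x),\dots,b_m(x)\}$ nonsingular, and $\delta_{i,j,l}(x)=0$ for $j<q_l$, $i=1,\dots,m$. Moreover, there exists a set of coordinates such that $\varphi_l(x)=0$, $l=1,\dots,m$.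
   Context: System: $\dot x=f(x)+g(x)u$, $y=h(x)$, with $x\in\mathbb R^n$, $u\in\mathbb R^m$, $y\in\mathbb R^p$; $f,g,h$ are smooth on an open set $U\subset\mathbb R^n$ containing $0$, with $f(0)=0$, $h(0)=0$. For a smooth vector-valued $\Theta$, $d\Theta=\partial\Theta/\partial x$, $L_f\Theta=d\Theta\, f$, $L_g\Theta=d\Theta\, g$. $\mathrm{col}\{\cdot\}$ denotes vertical stacking. Matrices with zero rows are allowed (empty). A distribution is involutive if it is closed under Lie brackets of vector fields in it. Infinite zero structure algorithm. Initial step: $\Theta_0=h$, $\Omega_0=\emptyset$, $\rho_0=0$, $k=1$. Step $k$: given $\Theta_{k-1}:U\to\mathbb R^{p-\rho_{k-1}}$ and $\Omega_{k-1}:U\to\mathbb R^{\rho_{k-1}}$ with $L_g\Omega_{k-1}(x)$ of full row rank. Assumption $\mathcal A_k$: $\mathrm{col}\{L_g\Omega_{k-1}(x),L_g\Theta_{k-1}(x)\}$ has constant rank $\rho_k$ for $x\in U$, and there is a constant matrix $R_k\in\mathbb R^{(\rho_k-\rho_{k-1})\times(p-\rho_{k-1})}$ such that $\mathrm{col}\{L_g\Omega_{k-1}(x),L_gR_k\Theta_{k-1}(x)\}$ has full row rank $\rho_k$ for $x\in U$. Choose a constant $S_k\in\mathbb R^{(p-\rho_k)\times(p-\rho_{k-1})}$ with $\mathrm{col}\{R_k,S_k\}$ nonsingular, and set $\Omega_k=\mathrm{col}\{R_1\Theta_0,R_2\Theta_1,\dots,R_k\Theta_{k-1}\}$. There are unique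 smooth matrix functions $P_{k,l}:U\to\mathbb R^{(p-\rho_k)\times(\rho_l-\rho_{l-1})}$, $l=1,\dots,k$, with $L_gS_k\Theta_{k-1}=\sum_{l=1}^kP_{k,l}L_gR_l\Theta_{l-1}$. Set $\Theta_k=L_fS_k\Theta_{k-1}-\sum_{l=1}^kP_{k,l}L_fR_l\Theta_{l-1}$. If $k+\sum_{j=1}^kj(\rho_j-\rho_{j-1})<n$ and $\rho_k<\min\{p,m\}$, increase $k$ by one and repeat; otherwise stop with $k^\star=k$. Put $m_{\rm d}=\rho_{k^\star}$, $n_{\rm d}=\sum_{j=1}^{k^\star}j(\rho_j-\rho_{j-1})$, and let $q=\{q_1\le\dots\le q_{m_{\rm d}}\}$ be the list in which each integer $j\in\{1,\dots,k^\star\}$ occurs $\rho_j-\rho_{j-1}$ times. The system is called regular if Assumptions $\mathcal A_k$, $k=1,\dots,k^\star$, are satisfied; the infinite zeros of a regular system are the integers $q$. Further notation: $S_{i\leftrightarrow j}=S_iS_{i-1}\cdots S_j$ (identity if $j>i$); $\zeta_{i,j}=R_iS_{i-1\leftrightarrow j}\Theta_{j-1}(x)$ for $1\le j\le i\le k^\star$; $\zeta_i=\mathrm{col}\{\zeta_{i,1},\dots,\zeta_{i,i}\}$; $\bar\Phi_{\rm d}(x)=\mathrm{col}\{\zeta_1,\dots,\zeta_{k^\star}\}\in\mathbb R^{n_{\rm d}}$.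
   Formalization: The coordinates η, and the diffeomorphism x ↦ col{η,ξ}, are asserted on a neighbourhood of each point of U, since on all of U they need not exist; the ξ-subsystem, outputs, v and δ are on all of U. *)

theory Defs
  imports "HOL-Analysis.Analysis" "Jordan_Normal_Form.DL_Rank"
begin

unbundle no vec_syntax and no inner_syntax

text \<open>
  The state lives in \<open>real ^ 'n\<close>. Objects whose size is computed by the structure algorithm
  (outputs, the functions \<open>\<Theta>\<close> and \<open>\<Omega>\<close>, constant matrices) are \<open>vec\<close> and \<open>mat\<close> of
  Jordan_Normal_Form, which allow zero rows. The components of \<open>vec\<close> and \<open>mat\<close> are counted from 0;
  the steps \<open>k\<close>, the integrator chains \<open>i\<close>, \<open>l\<close> and the positions \<open>j\<close> in a chain are counted from 1.
\<close>

section \<open>Smoothness\<close>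

text \<open>Meaningful on open sets.\<close>

primrec Ck_on :: "nat \<Rightarrow> 'a set \<Rightarrow> ('a::real_normed_vector \<Rightarrow> 'b::real_normed_vector) \<Rightarrow> bool" where
  "Ck_on 0 U F \<longleftrightarrow> continuous_on U F"
| "Ck_on (Suc k) U F \<longleftrightarrow>
     (\<forall>x\<in>U. F differentiable (at x)) \<and> (\<forall>w. Ck_on k U (\<lambda>x. frechet_derivative F (at x) w))"

definition smooth_on :: "'a set \<Rightarrow> ('a::real_normed_vector \<Rightarrow> 'b::real_normed_vector) \<Rightarrow> bool" where
  "smooth_on U F \<longleftrightarrow> (\<forall>k. Ck_on k U F)"

definition smooth_vec_on :: "'a set \<Rightarrow> nat \<Rightarrow> ('a::real_normed_vector \<Rightarrow> real vec) \<Rightarrow> bool" where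
  "smooth_vec_on U r \<Theta> \<longleftrightarrow> (\<forall>x\<in>U. \<Theta> x \<in> carrier_vec r) \<and> (\<forall>i<r. smooth_on U (\<lambda>x. \<Theta> x $ i))"

definition diffeo_on :: "'a set \<Rightarrow> ('a::real_normed_vector \<Rightarrow> 'b::real_normed_vector) \<Rightarrow> bool" where
  "diffeo_on V \<Phi> \<longleftrightarrow>
     open V \<and> smooth_on V \<Phi> \<and> inj_on \<Phi> V \<and> open (\<Phi> ` V) \<and> smooth_on (\<Phi> ` V) (inv_into V \<Phi>)"

text \<open>Identification of a \<open>vec\<close> of length \<open>CARD('n)\<close> with a point of \<open>real ^ 'n\<close>, by the library's
  enumeration of the index type.\<close>

definition cart_of_vec :: "real vec \<Rightarrow> real ^ 'n::finite" where
  "cart_of_vec v = vec_lambda (\<lambda>i. v $ to_nat_on (UNIV :: 'n set) i)"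

section \<open>Derivatives along vector fields\<close>

definition vec_jacobian :: "(real ^ 'n::finite \<Rightarrow> real vec) \<Rightarrow> real ^ 'n \<Rightarrow> real mat" where
  "vec_jacobian \<Theta> x = mat (dim_vec (\<Theta> x)) CARD('n)
     (\<lambda>(i, j). frechet_derivative (\<lambda>z. \<Theta> z $ i) (at x) (axis (from_nat_into (UNIV :: 'n set) j) 1))"

definition Lf :: "('a::real_normed_vector \<Rightarrow> 'a) \<Rightarrow> ('a \<Rightarrow> real vec) \<Rightarrow> 'a \<Rightarrow> real vec" where
  "Lf f \<Theta> x = vec (dim_vec (\<Theta> x)) (\<lambda>i. frechet_derivative (\<lambda>z. \<Theta> z $ i) (at x) (f x))"

text \<open>The input matrix is given by its columns, the vector fields \<open>g j\<close> with \<open>j < m\<close>.\<close>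

definition Lg :: "(nat \<Rightarrow> 'a::real_normed_vector \<Rightarrow> 'a) \<Rightarrow> nat \<Rightarrow> ('a \<Rightarrow> real vec) \<Rightarrow> 'a \<Rightarrow> real mat" where
  "Lg g m \<Theta> x = mat (dim_vec (\<Theta> x)) m
     (\<lambda>(i, j). frechet_derivative (\<lambda>z. \<Theta> z $ i) (at x) (g j x))"

text \<open>The time derivative of a scalar function \<open>\<theta>\<close> of the state along the system, at state \<open>x\<close> with
  input value \<open>u\<close>.\<close>

definition deriv_along :: "('a::real_normed_vector \<Rightarrow> 'a) \<Rightarrow> (nat \<Rightarrow> 'a \<Rightarrow> 'a) \<Rightarrow> nat \<Rightarrow>
    ('a \<Rightarrow> real) \<Rightarrow> 'a \<Rightarrow> real vec \<Rightarrow> real" where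
  "deriv_along f g m \<theta> x u = frechet_derivative \<theta> (at x) (f x + (\<Sum>j<m. (u $ j) *\<^sub>R g j x))"

definition lie_bracket :: "('a::real_normed_vector \<Rightarrow> 'a) \<Rightarrow> ('a \<Rightarrow> 'a) \<Rightarrow> 'a \<Rightarrow> 'a" where
  "lie_bracket X Y x = frechet_derivative Y (at x) (X x) - frechet_derivative X (at x) (Y x)"

definition involutive_on :: "'a set \<Rightarrow> ('a::real_normed_vector \<Rightarrow> 'a set) \<Rightarrow> bool" where
  "involutive_on U \<Delta> \<longleftrightarrow>
     (\<forall>X Y. smooth_on U X \<and> smooth_on U Y \<and> (\<forall>x\<in>U. X x \<in> \<Delta> x \<and> Y x \<in> \<Delta> x)
        \<longrightarrow> (\<forall>x\<in>U. lie_bracket X Y x \<in> \<Delta> x))"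

definition mat_rank :: "real mat \<Rightarrow> nat" where
  "mat_rank A = vec_space.rank (dim_row A) A"

definition full_row_rank :: "real mat \<Rightarrow> bool" where
  "full_row_rank A \<longleftrightarrow> mat_rank A = dim_row A"

section \<open>The infinite zero structure algorithm\<close>

definition affine_system :: "(real ^ 'n::finite) set \<Rightarrow> (real ^ 'n \<Rightarrow> real ^ 'n) \<Rightarrow>
    (nat \<Rightarrow> real ^ 'n \<Rightarrow> real ^ 'n) \<Rightarrow> (real ^ 'n \<Rightarrow> real vec) \<Rightarrow> nat \<Rightarrow> nat \<Rightarrow> bool" where
  "affine_system U f g h m p \<longleftrightarrow>
     open U \<and> 0 \<in> U \<and> smooth_on U f \<and> (\<forall>j<m. smooth_on U (g j)) \<and> smooth_vec_on U p h \<and>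
     f 0 = 0 \<and> h 0 = 0\<^sub>v p"

text \<open>The block row \<open>P\<^sub>k = [P\<^sub>k\<^sub>,\<^sub>1, \<dots>, P\<^sub>k\<^sub>,\<^sub>k]\<close>: the unique solution of
  \<open>L\<^sub>g \<Psi> = P\<^sub>k L\<^sub>g \<Omega>\<^sub>k\<close> for \<open>\<Psi> = S\<^sub>k \<Theta>\<^sub>k\<^sub>-\<^sub>1\<close>. Since \<open>\<Omega>\<^sub>k\<close> stacks
  \<open>R\<^sub>l \<Theta>\<^sub>l\<^sub>-\<^sub>1\<close> for \<open>l = 1, \<dots>, k\<close>, the products with \<open>P\<^sub>k\<close> are the sums over \<open>l\<close>.\<close>

definition Pcoeff :: "(nat \<Rightarrow> 'a::real_normed_vector \<Rightarrow> 'a) \<Rightarrow> nat \<Rightarrow> ('a \<Rightarrow> real vec) \<Rightarrow>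
    ('a \<Rightarrow> real vec) \<Rightarrow> 'a \<Rightarrow> real mat" where
  "Pcoeff g m \<Omega> \<Psi> x = (THE M. M \<in> carrier_mat (dim_vec (\<Psi> x)) (dim_vec (\<Omega> x)) \<and>
     Lg g m \<Psi> x = M * Lg g m \<Omega> x)"

text \<open>The pair \<open>(\<Theta>\<^sub>k, \<Omega>\<^sub>k)\<close>.\<close>

primrec theta_omega :: "('a::real_normed_vector \<Rightarrow> 'a) \<Rightarrow> (nat \<Rightarrow> 'a \<Rightarrow> 'a) \<Rightarrow> ('a \<Rightarrow> real vec) \<Rightarrow>
    nat \<Rightarrow> (nat \<Rightarrow> real mat) \<Rightarrow> (nat \<Rightarrow> real mat) \<Rightarrow> nat \<Rightarrow> ('a \<Rightarrow> real vec) \<times> ('a \<Rightarrow> real vec)" where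
  "theta_omega f g h m R S 0 = (h, \<lambda>x. 0\<^sub>v 0)"
| "theta_omega f g h m R S (Suc k) =
     (let \<Theta> = fst (theta_omega f g h m R S k);
          \<Omega> = (\<lambda>x. snd (theta_omega f g h m R S k) x @\<^sub>v (R (Suc k) *\<^sub>v \<Theta> x));
          \<Psi> = (\<lambda>x. S (Suc k) *\<^sub>v \<Theta> x)
      in (\<lambda>x. Lf f \<Psi> x - Pcoeff g m \<Omega> \<Psi> x *\<^sub>v Lf f \<Omega> x, \<Omega>))"

definition Theta :: "('a::real_normed_vector \<Rightarrow> 'a) \<Rightarrow> (nat \<Rightarrow> 'a \<Rightarrow> 'a) \<Rightarrow> ('a \<Rightarrow> real vec) \<Rightarrow>
    nat \<Rightarrow> (nat \<Rightarrow> real mat) \<Rightarrow> (nat \<Rightarrow> real mat) \<Rightarrow> nat \<Rightarrow> 'a \<Rightarrow> real vec" where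
  "Theta f g h m R S k = fst (theta_omega f g h m R S k)"

definition Omega :: "('a::real_normed_vector \<Rightarrow> 'a) \<Rightarrow> (nat \<Rightarrow> 'a \<Rightarrow> 'a) \<Rightarrow> ('a \<Rightarrow> real vec) \<Rightarrow>
    nat \<Rightarrow> (nat \<Rightarrow> real mat) \<Rightarrow> (nat \<Rightarrow> real mat) \<Rightarrow> nat \<Rightarrow> 'a \<Rightarrow> real vec" where
  "Omega f g h m R S k = snd (theta_omega f g h m R S k)"

definition step_assumption :: "'a set \<Rightarrow> ('a::real_normed_vector \<Rightarrow> 'a) \<Rightarrow> (nat \<Rightarrow> 'a \<Rightarrow> 'a) \<Rightarrow>
    ('a \<Rightarrow> real vec) \<Rightarrow> nat \<Rightarrow> nat \<Rightarrow> (nat \<Rightarrow> nat) \<Rightarrow> (nat \<Rightarrow> real mat) \<Rightarrow> (nat \<Rightarrow> real mat) \<Rightarrow>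
    nat \<Rightarrow> bool" where
  "step_assumption U f g h m p \<rho> R S k \<longleftrightarrow>
     (let \<Theta> = Theta f g h m R S (k - 1); \<Omega> = Omega f g h m R S (k - 1) in
       (\<forall>x\<in>U. mat_rank (Lg g m \<Omega> x @\<^sub>r Lg g m \<Theta> x) = \<rho> k) \<and>
       R k \<in> carrier_mat (\<rho> k - \<rho> (k - 1)) (p - \<rho> (k - 1)) \<and>
       (\<forall>x\<in>U. full_row_rank (Lg g m \<Omega> x @\<^sub>r Lg g m (\<lambda>z. R k *\<^sub>v \<Theta> z) x)))"

definition nd :: "(nat \<Rightarrow> nat) \<Rightarrow> nat \<Rightarrow> nat" where
  "nd \<rho> k = (\<Sum>j=1..k. j * (\<rho> j - \<rho> (j - 1)))"

definition continues :: "nat \<Rightarrow> nat \<Rightarrow> nat \<Rightarrow> (nat \<Rightarrow> nat) \<Rightarrow> nat \<Rightarrow> bool" where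
  "continues n m p \<rho> k \<longleftrightarrow> k + nd \<rho> k < n \<and> \<rho> k < min p m"

text \<open>A run of the algorithm with choices \<open>R k\<close>, \<open>S k\<close> that satisfies the assumption of every step
  and stops after step \<open>kstar\<close>.\<close>

definition regular_run :: "(real ^ 'n::finite) set \<Rightarrow> (real ^ 'n \<Rightarrow> real ^ 'n) \<Rightarrow>
    (nat \<Rightarrow> real ^ 'n \<Rightarrow> real ^ 'n) \<Rightarrow> (real ^ 'n \<Rightarrow> real vec) \<Rightarrow> nat \<Rightarrow> nat \<Rightarrow> (nat \<Rightarrow> nat) \<Rightarrow>
    (nat \<Rightarrow> real mat) \<Rightarrow> (nat \<Rightarrow> real mat) \<Rightarrow> nat \<Rightarrow> bool" where
  "regular_run U f g h m p \<rho> R S kstar \<longleftrightarrow>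
     \<rho> 0 = 0 \<and> 1 \<le> kstar \<and>
     (\<forall>k\<in>{1..kstar}. step_assumption U f g h m p \<rho> R S k \<and>
        S k \<in> carrier_mat (p - \<rho> k) (p - \<rho> (k - 1)) \<and> invertible_mat (R k @\<^sub>r S k)) \<and>
     (\<forall>k\<in>{1..<kstar}. continues CARD('n) m p \<rho> k) \<and> \<not> continues CARD('n) m p \<rho> kstar"

definition infinite_zeros :: "(nat \<Rightarrow> nat) \<Rightarrow> nat \<Rightarrow> nat list" where
  "infinite_zeros \<rho> kstar = concat (map (\<lambda>j. replicate (\<rho> j - \<rho> (j - 1)) j) [1..<Suc kstar])"

text \<open>The product \<open>S\<^sub>i S\<^sub>i\<^sub>-\<^sub>1 \<cdots> S\<^sub>j\<close>, for \<open>j \<ge> 1\<close>.\<close>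

primrec Sprod :: "nat \<Rightarrow> (nat \<Rightarrow> nat) \<Rightarrow> (nat \<Rightarrow> real mat) \<Rightarrow> nat \<Rightarrow> nat \<Rightarrow> real mat" where
  "Sprod p \<rho> S 0 j = 1\<^sub>m (p - \<rho> 0)"
| "Sprod p \<rho> S (Suc i) j = (if j > Suc i then 1\<^sub>m (p - \<rho> (Suc i)) else S (Suc i) * Sprod p \<rho> S i j)"

definition zeta :: "('a::real_normed_vector \<Rightarrow> 'a) \<Rightarrow> (nat \<Rightarrow> 'a \<Rightarrow> 'a) \<Rightarrow> ('a \<Rightarrow> real vec) \<Rightarrow>
    nat \<Rightarrow> nat \<Rightarrow> (nat \<Rightarrow> nat) \<Rightarrow> (nat \<Rightarrow> real mat) \<Rightarrow> (nat \<Rightarrow> real mat) \<Rightarrow> nat \<Rightarrow> nat \<Rightarrow>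
    'a \<Rightarrow> real vec" where
  "zeta f g h m p \<rho> R S i j x =
     (R i * Sprod p \<rho> S (i - 1) j) *\<^sub>v Theta f g h m R S (j - 1) x"

definition Phi_d :: "('a::real_normed_vector \<Rightarrow> 'a) \<Rightarrow> (nat \<Rightarrow> 'a \<Rightarrow> 'a) \<Rightarrow> ('a \<Rightarrow> real vec) \<Rightarrow>
    nat \<Rightarrow> nat \<Rightarrow> (nat \<Rightarrow> nat) \<Rightarrow> (nat \<Rightarrow> real mat) \<Rightarrow> (nat \<Rightarrow> real mat) \<Rightarrow> nat \<Rightarrow> 'a \<Rightarrow> real vec" where
  "Phi_d f g h m p \<rho> R S kstar x = vec_of_list (concat (map (\<lambda>i.
     concat (map (\<lambda>j. list_of_vec (zeta f g h m p \<rho> R S i j x)) [1..<Suc i])) [1..<Suc kstar]))"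

section \<open>The normal form\<close>

definition xi_vec :: "nat \<Rightarrow> (nat \<Rightarrow> nat) \<Rightarrow> (nat \<Rightarrow> nat \<Rightarrow> 'a \<Rightarrow> real) \<Rightarrow> 'a \<Rightarrow> real vec" where
  "xi_vec m q \<xi> x = vec_of_list (concat (map (\<lambda>i. map (\<lambda>j. \<xi> i j x) [1..<Suc (q i)]) [1..<Suc m]))"

text \<open>The integrator chains \<open>\<xi>\<close>, driven by the inputs \<open>v\<^sub>i = a\<^sub>i(x) + b\<^sub>i(x) u\<close>, with the outputs
  \<open>y\<^sub>i\<close> of the transformed output map \<open>y\<close>.\<close>

definition chain_form :: "'a set \<Rightarrow> ('a::real_normed_vector \<Rightarrow> 'a) \<Rightarrow> (nat \<Rightarrow> 'a \<Rightarrow> 'a) \<Rightarrow>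
    ('a \<Rightarrow> real vec) \<Rightarrow> nat \<Rightarrow> (nat \<Rightarrow> nat) \<Rightarrow> (nat \<Rightarrow> nat \<Rightarrow> 'a \<Rightarrow> real) \<Rightarrow> (nat \<Rightarrow> 'a \<Rightarrow> real) \<Rightarrow>
    (nat \<Rightarrow> 'a \<Rightarrow> real vec) \<Rightarrow> (nat \<Rightarrow> nat \<Rightarrow> nat \<Rightarrow> 'a \<Rightarrow> real) \<Rightarrow> bool" where
  "chain_form U f g y m q \<xi> a b \<delta> \<longleftrightarrow>
     (\<forall>i\<in>{1..m}.
        (\<forall>j\<in>{1..q i}. smooth_on U (\<xi> i j)) \<and> smooth_on U (a i) \<and> smooth_vec_on U m (b i) \<and>
        (\<forall>j\<in>{1..<q i}. \<forall>l\<in>{1..<i}. smooth_on U (\<delta> i j l))) \<and>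
     (\<forall>x\<in>U. invertible_mat (mat_of_rows m (map (\<lambda>i. b i x) [1..<Suc m]))) \<and>
     (\<forall>x\<in>U. \<forall>u\<in>carrier_vec m. \<forall>i\<in>{1..m}.
        (\<forall>j\<in>{1..<q i}. deriv_along f g m (\<xi> i j) x u =
           \<xi> i (j + 1) x + (\<Sum>l\<in>{1..<i}. \<delta> i j l x * (a l x + b l x \<bullet> u))) \<and>
        deriv_along f g m (\<xi> i (q i)) x u = a i x + b i x \<bullet> u) \<and>
     (\<forall>x\<in>U. \<forall>i\<in>{1..m}. y x $ (i - 1) = \<xi> i 1 x) \<and>
     (\<forall>x\<in>U. \<forall>i\<in>{1..m}. \<forall>j\<in>{1..<q i}. \<forall>l\<in>{1..<i}. j < q l \<longrightarrow> \<delta> i j l x = 0)"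

text \<open>On \<open>V\<close>, the functions \<open>\<eta>\<close> complete \<open>\<xi>\<close> to coordinates of the state, with
  \<open>\<eta>' = f\<^sub>e(x) + \<Sum>\<^sub>l \<phi>\<^sub>l(x) v\<^sub>l\<close>. Such coordinates exist only locally in general: a Jacobian of full row
  rank on \<open>U\<close> does not make \<open>\<xi>\<close> part of an injective map on \<open>U\<close>.\<close>

definition eta_form :: "(real ^ 'n::finite) set \<Rightarrow> (real ^ 'n \<Rightarrow> real ^ 'n) \<Rightarrow>
    (nat \<Rightarrow> real ^ 'n \<Rightarrow> real ^ 'n) \<Rightarrow> nat \<Rightarrow> (nat \<Rightarrow> nat) \<Rightarrow> (nat \<Rightarrow> nat \<Rightarrow> real ^ 'n \<Rightarrow> real) \<Rightarrow>
    (nat \<Rightarrow> real ^ 'n \<Rightarrow> real) \<Rightarrow> (nat \<Rightarrow> real ^ 'n \<Rightarrow> real vec) \<Rightarrow> nat \<Rightarrow>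
    (real ^ 'n \<Rightarrow> real vec) \<Rightarrow> (real ^ 'n \<Rightarrow> real vec) \<Rightarrow> (nat \<Rightarrow> real ^ 'n \<Rightarrow> real vec) \<Rightarrow> bool" where
  "eta_form V f g m q \<xi> a b r \<eta> fe \<phi> \<longleftrightarrow>
     smooth_vec_on V r \<eta> \<and> smooth_vec_on V r fe \<and> (\<forall>l\<in>{1..m}. smooth_vec_on V r (\<phi> l)) \<and>
     diffeo_on V (\<lambda>x. cart_of_vec (\<eta> x @\<^sub>v xi_vec m q \<xi> x) :: real ^ 'n) \<and>
     (\<forall>x\<in>V. \<forall>u\<in>carrier_vec m. \<forall>k<r. deriv_along f g m (\<lambda>z. \<eta> z $ k) x u =
        fe x $ k + (\<Sum>l=1..m. (\<phi> l x $ k) * (a l x + b l x \<bullet> u)))"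

end

(*
  Write v for the time derivative of Omega. In Theta_j = L_f S_j Theta_{j-1} - P_j L_f Omega_j the
  input enters the derivative of S_j Theta_{j-1} only through P_j v, and P_j has rho_j columns. Hence
  the components of K Theta_{j-1}, for the constant matrices K = R_i S_{i-1} ... S_j, form integrator
  chains in which v_l occurs at position j only for l at most rho_j.

  For the internal coordinates, solve for fields X_j in the span of the g_j that are dual to the
  differentials of Omega_1, ..., Omega_m. By duality their brackets are annihilated by every dOmega_i,
  and by involutivity the brackets are combinations of the X_j, so the X_j commute. Following the X_j
  to the level set of Omega through the base point gives first integrals of the distribution whose
  differentials, together with those of Omega, have full rank. Omega consists of the last entries
  of the chains, so gradients of first integrals complete the independent gradients of the xi_{i,j}
  to a basis. First integrals do not see the input, so phi = 0. Smoothness of the flow comes from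
  Picard iteration for Volterra equations with a parameter.
*)

theory Submission
  imports Defs
begin

section \<open>Families of functions with jointly continuous derivatives\<close>

text \<open>The analytic obstacle is that smoothness means derivatives of every order, while the
  flow has to be smooth in its starting point. Class k + 1 is reached from class k because the
  derivative of a solution solves the variational equation, a linear Volterra equation whose
  coefficients are built from the solution itself and so are already of class k. To run this
  induction, functions are treated as families \<open>F s x\<close> whose derivatives in
  \<open>x\<close> are continuous in \<open>(s, x)\<close> jointly; the time \<open>s\<close> is a
  mere parameter and may range over a closed interval. Time is rescaled so that the vector field has
  Lipschitz constant 1/2 on the unit interval. This one constant serves the convergence of the
  iteration, uniqueness, and the estimate of difference quotients.

  The algebraic obstacle is that the coefficients \<open>P\<close> of the algorithm are given
  pointwise by a definite description. They exist by a rank factorisation, and they are smooth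
  because they solve a square system with a Gram matrix.\<close>

lemma frechet_derivative_cong_open:
  assumes "open U" "x \<in> U" "\<And>y. y \<in> U \<Longrightarrow> F y = G y"
  shows "frechet_derivative F (at x) = frechet_derivative G (at x)"
proof -
  have "(F has_derivative D) (at x) \<longleftrightarrow> (G has_derivative D) (at x)" for D
    using assms has_derivative_transform_within_open[of _ _ x UNIV U] by (metis)
  then show ?thesis by (simp add: frechet_derivative_def)
qed

lemma differentiable_cong_open:
  assumes "open U" "x \<in> U" "\<And>y. y \<in> U \<Longrightarrow> F y = G y"
  shows "F differentiable (at x) \<longleftrightarrow> G differentiable (at x)"
  using assms has_derivative_transform_within_open[of _ _ x UNIV U]
  by (metis differentiable_def)

lemma frechet_derivative_eq:
  "(F has_derivative D) (at x) \<Longrightarrow> frechet_derivative F (at x) = D"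
  using frechet_derivative_at by metis

lemma has_derivative_frechet:
  "F differentiable (at x) \<Longrightarrow> (F has_derivative frechet_derivative F (at x)) (at x)"
  by (simp add: frechet_derivative_works)

text \<open>\<open>T\<close> carries the parameter and may be any set, in particular a closed time
  interval; \<open>U\<close> is the open domain of the differentiated variable. Joint continuity is
  demanded anew at each order because differentiability in \<open>x\<close> for each fixed
  \<open>s\<close> does not give it. Derivatives are tested on fixed directions \<open>w\<close>, as
  in \<open>Ck_on\<close>, so that all values stay in the type \<open>'b\<close>.\<close>

primrec Ckp :: "nat \<Rightarrow> 's::topological_space set \<Rightarrow> 'a::real_normed_vector set \<Rightarrow>
    ('s \<Rightarrow> 'a \<Rightarrow> 'b::real_normed_vector) \<Rightarrow> bool" where
  "Ckp 0 T U F \<longleftrightarrow> continuous_on (T \<times> U) (\<lambda>p. F (fst p) (snd p))"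
| "Ckp (Suc k) T U F \<longleftrightarrow> continuous_on (T \<times> U) (\<lambda>p. F (fst p) (snd p)) \<and>
     (\<forall>s\<in>T. \<forall>x\<in>U. F s differentiable (at x)) \<and>
     (\<forall>w. Ckp k T U (\<lambda>s x. frechet_derivative (F s) (at x) w))"

lemma Ckp_cong_imp:
  assumes "open U" "\<And>s x. s \<in> T \<Longrightarrow> x \<in> U \<Longrightarrow> F s x = G s x" "Ckp k T U F"
  shows "Ckp k T U G"
  using assms(2,3)
proof (induction k arbitrary: F G)
  case 0
  have "continuous_on (T \<times> U) (\<lambda>p. G (fst p) (snd p))"
    by (rule continuous_on_eq[of "T \<times> U" "\<lambda>p. F (fst p) (snd p)"]) (use 0 in auto)
  then show ?case by simp
next
  case (Suc k)
  have "continuous_on (T \<times> U) (\<lambda>p. G (fst p) (snd p))"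
    by (rule continuous_on_eq[of "T \<times> U" "\<lambda>p. F (fst p) (snd p)"]) (use Suc.prems in auto)
  moreover have "G s differentiable (at x)" if "s \<in> T" "x \<in> U" for s x
    using Suc.prems that differentiable_cong_open[OF assms(1) that(2), of "F s" "G s"] by auto
  moreover have "Ckp k T U (\<lambda>s x. frechet_derivative (G s) (at x) w)" for w
  proof (rule Suc.IH)
    show "Ckp k T U (\<lambda>s x. frechet_derivative (F s) (at x) w)" using Suc.prems by simp
    show "frechet_derivative (F s) (at x) w = frechet_derivative (G s) (at x) w" if "s \<in> T" "x \<in> U" for s x
      using Suc.prems(1) that frechet_derivative_cong_open[OF assms(1) that(2), of "F s" "G s"] by auto
  qed
  ultimately show ?case by simp
qed

lemma Ckp_cong:
  assumes "open U" "\<And>s x. s \<in> T \<Longrightarrow> x \<in> U \<Longrightarrow> F s x = G s x"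
  shows "Ckp k T U F \<longleftrightarrow> Ckp k T U G"
  using Ckp_cong_imp[of U T F G k] Ckp_cong_imp[of U T G F k] assms by metis

lemma Ckp_continuous: "Ckp k T U F \<Longrightarrow> continuous_on (T \<times> U) (\<lambda>p. F (fst p) (snd p))"
  by (cases k) auto

text \<open>The closure proofs below know each derivative as a formula; this rule spares them the
  \<open>frechet_derivative\<close> of a compound function.\<close>

lemma Ckp_SucI:
  assumes "open U"
    and "continuous_on (T \<times> U) (\<lambda>p. F (fst p) (snd p))"
    and D: "\<And>s x. s \<in> T \<Longrightarrow> x \<in> U \<Longrightarrow> (F s has_derivative D s x) (at x)"
    and "\<And>w. Ckp k T U (\<lambda>s x. D s x w)"
  shows "Ckp (Suc k) T U F"
proof -
  have "Ckp k T U (\<lambda>s x. frechet_derivative (F s) (at x) w)" for w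
  proof (rule Ckp_cong_imp[OF assms(1) _ assms(4)[of w]])
    show "D s x w = frechet_derivative (F s) (at x) w" if "s \<in> T" "x \<in> U" for s x
      using D[OF that] by (simp add: frechet_derivative_eq)
  qed
  then show ?thesis using assms(2) differentiableI[OF D] by simp
qed

lemma Ckp_SucD:
  assumes "Ckp (Suc k) T U F"
  shows "\<And>s x. s \<in> T \<Longrightarrow> x \<in> U \<Longrightarrow> (F s has_derivative frechet_derivative (F s) (at x)) (at x)"
    and "\<And>w. Ckp k T U (\<lambda>s x. frechet_derivative (F s) (at x) w)"
  using assms by (simp_all add: has_derivative_frechet)

lemma Ckp_Suc_imp: "Ckp (Suc k) T U F \<Longrightarrow> Ckp k T U F"
proof (induction k arbitrary: F)
  case (Suc k)
  have "Ckp k T U (\<lambda>s x. frechet_derivative (F s) (at x) w)" for w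
    using Suc.IH Ckp_SucD(2)[OF Suc.prems] by blast
  moreover have "continuous_on (T \<times> U) (\<lambda>p. F (fst p) (snd p))" "\<forall>s\<in>T. \<forall>x\<in>U. F s differentiable (at x)"
    using Ckp.simps(2)[THEN iffD1, OF Suc.prems] by blast+
  ultimately show ?case by simp
qed auto

lemma Ckp_mono: "Ckp k T U F \<Longrightarrow> l \<le> k \<Longrightarrow> Ckp l T U F"
proof (induction k)
  case (Suc k)
  then show ?case using Ckp_Suc_imp le_Suc_eq by metis
qed auto

text \<open>Nothing is differentiated in the parameter, so a continuous change of parameter
  preserves the class. Freezing the time and changing the parameter type of a constant family are
  instances.\<close>

lemma Ckp_reparam_subset:
  fixes F :: "'s::topological_space \<Rightarrow> 'a::real_normed_vector \<Rightarrow> 'b::real_normed_vector"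
  assumes "Ckp k T U F" "continuous_on T' \<phi>" "\<phi> ` T' \<subseteq> T" "U' \<subseteq> U"
  shows "Ckp k T' U' (\<lambda>s. F (\<phi> s))"
proof -
  have "continuous_on (T' \<times> U') (\<lambda>p. \<phi> (fst p))"
    by (rule continuous_on_compose2[OF assms(2) continuous_on_fst[OF continuous_on_id]]) auto
  then have c: "continuous_on (T' \<times> U') (\<lambda>p. (\<phi> (fst p), snd p))"
    by (intro continuous_on_Pair continuous_on_snd continuous_on_id) auto
  have im: "(\<lambda>p. (\<phi> (fst p), snd p)) ` (T' \<times> U') \<subseteq> T \<times> U" using assms(3,4) by auto
  have *: "continuous_on (T' \<times> U') (\<lambda>p. G (\<phi> (fst p)) (snd p))"
    if "continuous_on (T \<times> U) (\<lambda>p. G (fst p) (snd p))" for G  :: "'s \<Rightarrow> 'a \<Rightarrow> 'b"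
    using continuous_on_compose2[OF that c im] by simp
  show ?thesis
    using assms(1)
  proof (induction k arbitrary: F)
    case 0
    then show ?case using * by simp
  next
    case (Suc k)
    have "Ckp k T' U' (\<lambda>s x. frechet_derivative (F (\<phi> s)) (at x) w)" for w
      using Suc.IH[OF Ckp_SucD(2)[OF Suc.prems, of w]] .
    moreover have "F (\<phi> s) differentiable (at x)" if "s \<in> T'" "x \<in> U'" for s x
      using Suc.prems that assms(3,4) by auto
    ultimately show ?case using *[OF Ckp_continuous[OF Suc.prems]] by simp
  qed
qed

lemma Ckp_reparam:
  "Ckp k T U F \<Longrightarrow> continuous_on T' \<phi> \<Longrightarrow> \<phi> ` T' \<subseteq> T \<Longrightarrow> Ckp k T' U (\<lambda>s. F (\<phi> s))"
  by (rule Ckp_reparam_subset) auto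

lemma Ckp_subset:
  "Ckp k T U F \<Longrightarrow> T' \<subseteq> T \<Longrightarrow> U' \<subseteq> U \<Longrightarrow> Ckp k T' U' F"
  using Ckp_reparam_subset[of k T U F T' "\<lambda>s. s" U'] by auto

lemma Ckp_const_param:
  assumes "Ckp k (T::'t::topological_space set) U (\<lambda>_. F)" "T \<noteq> {}"
  shows "Ckp k T' U (\<lambda>_. F)"
proof -
  obtain t where "t \<in> T" using assms by auto
  then show ?thesis
    using Ckp_reparam[OF assms(1), of T' "\<lambda>_. t"] by auto
qed

section \<open>Closure of the classes under algebraic operations\<close>

lemma Ckp_const: "open U \<Longrightarrow> Ckp k T U (\<lambda>s x. c)"
proof (induction k arbitrary: c)
  case (Suc k)
  then show ?case by (intro Ckp_SucI[where D="\<lambda>_ _ _. 0"]) auto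
qed auto

lemma Ckp_linear:
  assumes "open U" "bounded_linear L"
  shows "Ckp k T U (\<lambda>s. L)"
proof -
  have c: "continuous_on (T \<times> U) (\<lambda>p. L (snd p))"
    by (intro bounded_linear.continuous_on[OF assms(2)] continuous_on_snd continuous_on_id)
  show ?thesis
  proof (cases k)
    case 0
    then show ?thesis using c by simp
  next
    case (Suc n)
    show ?thesis unfolding Suc
      by (rule Ckp_SucI[where D="\<lambda>_ _. L"])
        (use assms c in \<open>auto intro: Ckp_const bounded_linear_imp_has_derivative\<close>)
  qed
qed

lemma Ckp_id: "open U \<Longrightarrow> Ckp k T U (\<lambda>s x. x)"
  using Ckp_linear[OF _ bounded_linear_ident] .

lemma Ckp_compose_linear:
  assumes "open U" "bounded_linear L" "Ckp k T U F"
  shows "Ckp k T U (\<lambda>s x. L (F s x))"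
  using assms(3)
proof (induction k arbitrary: F)
  case 0
  then show ?case using bounded_linear.continuous_on[OF assms(2)] by auto
next
  case (Suc k)
  show ?case
  proof (rule Ckp_SucI[where D="\<lambda>s x w. L (frechet_derivative (F s) (at x) w)"])
    show "continuous_on (T \<times> U) (\<lambda>p. L (F (fst p) (snd p)))"
      using bounded_linear.continuous_on[OF assms(2) Ckp_continuous[OF Suc.prems]] .
    show "((\<lambda>x. L (F s x)) has_derivative (\<lambda>w. L (frechet_derivative (F s) (at x) w))) (at x)"
      if "s \<in> T" "x \<in> U" for s x
      using bounded_linear.has_derivative[OF assms(2) Ckp_SucD(1)[OF Suc.prems that]] .
    show "Ckp k T U (\<lambda>s x. L (frechet_derivative (F s) (at x) w))" for w
      using Suc.IH[OF Ckp_SucD(2)[OF Suc.prems]] .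
  qed fact
qed

lemma Ckp_add:
  assumes "open U" "Ckp k T U F" "Ckp k T U G"
  shows "Ckp k T U (\<lambda>s x. F s x + G s x)"
  using assms(2,3)
proof (induction k arbitrary: F G)
  case 0
  then show ?case by (auto intro: continuous_on_add)
next
  case (Suc k)
  show ?case
  proof (rule Ckp_SucI[where D="\<lambda>s x w. frechet_derivative (F s) (at x) w + frechet_derivative (G s) (at x) w"])
    show "continuous_on (T \<times> U) (\<lambda>p. F (fst p) (snd p) + G (fst p) (snd p))"
      using Suc.prems by (auto intro: continuous_on_add)
  qed (use assms(1) Suc.IH Ckp_SucD[OF Suc.prems(1)] Ckp_SucD[OF Suc.prems(2)] in \<open>auto intro!: has_derivative_add\<close>)
qed

lemma Ckp_sum:
  assumes "open U" "\<And>i. i \<in> I \<Longrightarrow> Ckp k T U (F i)"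
  shows "Ckp k T U (\<lambda>s x. \<Sum>i\<in>I. F i s x)"
  using assms(2)
proof (induction I rule: infinite_finite_induct)
  case (insert a A)
  then show ?case using Ckp_add[OF assms(1), of k T "F a" "\<lambda>s x. \<Sum>i\<in>A. F i s x"] by simp
qed (simp_all add: Ckp_const[OF assms(1)])

text \<open>Each summand of the product rule pairs one function with a derivative of the other. Both
  are of class \<open>k\<close>, so the induction hypothesis applies to each summand.\<close>

lemma Ckp_bilinear:
  assumes "open U" "bounded_bilinear B" "Ckp k T U F" "Ckp k T U G"
  shows "Ckp k T U (\<lambda>s x. B (F s x) (G s x))"
  using assms(3,4)
proof (induction k arbitrary: F G)
  case 0
  then show ?case using bounded_bilinear.continuous_on[OF assms(2)] by auto
next
  case (Suc k)
  note F = Ckp_SucD[OF Suc.prems(1)] and G = Ckp_SucD[OF Suc.prems(2)]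
  show ?case
  proof (rule Ckp_SucI[where D="\<lambda>s x w. B (F s x) (frechet_derivative (G s) (at x) w) + B (frechet_derivative (F s) (at x) w) (G s x)"])
    show "continuous_on (T \<times> U) (\<lambda>p. B (F (fst p) (snd p)) (G (fst p) (snd p)))"
      using bounded_bilinear.continuous_on[OF assms(2) Ckp_continuous[OF Suc.prems(1)] Ckp_continuous[OF Suc.prems(2)]] .
    show "((\<lambda>x. B (F s x) (G s x)) has_derivative
           (\<lambda>w. B (F s x) (frechet_derivative (G s) (at x) w) + B (frechet_derivative (F s) (at x) w) (G s x))) (at x)"
      if "s \<in> T" "x \<in> U" for s x
      using bounded_bilinear.FDERIV[OF assms(2) F(1)[OF that] G(1)[OF that]] .
    show "Ckp k T U (\<lambda>s x. B (F s x) (frechet_derivative (G s) (at x) w) + B (frechet_derivative (F s) (at x) w) (G s x))" for w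
      using Suc.IH[OF Ckp_Suc_imp[OF Suc.prems(1)] G(2)] Suc.IH[OF F(2) Ckp_Suc_imp[OF Suc.prems(2)]]
      by (intro Ckp_add[OF assms(1)]) auto
  qed fact
qed

lemma Ckp_scaleR:
  "open U \<Longrightarrow> Ckp k T U F \<Longrightarrow> Ckp k T U G \<Longrightarrow> Ckp k T U (\<lambda>s x. F s x *\<^sub>R G s x)"
  using Ckp_bilinear[OF _ bounded_bilinear_scaleR] .

lemma Ckp_mult:
  fixes F :: "'s::topological_space \<Rightarrow> 'a::real_normed_vector \<Rightarrow> 'b::real_normed_algebra"
  shows "open U \<Longrightarrow> Ckp k T U F \<Longrightarrow> Ckp k T U G \<Longrightarrow> Ckp k T U (\<lambda>s x. F s x * G s x)"
  using Ckp_bilinear[OF _ bounded_bilinear_mult] .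

lemma Ckp_minus: "open U \<Longrightarrow> Ckp k T U F \<Longrightarrow> Ckp k T U (\<lambda>s x. - F s x)"
  using Ckp_compose_linear[OF _ bounded_linear_minus[OF bounded_linear_ident]] .

lemma Ckp_diff:
  "open U \<Longrightarrow> Ckp k T U F \<Longrightarrow> Ckp k T U G \<Longrightarrow> Ckp k T U (\<lambda>s x. F s x - G s x)"
  using Ckp_add[of U k T F "\<lambda>s x. - G s x"] Ckp_minus[of U k T G] by simp

lemma Ckp_prod:
  fixes F :: "'i \<Rightarrow> 's::topological_space \<Rightarrow> 'a::real_normed_vector \<Rightarrow> 'b::{real_normed_algebra_1, comm_ring_1}"
  assumes "open U" "\<And>i. i \<in> I \<Longrightarrow> Ckp k T U (F i)"
  shows "Ckp k T U (\<lambda>s x. \<Prod>i\<in>I. F i s x)"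
  using assms(2)
proof (induction I rule: infinite_finite_induct)
  case (insert a A)
  then show ?case using Ckp_mult[OF assms(1), of k T "F a" "\<lambda>s x. \<Prod>i\<in>A. F i s x"] by simp
qed (simp_all add: Ckp_const[OF assms(1)])

text \<open>The derivative of the inverse is a product that contains the inverse itself, and this
  factor is of class \<open>k\<close> by the induction hypothesis.\<close>

lemma Ckp_inverse:
  fixes F :: "'s::topological_space \<Rightarrow> 'a::real_normed_vector \<Rightarrow> real"
  assumes "open U" "Ckp k T U F" "\<And>s x. s \<in> T \<Longrightarrow> x \<in> U \<Longrightarrow> F s x \<noteq> 0"
  shows "Ckp k T U (\<lambda>s x. inverse (F s x))"
  using assms(2)
proof (induction k)
  case 0
  then show ?case using assms(3) by (auto intro!: continuous_on_inverse)
next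
  case (Suc k)
  note F = Ckp_SucD[OF Suc.prems(1)]
  have IH: "Ckp k T U (\<lambda>s x. inverse (F s x))" using Suc.IH[OF Ckp_Suc_imp[OF Suc.prems(1)]] .
  show ?case
  proof (rule Ckp_SucI[where D="\<lambda>s x w. - (inverse (F s x) * frechet_derivative (F s) (at x) w * inverse (F s x))"])
    show "continuous_on (T \<times> U) (\<lambda>p. inverse (F (fst p) (snd p)))"
      using Suc.prems assms(3) by (auto intro!: continuous_on_inverse)
    show "((\<lambda>x. inverse (F s x)) has_derivative
           (\<lambda>w. - (inverse (F s x) * frechet_derivative (F s) (at x) w * inverse (F s x)))) (at x)"
      if "s \<in> T" "x \<in> U" for s x
      using Deriv.has_derivative_inverse[OF assms(3)[OF that] F(1)[OF that]] by (simp add: mult_ac)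
    show "Ckp k T U (\<lambda>s x. - (inverse (F s x) * frechet_derivative (F s) (at x) w * inverse (F s x)))" for w
      by (intro Ckp_minus Ckp_mult assms(1) IH F(2))
  qed fact
qed

section \<open>Expansion of derivatives in the basis and the chain rule\<close>

lemma linear_frechet_sum:
  fixes F :: "'a::euclidean_space \<Rightarrow> 'b::real_normed_vector"
  assumes "linear D"
  shows "D w = (\<Sum>b\<in>Basis. inner w b *\<^sub>R D b)"
proof -
  have "D w = D (\<Sum>b\<in>Basis. inner w b *\<^sub>R b)" by (simp add: euclidean_representation)
  also have "\<dots> = (\<Sum>b\<in>Basis. inner w b *\<^sub>R D b)"
    using assms by (simp add: linear_sum linear_scale)
  finally show ?thesis .
qed

lemma frechet_sum_Basis:
  fixes F :: "'a::euclidean_space \<Rightarrow> 'b::real_normed_vector"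
  assumes "F differentiable (at x)"
  shows "frechet_derivative F (at x) w = (\<Sum>b\<in>Basis. inner w b *\<^sub>R frechet_derivative F (at x) b)"
  using linear_frechet_sum has_derivative_linear[OF has_derivative_frechet[OF assms]] by blast

lemma continuous_on_const_param:
  "continuous_on ({0::real} \<times> U) (\<lambda>p. F (snd p)) \<longleftrightarrow> continuous_on U F"
proof
  assume *: "continuous_on ({0::real} \<times> U) (\<lambda>p. F (snd p))"
  have "continuous_on U (\<lambda>x. (0::real, x))" by (intro continuous_intros)
  from continuous_on_compose2[OF * this] show "continuous_on U F" by auto
next
  assume *: "continuous_on U F"
  show "continuous_on ({0::real} \<times> U) (\<lambda>p. F (snd p))"
    by (rule continuous_on_compose2[OF * continuous_on_snd[OF continuous_on_id]]) auto
qed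

text \<open>In the chain rule the direction in which \<open>H s\<close> is differentiated moves with
  \<open>x\<close>, while \<open>Ckp\<close> controls fixed directions. Expanding the direction in
  \<open>Basis\<close> turns the derivative into a finite sum of products of class
  \<open>k\<close>.\<close>

lemma Ckp_compose_family:
  fixes H :: "'s::topological_space \<Rightarrow> 'b::euclidean_space \<Rightarrow> 'c::real_normed_vector"
    and F :: "'s \<Rightarrow> 'a::real_normed_vector \<Rightarrow> 'b"
  assumes "open U" "open W" "Ckp k T W H" "Ckp k T U F" "\<And>s x. s \<in> T \<Longrightarrow> x \<in> U \<Longrightarrow> F s x \<in> W"
  shows "Ckp k T U (\<lambda>s x. H s (F s x))"
  using assms(3,4)
proof (induction k arbitrary: H)
  have cont: "continuous_on (T \<times> U) (\<lambda>p. H (fst p) (F (fst p) (snd p)))" if "Ckp k T W H" "Ckp k T U F" for k H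
  proof -
    have "continuous_on (T \<times> U) (\<lambda>p. (fst p, F (fst p) (snd p)))"
      by (intro continuous_on_Pair continuous_on_fst continuous_on_id Ckp_continuous[OF that(2)])
    moreover have "(\<lambda>p. (fst p, F (fst p) (snd p))) ` (T \<times> U) \<subseteq> T \<times> W" using assms(5) by auto
    ultimately show ?thesis using continuous_on_compose2[OF Ckp_continuous[OF that(1)]] by fastforce
  qed
  {
    case 0
    then show ?case using cont[of 0 H] by simp
  next
    case (Suc k)
    note H = Ckp_SucD[OF Suc.prems(1)]
    note F = Ckp_SucD[OF Suc.prems(2)]
    show ?case
    proof (rule Ckp_SucI[where D="\<lambda>s x w. \<Sum>b\<in>Basis. inner (frechet_derivative (F s) (at x) w) b *\<^sub>R frechet_derivative (H s) (at (F s x)) b"])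
      show "continuous_on (T \<times> U) (\<lambda>p. H (fst p) (F (fst p) (snd p)))"
        by (rule cont[OF Suc.prems])
      show "((\<lambda>x. H s (F s x)) has_derivative
             (\<lambda>w. \<Sum>b\<in>Basis. inner (frechet_derivative (F s) (at x) w) b *\<^sub>R frechet_derivative (H s) (at (F s x)) b)) (at x)"
        if "s \<in> T" "x \<in> U" for s x
      proof -
        have dH: "(H s has_derivative frechet_derivative (H s) (at (F s x))) (at (F s x))"
          using H(1)[OF that(1) assms(5)[OF that]] .
        have "((\<lambda>x. H s (F s x)) has_derivative
             (\<lambda>w. frechet_derivative (H s) (at (F s x)) (frechet_derivative (F s) (at x) w))) (at x)"
          using has_derivative_compose[OF F(1)[OF that] dH] .
        moreover have "(\<lambda>w. frechet_derivative (H s) (at (F s x)) (frechet_derivative (F s) (at x) w)) =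
          (\<lambda>w. \<Sum>b\<in>Basis. inner (frechet_derivative (F s) (at x) w) b *\<^sub>R frechet_derivative (H s) (at (F s x)) b)"
          by (rule ext) (rule frechet_sum_Basis[OF differentiableI[OF dH]])
        ultimately show ?thesis by simp
      qed
      show "Ckp k T U (\<lambda>s x. \<Sum>b\<in>Basis. inner (frechet_derivative (F s) (at x) w) b *\<^sub>R frechet_derivative (H s) (at (F s x)) b)" for w
      proof (intro Ckp_sum Ckp_scaleR assms(1))
        fix b :: 'b
        show "Ckp k T U (\<lambda>s x. inner (frechet_derivative (F s) (at x) w) b)"
          using Ckp_compose_linear[OF assms(1) bounded_linear_inner_left F(2)] .
        show "Ckp k T U (\<lambda>s x. frechet_derivative (H s) (at (F s x)) b)"
          using Suc.IH[OF H(2) Ckp_Suc_imp[OF Suc.prems(2)]] .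
      qed
    qed fact
  }
qed

lemma Ckp_compose:
  fixes H :: "'b::euclidean_space \<Rightarrow> 'c::real_normed_vector"
  assumes "open U" "open W" "Ckp k {0::real} W (\<lambda>_. H)" "Ckp k T U F" "\<And>s x. s \<in> T \<Longrightarrow> x \<in> U \<Longrightarrow> F s x \<in> W"
  shows "Ckp k T U (\<lambda>s x. H (F s x))"
  by (rule Ckp_compose_family[OF assms(1,2) Ckp_const_param[OF assms(3)] assms(4,5)]) simp

section \<open>Functions without a parameter, as families over a one-point set\<close>

lemma Ck_on_iff_Ckp:
  assumes "open U"
  shows "Ck_on k U F \<longleftrightarrow> Ckp k {0::real} U (\<lambda>_. F)"
proof (induction k arbitrary: F)
  case 0
  show ?case using continuous_on_const_param[of U F] by simp
next
  case (Suc k)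
  \<comment> \<open>At successor order \<open>Ck_on\<close> does not list continuity, which here
    follows from differentiability since there is no parameter.\<close>
  have "continuous_on U F" if "\<forall>x\<in>U. F differentiable (at x)"
    using that differentiable_imp_continuous_within continuous_at_imp_continuous_on by blast
  then show ?case using Suc continuous_on_const_param[of U F] by auto
qed

lemma smooth_on_iff_Ckp:
  assumes "open U"
  shows "smooth_on U F \<longleftrightarrow> (\<forall>k. Ckp k {0::real} U (\<lambda>_. F))"
  by (simp add: smooth_on_def Ck_on_iff_Ckp[OF assms])

lemma smooth_on_Ckp: "open U \<Longrightarrow> smooth_on U F \<Longrightarrow> Ckp k T U (\<lambda>_. F)"
  using smooth_on_iff_Ckp Ckp_const_param by blast

lemma smooth_on_differentiable: "smooth_on U F \<Longrightarrow> x \<in> U \<Longrightarrow> F differentiable (at x)"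
  unfolding smooth_on_def by (metis Ck_on.simps(2))

lemma smooth_on_frechet: "smooth_on U F \<Longrightarrow> smooth_on U (\<lambda>x. frechet_derivative F (at x) w)"
  unfolding smooth_on_def by (metis Ck_on.simps(2))

lemma smooth_on_has_derivative:
  "smooth_on U F \<Longrightarrow> x \<in> U \<Longrightarrow> (F has_derivative frechet_derivative F (at x)) (at x)"
  using has_derivative_frechet smooth_on_differentiable by blast

lemma smooth_on_continuous: "smooth_on U F \<Longrightarrow> continuous_on U F"
  unfolding smooth_on_def by (metis Ck_on.simps(1))

lemma smooth_on_subset: "smooth_on U F \<Longrightarrow> open U \<Longrightarrow> open V \<Longrightarrow> V \<subseteq> U \<Longrightarrow> smooth_on V F"
  using smooth_on_iff_Ckp Ckp_subset by (metis subset_refl)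

lemma smooth_on_cong: "open U \<Longrightarrow> (\<And>x. x \<in> U \<Longrightarrow> F x = G x) \<Longrightarrow> smooth_on U F \<longleftrightarrow> smooth_on U G"
  using smooth_on_iff_Ckp Ckp_cong[of U "{0::real}" "\<lambda>_. F" "\<lambda>_. G"] by metis

lemma smooth_on_const: "open U \<Longrightarrow> smooth_on U (\<lambda>x. c)"
  using smooth_on_iff_Ckp Ckp_const by metis

lemma smooth_on_linear: "open U \<Longrightarrow> bounded_linear L \<Longrightarrow> smooth_on U L"
  using smooth_on_iff_Ckp Ckp_linear by metis

lemma smooth_on_compose_linear: "open U \<Longrightarrow> bounded_linear L \<Longrightarrow> smooth_on U F \<Longrightarrow> smooth_on U (\<lambda>x. L (F x))"
  using smooth_on_iff_Ckp[of U] Ckp_compose_linear[of U L _ "{0::real}" "\<lambda>_. F"] by metis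

lemma smooth_on_add: "open U \<Longrightarrow> smooth_on U F \<Longrightarrow> smooth_on U G \<Longrightarrow> smooth_on U (\<lambda>x. F x + G x)"
  using smooth_on_iff_Ckp[of U] Ckp_add[of U _ "{0::real}" "\<lambda>_. F" "\<lambda>_. G"] by metis

lemma smooth_on_diff: "open U \<Longrightarrow> smooth_on U F \<Longrightarrow> smooth_on U G \<Longrightarrow> smooth_on U (\<lambda>x. F x - G x)"
  using smooth_on_iff_Ckp[of U] Ckp_diff[of U _ "{0::real}" "\<lambda>_. F" "\<lambda>_. G"] by metis

lemma smooth_on_minus: "open U \<Longrightarrow> smooth_on U F \<Longrightarrow> smooth_on U (\<lambda>x. - F x)"
  using smooth_on_iff_Ckp[of U] Ckp_minus[of U _ "{0::real}" "\<lambda>_. F"] by metis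

lemma smooth_on_scaleR: "open U \<Longrightarrow> smooth_on U F \<Longrightarrow> smooth_on U G \<Longrightarrow> smooth_on U (\<lambda>x. F x *\<^sub>R G x)"
  using smooth_on_iff_Ckp[of U] Ckp_scaleR[of U _ "{0::real}" "\<lambda>_. F" "\<lambda>_. G"] by metis

lemma smooth_on_mult:
  fixes F :: "'a::real_normed_vector \<Rightarrow> 'b::real_normed_algebra"
  shows "open U \<Longrightarrow> smooth_on U F \<Longrightarrow> smooth_on U G \<Longrightarrow> smooth_on U (\<lambda>x. F x * G x)"
  using smooth_on_iff_Ckp[of U] Ckp_mult[of U _ "{0::real}" "\<lambda>_. F" "\<lambda>_. G"] by metis

lemma smooth_on_sum:
  assumes "open U" "\<And>i. i \<in> I \<Longrightarrow> smooth_on U (F i)"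
  shows "smooth_on U (\<lambda>x. \<Sum>i\<in>I. F i x)"
  using assms smooth_on_iff_Ckp[of U] Ckp_sum[of U I _ "{0::real}" "\<lambda>i _. F i"] by metis

lemma smooth_on_compose:
  fixes H :: "'b::euclidean_space \<Rightarrow> 'c::real_normed_vector"
  assumes "open U" "open W" "smooth_on W H" "smooth_on U F" "\<And>x. x \<in> U \<Longrightarrow> F x \<in> W"
  shows "smooth_on U (\<lambda>x. H (F x))"
  using assms smooth_on_iff_Ckp[of U] smooth_on_iff_Ckp[of W] Ckp_compose[of U W _ H "{0::real}" "\<lambda>_. F"] by metis

lemma smooth_on_Basis_comp:
  fixes F :: "'a::real_normed_vector \<Rightarrow> 'b::euclidean_space"
  assumes "open U" "\<And>b. b \<in> Basis \<Longrightarrow> smooth_on U (\<lambda>x. inner (F x) b)"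
  shows "smooth_on U F"
proof -
  have "smooth_on U (\<lambda>x. \<Sum>b\<in>Basis. inner (F x) b *\<^sub>R b)"
    using assms by (intro smooth_on_sum smooth_on_scaleR smooth_on_const) auto
  then show ?thesis by (simp add: euclidean_representation)
qed

text \<open>The same expansion in \<open>Basis\<close>, now for a moving direction field. It makes
  the derivatives along \<open>f\<close> and along the inputs smooth.\<close>

lemma smooth_on_frechet_apply:
  fixes F :: "'a::euclidean_space \<Rightarrow> 'b::real_normed_vector"
  assumes "open U" "smooth_on U F" "smooth_on U X"
  shows "smooth_on U (\<lambda>x. frechet_derivative F (at x) (X x))"
proof -
  have "smooth_on U (\<lambda>x. \<Sum>b\<in>Basis. inner (X x) b *\<^sub>R frechet_derivative F (at x) b)"
    using assms by (intro smooth_on_sum smooth_on_scaleR smooth_on_frechet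
        smooth_on_compose_linear[OF _ bounded_linear_inner_left]) auto
  moreover have "(\<Sum>b\<in>Basis. inner (X x) b *\<^sub>R frechet_derivative F (at x) b) = frechet_derivative F (at x) (X x)"
    if "x \<in> U" for x
    by (rule sym) (rule frechet_sum_Basis[OF smooth_on_differentiable[OF assms(2) that]])
  ultimately show ?thesis
    using smooth_on_cong[OF assms(1), of "\<lambda>x. \<Sum>b\<in>Basis. inner (X x) b *\<^sub>R frechet_derivative F (at x) b"
        "\<lambda>x. frechet_derivative F (at x) (X x)"] by simp
qed

section \<open>Volterra equations depending on a parameter\<close>

lemma Ckp_fun_param:
  assumes "open U" "continuous_on T f"
  shows "Ckp k T U (\<lambda>s x. f s)"
proof -
  have c: "continuous_on (T \<times> U) (\<lambda>p. f (fst p))"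
    by (rule continuous_on_compose2[OF assms(2) continuous_on_fst[OF continuous_on_id]]) auto
  show ?thesis
  proof (cases k)
    case 0
    then show ?thesis using c by simp
  next
    case (Suc n)
    show ?thesis unfolding Suc
      by (rule Ckp_SucI[where D="\<lambda>_ _ _. 0"]) (use assms c in \<open>auto intro: Ckp_const\<close>)
  qed
qed

lemma Ckp_continuous_fiber:
  assumes "Ckp k T U F" "x \<in> U"
  shows "continuous_on T (\<lambda>s. F s x)"
proof -
  have "continuous_on T (\<lambda>s. (s, x))" by (intro continuous_intros)
  from continuous_on_compose2[OF Ckp_continuous[OF assms(1)] this] assms(2) show ?thesis by auto
qed

text \<open>The integral of \<open>f\<close> from 0 to \<open>s\<close>, rescaled so that \<open>s\<close> is a parameter of the integrand.\<close>

definition primitive :: "(real \<Rightarrow> 'b::euclidean_space) \<Rightarrow> real \<Rightarrow> 'b" where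
  "primitive f s = s *\<^sub>R integral {0..1} (\<lambda>\<sigma>. f (s * \<sigma>))"

section \<open>Calculus of the rescaled primitive\<close>

lemma unit_mult_closed: "s \<in> {0..1::real} \<Longrightarrow> t \<in> {0..1} \<Longrightarrow> s * t \<in> {0..1}"
  by (auto simp: mult_le_one)

lemma primitive_cong: "(\<And>\<sigma>. \<sigma> \<in> {0..1} \<Longrightarrow> f \<sigma> = g \<sigma>) \<Longrightarrow> s \<in> {0..1} \<Longrightarrow> primitive f s = primitive g s"
  unfolding primitive_def by (auto intro!: integral_cong simp: unit_mult_closed simp del: atLeastAtMost_iff)

lemma primitive_continuous_scaled:
  assumes "continuous_on {0..1} f" "s \<in> {0..1::real}"
  shows "continuous_on {0..1} (\<lambda>\<sigma>. f (s * \<sigma>))"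
  by (rule continuous_on_compose2[OF assms(1)])
    (use assms(2) in \<open>auto intro!: continuous_intros simp: unit_mult_closed simp del: atLeastAtMost_iff\<close>)

lemma primitive_integrable:
  fixes f :: "real \<Rightarrow> 'b::euclidean_space"
  assumes "continuous_on {0..1} f" "s \<in> {0..1::real}"
  shows "(\<lambda>\<sigma>. f (s * \<sigma>)) integrable_on {0..1}"
  using integrable_continuous_interval[OF primitive_continuous_scaled[OF assms]] .

lemma primitive_add:
  assumes "continuous_on {0..1} f" "continuous_on {0..1} g" "s \<in> {0..1}"
  shows "primitive (\<lambda>\<sigma>. f \<sigma> + g \<sigma>) s = primitive f s + primitive g s"
  using Henstock_Kurzweil_Integration.integral_add[OF primitive_integrable[OF assms(1,3)] primitive_integrable[OF assms(2,3)]]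
  by (simp add: primitive_def scaleR_add_right)

lemma primitive_diff:
  assumes "continuous_on {0..1} f" "continuous_on {0..1} g" "s \<in> {0..1}"
  shows "primitive (\<lambda>\<sigma>. f \<sigma> - g \<sigma>) s = primitive f s - primitive g s"
  using Henstock_Kurzweil_Integration.integral_diff[OF primitive_integrable[OF assms(1,3)] primitive_integrable[OF assms(2,3)]]
  by (simp add: primitive_def flip: scaleR_diff_right)

lemma primitive_scaleR: "primitive (\<lambda>\<sigma>. c *\<^sub>R f \<sigma>) s = c *\<^sub>R primitive f s"
  by (simp add: primitive_def)

lemma primitive_bound:
  assumes "continuous_on {0..1} f" "s \<in> {0..1}" "\<And>\<sigma>. \<sigma> \<in> {0..1} \<Longrightarrow> norm (f \<sigma>) \<le> c"
  shows "norm (primitive f s) \<le> c"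
proof -
  have "0 \<le> c" using assms(3)[of 0] norm_ge_zero by (meson atLeastAtMost_iff order_refl order_trans zero_le_one)
  have "norm (integral {0..1} (\<lambda>\<sigma>. f (s * \<sigma>))) \<le> c * (1 - 0)"
    by (rule integral_bound[OF _ primitive_continuous_scaled[OF assms(1,2)]])
      (use assms in \<open>auto simp: unit_mult_closed simp del: atLeastAtMost_iff\<close>)
  then have "norm (primitive f s) \<le> s * c" using assms(2) by (simp add: primitive_def mult_left_mono)
  also have "\<dots> \<le> c" using assms(2) \<open>0 \<le> c\<close> by (simp add: mult_left_le_one_le)
  finally show ?thesis .
qed

lemma primitive_continuous:
  fixes f :: "real \<Rightarrow> 'a::topological_space \<Rightarrow> 'b::euclidean_space"
  assumes "continuous_on ({0..1} \<times> U) (\<lambda>p. f (fst p) (snd p))"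
  shows "continuous_on ({0..1} \<times> U) (\<lambda>p. primitive (\<lambda>\<sigma>. f \<sigma> (snd p)) (fst p))"
proof -
  have "continuous_on (({0..1} \<times> U) \<times> cbox 0 (1::real)) (\<lambda>q. f (fst (fst q) * snd q) (snd (fst q)))"
    by (rule continuous_on_compose2[OF assms, of _ "\<lambda>q. (fst (fst q) * snd q, snd (fst q))", simplified])
      (auto intro!: continuous_intros simp: mult_le_one)
  then have "continuous_on ({0..1} \<times> U) (\<lambda>p. integral (cbox 0 1) (\<lambda>\<sigma>. f (fst p * \<sigma>) (snd p)))"
    by (intro integral_continuous_on_param) (simp add: case_prod_beta)
  then show ?thesis unfolding primitive_def by (auto intro!: continuous_intros)
qed

text \<open>Differentiation under the integral sign. Leibniz's rule wants the derivative as a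
  continuous map into bounded linear operators; in finite dimension this continuity can be checked
  direction by direction, which is what \<open>Ckp\<close> supplies.\<close>

lemma primitive_has_derivative:
  fixes f :: "real \<Rightarrow> 'a::euclidean_space \<Rightarrow> 'b::euclidean_space"
  assumes "open U" "Ckp (Suc k) {0..1} U f" "s \<in> {0..1}" "x \<in> U"
  shows "((\<lambda>x. primitive (\<lambda>\<sigma>. f \<sigma> x) s) has_derivative (\<lambda>w. primitive (\<lambda>\<sigma>. frechet_derivative (f \<sigma>) (at x) w) s)) (at x)"
proof -
  obtain r where r: "r > 0" "ball x r \<subseteq> U" using assms(1,4) open_contains_ball by blast
  define D where "D z t = Blinfun (frechet_derivative (f (s * t)) (at z))" for z t
  note f = Ckp_SucD[OF assms(2)]
  have D: "blinfun_apply (D z t) = frechet_derivative (f (s * t)) (at z)" if "z \<in> U" "t \<in> {0..1}" for z t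
    unfolding D_def using f(1)[OF unit_mult_closed[OF assms(3) that(2)] that(1)]
    by (simp add: bounded_linear_Blinfun_apply has_derivative_bounded_linear)
  have cont: "continuous_on (ball x r \<times> cbox 0 1) (\<lambda>(z, t). D z t)"
  proof (rule continuous_on_blinfun_componentwise)
    fix i :: 'a
    have "continuous_on ({0..1} \<times> U) (\<lambda>p. frechet_derivative (f (fst p)) (at (snd p)) i)"
      using Ckp_continuous[OF f(2)] .
    moreover have "continuous_on (ball x r \<times> cbox 0 1) (\<lambda>q. (s * snd q, fst q))" by (intro continuous_intros)
    moreover have "(\<lambda>q. (s * snd q, fst q)) ` (ball x r \<times> cbox 0 1) \<subseteq> {0..1} \<times> U"
      using r(2) assms(3) by (auto simp: mult_le_one)
    ultimately have "continuous_on (ball x r \<times> cbox 0 1) (\<lambda>q. frechet_derivative (f (fst (s * snd q, fst q))) (at (snd (s * snd q, fst q))) i)"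
      by (rule continuous_on_compose2)
    then have "continuous_on (ball x r \<times> cbox 0 1) (\<lambda>q. frechet_derivative (f (s * snd q)) (at (fst q)) i)" by simp
    then show "continuous_on (ball x r \<times> cbox 0 1) (\<lambda>q. blinfun_apply (case q of (z, t) \<Rightarrow> D z t) i)"
      by (rule continuous_on_eq) (use r D in auto)
  qed
  have "((\<lambda>z. integral (cbox 0 1) (\<lambda>t. f (s * t) z)) has_derivative integral (cbox 0 1) (D x)) (at x within ball x r)"
  proof (rule leibniz_rule[OF _ _ cont])
    fix z assume "z \<in> ball x r"
    then have z: "z \<in> U" using r by blast
    show "((\<lambda>z. f (s * t) z) has_derivative blinfun_apply (D z t)) (at z within ball x r)"
      if "t \<in> cbox 0 1" for t
      using that z f(1)[OF unit_mult_closed[OF assms(3)], of t z] D[of z t]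
      by (simp add: has_derivative_at_withinI)
    show "(\<lambda>t. f (s * t) z) integrable_on cbox 0 1"
      using primitive_integrable[OF Ckp_continuous_fiber[OF assms(2) z] assms(3)] by simp
  qed (simp_all add: r(1))
  then have "((\<lambda>z. integral {0..1} (\<lambda>t. f (s * t) z)) has_derivative integral {0..1} (D x)) (at x)"
    using r(1) by (simp add: at_within_open[of x "ball x r"])
  from has_derivative_scaleR_right[OF this, of s]
  have "((\<lambda>x. primitive (\<lambda>\<sigma>. f \<sigma> x) s) has_derivative (\<lambda>w. s *\<^sub>R blinfun_apply (integral {0..1} (D x)) w)) (at x)"
    by (simp add: primitive_def)
  \<comment> \<open>Evaluation at \<open>w\<close> is linear and bounded, so it passes under the
    operator-valued integral.\<close>
  moreover have "s *\<^sub>R blinfun_apply (integral {0..1} (D x)) w = primitive (\<lambda>\<sigma>. frechet_derivative (f \<sigma>) (at x) w) s" for w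
  proof -
    have "continuous_on {0..1} (\<lambda>t. case (x, t) of (z, t) \<Rightarrow> D z t)"
      by (rule continuous_on_compose2[OF cont]) (use r in \<open>auto intro!: continuous_intros\<close>)
    then have "D x integrable_on {0..1}" by (intro integrable_continuous_interval) simp
    from integral_linear[OF this blinfun.bounded_linear_left[of w]]
    have "blinfun_apply (integral {0..1} (D x)) w = integral {0..1} (\<lambda>t. D x t w)"
      by (simp add: o_def)
    also have "\<dots> = integral {0..1} (\<lambda>t. frechet_derivative (f (s * t)) (at x) w)"
      by (rule integral_cong) (simp add: D[OF assms(4)])
    finally show ?thesis by (simp add: primitive_def)
  qed
  ultimately show ?thesis by simp
qed

lemma Ckp_primitive:
  fixes f :: "real \<Rightarrow> 'a::euclidean_space \<Rightarrow> 'b::euclidean_space"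
  assumes "open U" "Ckp k {0..1} U f"
  shows "Ckp k {0..1} U (\<lambda>s x. primitive (\<lambda>\<sigma>. f \<sigma> x) s)"
  using assms(2)
proof (induction k arbitrary: f)
  case 0
  then show ?case using primitive_continuous[of U f] by simp
next
  case (Suc k)
  show ?case
  proof (rule Ckp_SucI[where D="\<lambda>s x w. primitive (\<lambda>\<sigma>. frechet_derivative (f \<sigma>) (at x) w) s"])
    show "continuous_on ({0..1} \<times> U) (\<lambda>p. primitive (\<lambda>\<sigma>. f \<sigma> (snd p)) (fst p))"
      using primitive_continuous[of U f, OF Ckp_continuous[OF Suc.prems]] .
    show "((\<lambda>x. primitive (\<lambda>\<sigma>. f \<sigma> x) s) has_derivative (\<lambda>w. primitive (\<lambda>\<sigma>. frechet_derivative (f \<sigma>) (at x) w) s)) (at x)"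
      if "s \<in> {0..1}" "x \<in> U" for s x
      using primitive_has_derivative[OF assms(1) Suc.prems that] .
    show "Ckp k {0..1} U (\<lambda>s x. primitive (\<lambda>\<sigma>. frechet_derivative (f \<sigma>) (at x) w) s)" for w
      using Suc.IH[OF Ckp_SucD(2)[OF Suc.prems, of w]] .
  qed (rule assms(1))
qed

text \<open>The fundamental theorem is applied to the integral from 0 to \<open>s * \<sigma>\<close>
  as a function of \<open>\<sigma>\<close>. This avoids a division by \<open>s\<close> and so covers
  \<open>s = 0\<close>.\<close>

lemma primitive_eq_integral:
  assumes "continuous_on {0..1} f" "s \<in> {0..1}"
  shows "primitive f s = integral {0..s} f"
proof -
  have "((\<lambda>\<sigma>. s *\<^sub>R f (s * \<sigma>)) has_integral (integral {0..s * 1} f - integral {0..s * 0} f)) {0..1}"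
  proof (rule fundamental_theorem_of_calculus[where f="\<lambda>\<sigma>. integral {0..s * \<sigma>} f"])
    fix \<sigma> :: real assume \<sigma>: "\<sigma> \<in> {0..1}"
    have *: "((\<lambda>t. integral {0..t} f) has_vector_derivative f (s * \<sigma>)) (at (s * \<sigma>) within (\<lambda>\<sigma>. s * \<sigma>) ` {0..1})"
      using integral_has_vector_derivative[OF assms(1) unit_mult_closed[OF assms(2) \<sigma>]]
      by (rule has_vector_derivative_within_subset) (use assms(2) in \<open>auto simp: mult_le_one\<close>)
    have "((\<lambda>\<sigma>. s * \<sigma>) has_vector_derivative s) (at \<sigma> within {0..1})"
      by (auto intro!: derivative_eq_intros)
    from vector_diff_chain_within[OF this *]
    show "((\<lambda>\<sigma>. integral {0..s * \<sigma>} f) has_vector_derivative s *\<^sub>R f (s * \<sigma>)) (at \<sigma> within {0..1})"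
      by (simp add: o_def)
  qed simp
  from integral_unique[OF this] have "integral {0..1} (\<lambda>\<sigma>. s *\<^sub>R f (s * \<sigma>)) = integral {0..s} f" by simp
  then show ?thesis by (simp add: primitive_def)
qed

lemma primitive_has_vector_derivative:
  assumes "continuous_on {0..1} f" "s \<in> {0..1}"
  shows "(primitive f has_vector_derivative f s) (at s within {0..1})"
  by (rule has_vector_derivative_transform[OF assms(2) _ integral_has_vector_derivative[OF assms]])
    (simp add: primitive_eq_integral[OF assms(1)])

lemma primitive_fundamental:
  assumes "\<And>s. s \<in> {0..1} \<Longrightarrow> (W has_vector_derivative w s) (at s within {0..1})" "continuous_on {0..1} w" "s \<in> {0..1}"
  shows "W s = W 0 + primitive w s"
proof -
  have "(w has_integral (W s - W 0)) {0..s}"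
  proof (rule fundamental_theorem_of_calculus)
    show "(W has_vector_derivative w t) (at t within {0..s})" if "t \<in> {0..s}" for t
      by (rule has_vector_derivative_within_subset[OF assms(1)]) (use that assms(3) in auto)
  qed (use assms(3) in simp)
  then show ?thesis using primitive_eq_integral[OF assms(2,3)] by (simp add: integral_unique)
qed

text \<open>Let \<open>M\<close> be the maximum of the norm, attained by compactness:
  \<open>M \<le> e + 3/4 * M\<close> gives \<open>M \<le> 4 * e\<close>. The constant 3/4 leaves 1/2
  for the Lipschitz constant of the equation and 1/4 for the remainder of a linearisation.\<close>

lemma contraction_bound:
  fixes u :: "real \<Rightarrow> 'b::real_normed_vector"
  assumes "continuous_on {0..1} u"
    and step: "\<And>M s. (\<And>\<sigma>. \<sigma> \<in> {0..1} \<Longrightarrow> norm (u \<sigma>) \<le> M) \<Longrightarrow> s \<in> {0..1} \<Longrightarrow> norm (u s) \<le> e + 3/4 * M"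
    and "s \<in> {0..1}"
  shows "norm (u s) \<le> 4 * e"
proof -
  obtain t where t: "t \<in> {0..1}" "\<And>\<sigma>. \<sigma> \<in> {0..1} \<Longrightarrow> norm (u \<sigma>) \<le> norm (u t)"
    using continuous_attains_sup[of "{0..1::real}" "\<lambda>s. norm (u s)"] continuous_on_norm[OF assms(1)] by auto
  have "norm (u t) \<le> e + 3/4 * norm (u t)" using step[OF t(2) t(1)] .
  then show ?thesis using t(2)[OF assms(3)] by linarith
qed

text \<open>With Lipschitz constant 1/2 on an interval of length 1, the difference of two solutions
  is bounded by half of its own maximum.\<close>

lemma volterra_unique:
  assumes "continuous_on {0..1} y" "continuous_on {0..1} z"
    and "continuous_on {0..1} (\<lambda>s. F s (y s))" "continuous_on {0..1} (\<lambda>s. F s (z s))"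
    and "\<And>s. s \<in> {0..1} \<Longrightarrow> norm (F s (y s) - F s (z s)) \<le> norm (y s - z s) / 2"
    and "\<And>s. s \<in> {0..1} \<Longrightarrow> y s = B s + primitive (\<lambda>\<sigma>. F \<sigma> (y \<sigma>)) s"
    and "\<And>s. s \<in> {0..1} \<Longrightarrow> z s = B s + primitive (\<lambda>\<sigma>. F \<sigma> (z \<sigma>)) s"
    and "s \<in> {0..1}"
  shows "y s = z s"
proof -
  have "norm (y s - z s) \<le> 4 * 0"
  proof (rule contraction_bound[OF _ _ assms(8)])
    show "continuous_on {0..1} (\<lambda>s. y s - z s)" using assms(1,2) by (rule continuous_on_diff)
    fix M t assume M: "\<And>\<sigma>. \<sigma> \<in> {0..1} \<Longrightarrow> norm (y \<sigma> - z \<sigma>) \<le> M" and t: "t \<in> {0..1::real}"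
    have "y t - z t = primitive (\<lambda>\<sigma>. F \<sigma> (y \<sigma>)) t - primitive (\<lambda>\<sigma>. F \<sigma> (z \<sigma>)) t"
      using assms(6,7)[OF t] by simp
    also have "\<dots> = primitive (\<lambda>\<sigma>. F \<sigma> (y \<sigma>) - F \<sigma> (z \<sigma>)) t"
      using primitive_diff[OF assms(3,4) t] by simp
    also have "norm \<dots> \<le> M / 2"
    proof (rule primitive_bound[OF _ t])
      show "continuous_on {0..1} (\<lambda>\<sigma>. F \<sigma> (y \<sigma>) - F \<sigma> (z \<sigma>))" using assms(3,4) by (rule continuous_on_diff)
      show "norm (F \<sigma> (y \<sigma>) - F \<sigma> (z \<sigma>)) \<le> M / 2" if "\<sigma> \<in> {0..1}" for \<sigma>
        using assms(5)[OF that] M[OF that] by linarith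
    qed
    finally have "norm (y t - z t) \<le> M / 2" .
    moreover have "0 \<le> M" using M[OF t] norm_ge_zero order_trans by blast
    ultimately show "norm (y t - z t) \<le> 0 + 3/4 * M" by linarith
  qed
  then show ?thesis by simp
qed

text \<open>The iteration treats all \<open>x\<close> in \<open>K\<close> at once, so that the
  uniform limit is continuous in \<open>(s, x)\<close> jointly. \<open>Q\<close> is a closed set
  preserved by the integral operator: the whole space for linear equations, a closed ball for the
  flow.\<close>

lemma picard_fixpoint:
  fixes G :: "real \<Rightarrow> 'a::topological_space \<Rightarrow> 'b::euclidean_space \<Rightarrow> 'b"
  assumes K: "compact K" and Q: "closed Q" "q \<in> Q"
    and B: "continuous_on ({0..1} \<times> K) (\<lambda>p. B (fst p) (snd p))"
    and G: "\<And>y. continuous_on ({0..1} \<times> K) (\<lambda>p. y (fst p) (snd p)) \<Longrightarrow> (\<And>s x. s \<in> {0..1} \<Longrightarrow> x \<in> K \<Longrightarrow> y s x \<in> Q) \<Longrightarrow>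
       continuous_on ({0..1} \<times> K) (\<lambda>p. G (fst p) (snd p) (y (fst p) (snd p)))"
    and T: "\<And>y s x. continuous_on ({0..1} \<times> K) (\<lambda>p. y (fst p) (snd p)) \<Longrightarrow> (\<And>s x. s \<in> {0..1} \<Longrightarrow> x \<in> K \<Longrightarrow> y s x \<in> Q) \<Longrightarrow>
       s \<in> {0..1} \<Longrightarrow> x \<in> K \<Longrightarrow> B s x + primitive (\<lambda>\<sigma>. G \<sigma> x (y \<sigma> x)) s \<in> Q"
    and L: "\<And>s x y z. s \<in> {0..1} \<Longrightarrow> x \<in> K \<Longrightarrow> y \<in> Q \<Longrightarrow> z \<in> Q \<Longrightarrow> norm (G s x y - G s x z) \<le> norm (y - z) / 2"
  obtains y where "continuous_on ({0..1} \<times> K) (\<lambda>p. y (fst p) (snd p))"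
    and "\<And>s x. s \<in> {0..1} \<Longrightarrow> x \<in> K \<Longrightarrow> y s x \<in> Q"
    and "\<And>s x. s \<in> {0..1} \<Longrightarrow> x \<in> K \<Longrightarrow> y s x = B s x + primitive (\<lambda>\<sigma>. G \<sigma> x (y \<sigma> x)) s"
proof -
  define P where "P y \<longleftrightarrow> continuous_on ({0..1} \<times> K) (\<lambda>p. y (fst p) (snd p)) \<and> (\<forall>s\<in>{0..1}. \<forall>x\<in>K. y s x \<in> Q)"
    for y :: "real \<Rightarrow> 'a \<Rightarrow> 'b"
  define S where "S y = (\<lambda>s x. B s x + primitive (\<lambda>\<sigma>. G \<sigma> x (y \<sigma> x)) s)" for y
  define Y where "Y n = (S ^^ n) (\<lambda>_ _. q)" for n
  have fib: "continuous_on {0..1} (\<lambda>s. f s x)" if "continuous_on ({0..1} \<times> K) (\<lambda>p. f (fst p) (snd p))" "x \<in> K"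
    for f :: "real \<Rightarrow> 'a \<Rightarrow> 'b" and x
  proof -
    have "continuous_on {0..1::real} (\<lambda>s. (s, x))" by (intro continuous_intros)
    from continuous_on_compose2[OF that(1) this] that(2) show ?thesis by auto
  qed
  have PG: "continuous_on ({0..1} \<times> K) (\<lambda>p. G (fst p) (snd p) (y (fst p) (snd p)))" if "P y" for y
    using G[of y] that unfolding P_def by blast
  have PS: "P (S y)" if "P y" for y
    unfolding P_def
  proof
    show "continuous_on ({0..1} \<times> K) (\<lambda>p. S y (fst p) (snd p))"
      unfolding S_def using primitive_continuous[of K "\<lambda>\<sigma> x. G \<sigma> x (y \<sigma> x)"] PG[OF that] B by (auto intro: continuous_on_add)
    show "\<forall>s\<in>{0..1}. \<forall>x\<in>K. S y s x \<in> Q"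
      unfolding S_def using T[of y] that unfolding P_def by blast
  qed
  have PY: "P (Y n)" for n
  proof (induction n)
    case 0
    show ?case using Q by (simp add: Y_def P_def)
  next
    case (Suc n)
    then show ?case using PS by (simp add: Y_def)
  qed
  have contr: "norm (S y s x - S z s x) \<le> c / 2"
    if "P y" "P z" "s \<in> {0..1}" "x \<in> K" "\<And>\<sigma>. \<sigma> \<in> {0..1} \<Longrightarrow> norm (y \<sigma> x - z \<sigma> x) \<le> c" for y z s x c
  proof -
    have "S y s x - S z s x = primitive (\<lambda>\<sigma>. G \<sigma> x (y \<sigma> x) - G \<sigma> x (z \<sigma> x)) s"
      using primitive_diff[of "\<lambda>\<sigma>. G \<sigma> x (y \<sigma> x)" "\<lambda>\<sigma>. G \<sigma> x (z \<sigma> x)" s] fib[of "\<lambda>\<sigma> x. G \<sigma> x (y \<sigma> x)", OF PG[OF that(1)] that(4)]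
        fib[of "\<lambda>\<sigma> x. G \<sigma> x (z \<sigma> x)", OF PG[OF that(2)] that(4)] that(3) by (simp add: S_def)
    also have "norm \<dots> \<le> c / 2"
    proof (rule primitive_bound[OF _ that(3)])
      show "continuous_on {0..1} (\<lambda>\<sigma>. G \<sigma> x (y \<sigma> x) - G \<sigma> x (z \<sigma> x))"
        using fib[of "\<lambda>\<sigma> x. G \<sigma> x (y \<sigma> x)", OF PG[OF that(1)] that(4)]
          fib[of "\<lambda>\<sigma> x. G \<sigma> x (z \<sigma> x)", OF PG[OF that(2)] that(4)] by (rule continuous_on_diff)
      show "norm (G \<sigma> x (y \<sigma> x) - G \<sigma> x (z \<sigma> x)) \<le> c / 2" if "\<sigma> \<in> {0..1}" for \<sigma>
      proof -
        have "norm (G \<sigma> x (y \<sigma> x) - G \<sigma> x (z \<sigma> x)) \<le> norm (y \<sigma> x - z \<sigma> x) / 2"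
          using L that \<open>P y\<close> \<open>P z\<close> \<open>x \<in> K\<close> unfolding P_def by blast
        then show ?thesis using \<open>\<And>\<sigma>. \<sigma> \<in> {0..1} \<Longrightarrow> norm (y \<sigma> x - z \<sigma> x) \<le> c\<close>[OF that] by linarith
      qed
    qed
    finally show ?thesis .
  qed
  \<comment> \<open>Compactness of \<open>K\<close> bounds the first increment; the following
    increments are halved at each step.\<close>
  have "continuous_on ({0..1} \<times> K) (\<lambda>p. Y 1 (fst p) (snd p) - Y 0 (fst p) (snd p))"
    using PY unfolding P_def by (intro continuous_on_diff) auto
  then have "bounded ((\<lambda>p. Y 1 (fst p) (snd p) - Y 0 (fst p) (snd p)) ` ({0..1} \<times> K))"
    using K by (intro compact_imp_bounded compact_continuous_image compact_Times) auto
  then obtain c where c: "\<forall>v\<in>(\<lambda>p. Y 1 (fst p) (snd p) - Y 0 (fst p) (snd p)) ` ({0..1} \<times> K). norm v \<le> c"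
    unfolding bounded_iff by (rule exE)
  have c: "norm (Y 1 s x - Y 0 s x) \<le> c" if "s \<in> {0..1}" "x \<in> K" for s x
  proof -
    have "Y 1 s x - Y 0 s x \<in> (\<lambda>p. Y 1 (fst p) (snd p) - Y 0 (fst p) (snd p)) ` ({0..1} \<times> K)"
      using that by (intro image_eqI[of _ _ "(s, x)"]) auto
    then show ?thesis using c by blast
  qed
  have step: "norm (Y (Suc n) s x - Y n s x) \<le> c * (1/2)^n" if "s \<in> {0..1}" "x \<in> K" for n s x
    using that
  proof (induction n arbitrary: s)
    case 0
    then show ?case using c by simp
  next
    case (Suc n)
    have "norm (S (Y (Suc n)) s x - S (Y n) s x) \<le> c * (1/2)^n / 2"
      using Suc by (intro contr PY) auto
    then show ?case by (simp add: Y_def)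
  qed
  define y where "y s x = q + (\<Sum>n. Y (Suc n) s x - Y n s x)" for s x
  have "summable (\<lambda>n. c * (1/2::real)^n)" by (intro summable_mult summable_geometric) auto
  then have "uniform_limit ({0..1} \<times> K) (\<lambda>n p. \<Sum>i<n. Y (Suc i) (fst p) (snd p) - Y i (fst p) (snd p))
     (\<lambda>p. \<Sum>n. Y (Suc n) (fst p) (snd p) - Y n (fst p) (snd p)) sequentially"
    by (intro Weierstrass_m_test[of _ _ "\<lambda>n. c * (1/2::real)^n"]) (use step in auto)
  then have "uniform_limit ({0..1} \<times> K) (\<lambda>n p. q + (\<Sum>i<n. Y (Suc i) (fst p) (snd p) - Y i (fst p) (snd p)))
     (\<lambda>p. y (fst p) (snd p)) sequentially"
    unfolding y_def by (intro uniform_limit_add uniform_limit_const)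
  moreover have "q + (\<Sum>i<n. Y (Suc i) s x - Y i s x) = Y n s x" for n s x
    by (subst sum_lessThan_telescope) (simp add: Y_def)
  ultimately have ul: "uniform_limit ({0..1} \<times> K) (\<lambda>n p. Y n (fst p) (snd p)) (\<lambda>p. y (fst p) (snd p)) sequentially"
    by simp
  have yc: "continuous_on ({0..1} \<times> K) (\<lambda>p. y (fst p) (snd p))"
    by (rule uniform_limit_theorem[OF _ ul]) (use PY in \<open>auto simp: P_def\<close>)
  have yQ: "y s x \<in> Q" if "s \<in> {0..1}" "x \<in> K" for s x
  proof -
    have "(\<lambda>n. Y n s x) \<longlonglongrightarrow> y s x"
      using tendsto_uniform_limitI[OF ul, of "(s, x)"] that by simp
    moreover have "Y n s x \<in> Q" for n using PY[of n] that by (auto simp: P_def)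
    ultimately show ?thesis using closed_sequentially[OF Q(1), of "\<lambda>n. Y n s x"] by simp
  qed
  have Py: "P y" unfolding P_def using yc yQ by blast
  \<comment> \<open>A late iterate \<open>Y N\<close> is close to \<open>y\<close>. Its image under
    \<open>S\<close> is \<open>Y (Suc N)\<close>, which is close to \<open>y\<close> and, by
    contraction, to \<open>S y\<close>.\<close>
  have eq: "y s x = B s x + primitive (\<lambda>\<sigma>. G \<sigma> x (y \<sigma> x)) s" if "s \<in> {0..1}" "x \<in> K" for s x
  proof -
    have "norm (y s x - S y s x) \<le> 0 + e" if "e > 0" for e
    proof -
      have "\<forall>\<^sub>F n in sequentially. \<forall>p\<in>{0..1} \<times> K. dist (Y n (fst p) (snd p)) (y (fst p) (snd p)) < e/2"
        using uniform_limitD[OF ul, of "e/2"] that by auto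
      then obtain N where N: "\<forall>n\<ge>N. \<forall>p\<in>{0..1} \<times> K. dist (Y n (fst p) (snd p)) (y (fst p) (snd p)) < e/2"
        unfolding eventually_sequentially by (rule exE)
      have N': "norm (Y n \<sigma> x - y \<sigma> x) \<le> e/2" if "n \<ge> N" "\<sigma> \<in> {0..1}" for n \<sigma>
      proof -
        have "(\<sigma>, x) \<in> {0..1} \<times> K" using that \<open>x \<in> K\<close> by simp
        then have "dist (Y n (fst (\<sigma>, x)) (snd (\<sigma>, x))) (y (fst (\<sigma>, x)) (snd (\<sigma>, x))) < e/2"
          using N that(1) by blast
        then show ?thesis by (simp add: dist_norm)
      qed
      have "norm (S (Y N) s x - S y s x) \<le> e/2/2"
        using N' PY Py \<open>s \<in> {0..1}\<close> \<open>x \<in> K\<close> by (intro contr) auto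
      moreover have "norm (Y (Suc N) s x - y s x) \<le> e/2" using N'[of "Suc N"] \<open>s \<in> {0..1}\<close> by simp
      moreover have "norm (y s x - S y s x) = norm ((S (Y N) s x - S y s x) - (Y (Suc N) s x - y s x))"
        by (simp add: Y_def)
      ultimately show ?thesis using norm_triangle_ineq4[of "S (Y N) s x - S y s x" "Y (Suc N) s x - y s x"] that by linarith
    qed
    then have "norm (y s x - S y s x) \<le> 0" by (rule field_le_epsilon)
    then show ?thesis by (simp add: S_def)
  qed
  show ?thesis by (rule that[OF yc yQ eq])
qed

lemma primitive_sum:
  fixes f :: "'i \<Rightarrow> real \<Rightarrow> 'b::euclidean_space"
  assumes "finite I" "\<And>i. i \<in> I \<Longrightarrow> continuous_on {0..1} (f i)" "s \<in> {0..1}"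
  shows "primitive (\<lambda>\<sigma>. \<Sum>i\<in>I. c i *\<^sub>R f i \<sigma>) s = (\<Sum>i\<in>I. c i *\<^sub>R primitive (f i) s)"
  using assms(1,2)
proof (induction I rule: finite_induct)
  case empty
  show ?case by (simp add: primitive_def)
next
  case (insert a A)
  have "primitive (\<lambda>\<sigma>. c a *\<^sub>R f a \<sigma> + (\<Sum>i\<in>A. c i *\<^sub>R f i \<sigma>)) s = primitive (\<lambda>\<sigma>. c a *\<^sub>R f a \<sigma>) s + primitive (\<lambda>\<sigma>. \<Sum>i\<in>A. c i *\<^sub>R f i \<sigma>) s"
    using insert.prems assms(3) by (intro primitive_add continuous_on_scaleR continuous_on_sum continuous_on_const) auto
  then show ?case using insert by (simp add: primitive_scaleR)
qed

section \<open>Estimates with a radius that is uniform over the time interval\<close>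

lemma finite_uniform_radius:
  fixes P :: "'i \<Rightarrow> 'a::real_normed_vector \<Rightarrow> bool"
  assumes "finite A" "\<And>b. b \<in> A \<Longrightarrow> \<exists>d>0. \<forall>v. norm v < d \<longrightarrow> P b v"
  shows "\<exists>d>0. \<forall>b\<in>A. \<forall>v. norm v < d \<longrightarrow> P b v"
  using assms
proof (induction A rule: finite_induct)
  case empty
  show ?case by (auto intro: exI[of _ 1])
next
  case (insert a A)
  obtain d where d: "d > 0" "\<forall>b\<in>A. \<forall>v. norm v < d \<longrightarrow> P b v" using insert by auto
  obtain d' where d': "d' > 0" "\<forall>v. norm v < d' \<longrightarrow> P a v" using insert.prems by auto
  show ?case using d d' by (intro exI[of _ "min d d'"]) auto
qed

text \<open>Compactness of the time interval makes the neighbourhood of \<open>x\<close> independent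
  of \<open>s\<close>.\<close>

lemma family_uniform:
  fixes F :: "real \<Rightarrow> 'a::real_normed_vector \<Rightarrow> 'b::real_normed_vector"
  assumes "open U" "x \<in> U" "continuous_on ({0..1} \<times> U) (\<lambda>p. F (fst p) (snd p))" "e > 0"
  shows "\<exists>d>0. \<forall>v. norm v < d \<longrightarrow> x + v \<in> U \<and> (\<forall>s\<in>{0..1}. norm (F s (x + v) - F s x) \<le> e)"
proof -
  have "continuous_on (U \<times> {0..1}) (\<lambda>q. F (fst (snd q, fst q)) (snd (snd q, fst q)))"
    by (rule continuous_on_compose2[OF assms(3)]) (auto intro!: continuous_intros)
  then have "continuous_on (U \<times> {0..1}) (\<lambda>q. F (snd q) (fst q))" by simp
  from continuous_on_prod_compactE[OF this compact_Icc assms(2,4)]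
  obtain X0 where X0: "x \<in> X0" "open X0" "\<forall>x'\<in>X0 \<inter> U. \<forall>t\<in>{0..1}. dist (F t x') (F t x) \<le> e"
    by auto
  have "open (X0 \<inter> U)" "x \<in> X0 \<inter> U" using X0 assms by auto
  then obtain d where d: "d > 0" "ball x d \<subseteq> X0 \<inter> U" using open_contains_ball by blast
  have "x + v \<in> U \<and> (\<forall>s\<in>{0..1}. norm (F s (x + v) - F s x) \<le> e)" if "norm v < d" for v
  proof -
    have "x + v \<in> X0 \<inter> U" using d(2) that by (auto simp: dist_norm subset_iff)
    then show ?thesis using X0(3) by (auto simp: dist_norm)
  qed
  then show ?thesis using d(1) by blast
qed

text \<open>A linear map given by its columns \<open>a b s x\<close>, one for each basis vector
  \<open>b\<close>. In this form the coefficients of a linear equation are again families to which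
  \<open>Ckp\<close> applies.\<close>

definition lin :: "('b::euclidean_space \<Rightarrow> 's \<Rightarrow> 'a \<Rightarrow> 'c::real_normed_vector) \<Rightarrow> 's \<Rightarrow> 'a \<Rightarrow> 'b \<Rightarrow> 'c" where
  "lin a s x z = (\<Sum>b\<in>Basis. inner z b *\<^sub>R a b s x)"

lemma linear_lin: "linear (lin a s x)"
  by (rule linearI) (simp_all add: lin_def inner_add_left scaleR_add_left sum.distrib scaleR_sum_right)

lemma lin_bound:
  fixes e :: real
  assumes "\<And>b. b \<in> Basis \<Longrightarrow> norm (a b s x) \<le> e"
  shows "norm (lin a s x (z::'b::euclidean_space)) \<le> DIM('b) * e * norm z"
proof -
  have "norm (lin a s x z) \<le> (\<Sum>b\<in>(Basis::'b set). e * norm z)"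
    unfolding lin_def
  proof (rule sum_norm_le)
    fix b :: 'b assume b: "b \<in> Basis"
    then show "norm (inner z b *\<^sub>R a b s x) \<le> e * norm z"
      using mult_mono[OF Basis_le_norm[OF b, of z] assms[OF b]] by (simp add: mult.commute)
  qed
  then show ?thesis by (simp add: mult.assoc)
qed

lemma Ckp_lin:
  assumes "open U" "\<And>b. b \<in> Basis \<Longrightarrow> Ckp k T U (a b)" "Ckp k T U Z"
  shows "Ckp k T U (\<lambda>s x. lin a s x (Z s x))"
  unfolding lin_def
  by (intro Ckp_sum Ckp_scaleR assms Ckp_compose_linear[OF _ bounded_linear_inner_left])

text \<open>Mean value inequality: near \<open>x\<close> the derivative differs little from its
  value at \<open>x\<close>, and by \<open>family_uniform\<close> this holds for all
  \<open>s\<close> with one radius.\<close>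

lemma family_differentiable_uniform:
  fixes F :: "real \<Rightarrow> 'a::euclidean_space \<Rightarrow> 'b::real_normed_vector"
  assumes "open U" "x \<in> U" "Ckp (Suc k) {0..1} U F" "e > 0"
  shows "\<exists>d>0. \<forall>v. norm v < d \<longrightarrow>
    (\<forall>s\<in>{0..1}. norm (F s (x + v) - F s x - frechet_derivative (F s) (at x) v) \<le> e * norm v)"
proof -
  define D where "D b s x' = frechet_derivative (F s) (at x') b" for b s x'
  \<comment> \<open>\<open>lin_bound\<close> loses the factor \<open>DIM('a)\<close>, which the
    divisor compensates.\<close>
  have "\<exists>d>0. \<forall>b\<in>Basis. \<forall>v. norm v < d \<longrightarrow>
     x + v \<in> U \<and> (\<forall>s\<in>{0..1}. norm (D b s (x + v) - D b s x) \<le> e / DIM('a))"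
    unfolding D_def
    by (intro finite_uniform_radius family_uniform assms(1,2) Ckp_continuous[OF Ckp_SucD(2)[OF assms(3)]])
      (use assms(4) in auto)
  then obtain d where d: "d > 0" and dD: "\<And>b v. b \<in> Basis \<Longrightarrow> norm v < d \<Longrightarrow>
     x + v \<in> U \<and> (\<forall>s\<in>{0..1}. norm (D b s (x + v) - D b s x) \<le> e / DIM('a))"
    by blast
  have dU: "x + v \<in> U" if "norm v < d" for v
    using dD[OF SOME_Basis that] by blast
  have "norm (F s (x + v) - F s x - frechet_derivative (F s) (at x) v) \<le> e * norm v"
    if v: "norm v < d" and s: "s \<in> {0..1}" for v s
  proof -
    have df: "(F s has_derivative frechet_derivative (F s) (at z)) (at z)" if "z \<in> ball x d" for z
      using Ckp_SucD(1)[OF assms(3) s] dU[of "z - x"] that by (simp add: dist_norm norm_minus_commute)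
    have "norm (F s (x + v) - F s x - frechet_derivative (F s) (at x) (x + v - x)) \<le> norm (x + v - x) * e"
    proof (rule differentiable_bound_linearization[of _ _ "ball x d"])
      show "x + t *\<^sub>R (x + v - x) \<in> ball x d" if "t \<in> {0..1}" for t
      proof -
        have "norm (t *\<^sub>R v) \<le> 1 * norm v" using that by (simp add: mult_left_le_one_le)
        then show ?thesis using v by (simp add: dist_norm)
      qed
      show "(F s has_derivative frechet_derivative (F s) (at z)) (at z within ball x d)" if "z \<in> ball x d" for z
        using df[OF that] by (rule has_derivative_at_withinI)
      show "onorm (frechet_derivative (F s) (at z) - frechet_derivative (F s) (at x)) \<le> e" if z: "z \<in> ball x d" for z
      proof (rule onorm_bound)
        fix w
        have l: "linear (frechet_derivative (F s) (at z))" "linear (frechet_derivative (F s) (at x))"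
          using df[OF z] df[of x] d by (auto intro: has_derivative_linear)
        have "(frechet_derivative (F s) (at z) - frechet_derivative (F s) (at x)) w
          = lin (\<lambda>b s z. D b s z - D b s x) s z w"
          using linear_frechet_sum[OF l(1), of w] linear_frechet_sum[OF l(2), of w]
          by (simp add: lin_def D_def scaleR_diff_right sum_subtractf)
        also have "norm \<dots> \<le> DIM('a) * (e / DIM('a)) * norm w"
        proof (rule lin_bound)
          fix b :: 'a assume "b \<in> Basis"
          moreover have "norm (z - x) < d" using z by (simp add: dist_norm norm_minus_commute)
          ultimately show "norm (D b s z - D b s x) \<le> e / DIM('a)" using dD[of b "z - x"] s by simp
        qed
        finally show "norm ((frechet_derivative (F s) (at z) - frechet_derivative (F s) (at x)) w) \<le> e * norm w"
          by simp
      qed (use assms(4) in simp)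
      show "x \<in> ball x d" using d by simp
    qed
    then show ?thesis by (simp add: mult.commute)
  qed
  then show ?thesis using d by blast
qed

text \<open>Picard iteration needs a compact parameter set, whereas \<open>U\<close> is open.
  Solving over each single point defines \<open>Z\<close>; solving again over a closed ball gives a
  jointly continuous solution, and uniqueness identifies the two near the centre.\<close>

lemma volterra_linear_exists:
  fixes a :: "'b::euclidean_space \<Rightarrow> real \<Rightarrow> 'a::euclidean_space \<Rightarrow> 'b"
  assumes U: "open U" and a: "\<And>b. b \<in> Basis \<Longrightarrow> Ckp 0 {0..1} U (a b)" and B: "Ckp 0 {0..1} U B"
    and half: "\<And>s x z. s \<in> {0..1} \<Longrightarrow> x \<in> U \<Longrightarrow> norm (lin a s x z) \<le> norm z / 2"
  shows "\<exists>Z. Ckp 0 {0..1} U Z \<and> (\<forall>s\<in>{0..1}. \<forall>x\<in>U. Z s x = B s x + primitive (\<lambda>\<sigma>. lin a \<sigma> x (Z \<sigma> x)) s)"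
proof -
  have contl: "continuous_on ({0..1} \<times> K) (\<lambda>p. lin a (fst p) (snd p) (y (fst p) (snd p)))"
    if "K \<subseteq> U" "continuous_on ({0..1} \<times> K) (\<lambda>p. y (fst p) (snd p))" for K and y :: "real \<Rightarrow> 'a \<Rightarrow> 'b"
    unfolding lin_def
  proof (intro continuous_on_sum continuous_on_scaleR continuous_on_inner continuous_on_const that(2))
    fix b :: 'b assume "b \<in> Basis"
    then have "continuous_on ({0..1} \<times> U) (\<lambda>p. a b (fst p) (snd p))" using a by simp
    then show "continuous_on ({0..1} \<times> K) (\<lambda>p. a b (fst p) (snd p))"
      by (rule continuous_on_subset) (use that(1) in auto)
  qed
  have sol: "\<exists>Z. continuous_on ({0..1} \<times> K) (\<lambda>p. Z (fst p) (snd p)) \<and>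
      (\<forall>s\<in>{0..1}. \<forall>x\<in>K. Z s x = B s x + primitive (\<lambda>\<sigma>. lin a \<sigma> x (Z \<sigma> x)) s)"
    if K: "compact K" "K \<subseteq> U" for K
  proof -
    have cB: "continuous_on ({0..1} \<times> K) (\<lambda>p. B (fst p) (snd p))"
      by (rule continuous_on_subset[OF Ckp_continuous[OF B]]) (use K in auto)
    show ?thesis
    proof (rule picard_fixpoint[OF K(1) closed_UNIV UNIV_I cB, of "lin a"])
      show "continuous_on ({0..1} \<times> K) (\<lambda>p. lin a (fst p) (snd p) (y (fst p) (snd p)))"
        if "continuous_on ({0..1} \<times> K) (\<lambda>p. y (fst p) (snd p))" for y
        using contl[OF K(2) that] .
      show "norm (lin a s x y - lin a s x z) \<le> norm (y - z) / 2" if "s \<in> {0..1}" "x \<in> K" for s x y z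
      proof -
        have "lin a s x y - lin a s x z = lin a s x (y - z)"
          using linear_diff[OF linear_lin[of a s x], of y z] by simp
        then show ?thesis using half[of s x "y - z"] that K by auto
      qed
    qed blast+
  qed
  have "\<forall>x\<in>U. \<exists>Z. continuous_on ({0..1} \<times> {x}) (\<lambda>p. Z (fst p) (snd p)) \<and>
      (\<forall>s\<in>{0..1}. \<forall>x'\<in>{x}. Z s x' = B s x' + primitive (\<lambda>\<sigma>. lin a \<sigma> x' (Z \<sigma> x')) s)"
    by (intro ballI sol) auto
  then obtain Zx where Zx: "\<forall>x\<in>U. continuous_on ({0..1} \<times> {x}) (\<lambda>p. Zx x (fst p) (snd p)) \<and>
      (\<forall>s\<in>{0..1}. \<forall>x'\<in>{x}. Zx x s x' = B s x' + primitive (\<lambda>\<sigma>. lin a \<sigma> x' (Zx x \<sigma> x')) s)"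
    by (rule bchoice[THEN exE])
  define Z where "Z s x = Zx x s x" for s x
  have Zeq: "Z s x = B s x + primitive (\<lambda>\<sigma>. lin a \<sigma> x (Z \<sigma> x)) s" if "s \<in> {0..1}" "x \<in> U" for s x
    using Zx that unfolding Z_def by blast
  have fib: "continuous_on {0..1} (\<lambda>s. f s x)" if "continuous_on ({0..1} \<times> K) (\<lambda>p. f (fst p) (snd p))" "x \<in> K"
    for f :: "real \<Rightarrow> 'a \<Rightarrow> 'b" and x K
    using Ckp_continuous_fiber[of 0 "{0..1}" K f x] that by simp
  have Zf: "continuous_on {0..1} (\<lambda>s. Z s x)" if "x \<in> U" for x
    using fib[of "{x}" "Zx x" x] Zx that by (simp add: Z_def)
  have lf: "continuous_on {0..1} (\<lambda>s. lin a s x (y s))" if "x \<in> U" "continuous_on {0..1} y" for x y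
  proof -
    have "continuous_on ({0..1} \<times> {x}) (\<lambda>p. y (fst p))"
      by (rule continuous_on_compose2[OF that(2) continuous_on_fst[OF continuous_on_id]]) auto
    from fib[of "{x}" "\<lambda>s x. lin a s x (y s)", OF contl[of "{x}" "\<lambda>s x. y s", OF _ this]] that(1) show ?thesis by simp
  qed
  have "continuous (at p within {0..1} \<times> U) (\<lambda>p. Z (fst p) (snd p))" if p: "p \<in> {0..1} \<times> U" for p
  proof -
    obtain s0 x0 where p_eq: "p = (s0, x0)" and s0: "s0 \<in> {0..1}" and x0: "x0 \<in> U" using p by blast
    obtain r where r: "r > 0" "cball x0 r \<subseteq> U" using U x0 open_contains_cball by blast
    obtain Y where Y: "continuous_on ({0..1} \<times> cball x0 r) (\<lambda>p. Y (fst p) (snd p))"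
      "\<forall>s\<in>{0..1}. \<forall>x\<in>cball x0 r. Y s x = B s x + primitive (\<lambda>\<sigma>. lin a \<sigma> x (Y \<sigma> x)) s"
      using sol[OF compact_cball r(2)] by blast
    have eq: "Y s x = Z s x" if "x \<in> cball x0 r" "s \<in> {0..1}" for s x
    proof (rule volterra_unique[of "\<lambda>s. Y s x" "\<lambda>s. Z s x" "\<lambda>s. lin a s x" "\<lambda>s. B s x"])
      have xU: "x \<in> U" using that r by blast
      show "continuous_on {0..1} (\<lambda>s. Y s x)" using fib[OF Y(1) that(1)] .
      show "continuous_on {0..1} (\<lambda>s. Z s x)" using Zf[OF xU] .
      show "continuous_on {0..1} (\<lambda>s. lin a s x (Y s x))" using lf[OF xU fib[OF Y(1) that(1)]] .
      show "continuous_on {0..1} (\<lambda>s. lin a s x (Z s x))" using lf[OF xU Zf[OF xU]] .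
      show "norm (lin a s x (Y s x) - lin a s x (Z s x)) \<le> norm (Y s x - Z s x) / 2" if "s \<in> {0..1}" for s
        using half[OF that xU, of "Y s x - Z s x"] linear_diff[OF linear_lin[of a s x], of "Y s x" "Z s x"] by simp
      show "Y s x = B s x + primitive (\<lambda>\<sigma>. lin a \<sigma> x (Y \<sigma> x)) s" if "s \<in> {0..1}" for s
        using Y(2) that \<open>x \<in> cball x0 r\<close> by blast
      show "Z s x = B s x + primitive (\<lambda>\<sigma>. lin a \<sigma> x (Z \<sigma> x)) s" if "s \<in> {0..1}" for s
        using Zeq[OF that xU] .
    qed (rule that(2))
    have "continuous_on ({0..1} \<times> ball x0 r) (\<lambda>p. Y (fst p) (snd p))"
      by (rule continuous_on_subset[OF Y(1)]) auto
    then have "continuous_on ({0..1} \<times> ball x0 r) (\<lambda>p. Z (fst p) (snd p))"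
      by (rule continuous_on_eq) (auto intro!: eq)
    then have "continuous (at p within {0..1} \<times> ball x0 r) (\<lambda>p. Z (fst p) (snd p))"
      using s0 r(1) by (simp add: continuous_on_eq_continuous_within p_eq)
    moreover have "at p within {0..1} \<times> ball x0 r = at p within {0..1} \<times> U"
    proof (rule at_within_nhd[of _ "UNIV \<times> ball x0 r"])
      show "({0..1} \<times> ball x0 r) \<inter> (UNIV \<times> ball x0 r) - {p} = ({0..1} \<times> U) \<inter> (UNIV \<times> ball x0 r) - {p}"
        using r(2) ball_subset_cball[of x0 r] by blast
    qed (use r(1) p_eq in \<open>auto intro: open_Times\<close>)
    ultimately show ?thesis by simp
  qed
  then have "Ckp 0 {0..1} U Z" by (simp add: continuous_on_eq_continuous_within)
  then show ?thesis using Zeq by blast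
qed

text \<open>The candidate for the derivative in direction \<open>v\<close> solves the linearised
  equation. The increment of \<open>y\<close> minus this candidate satisfies an inequality as in
  \<open>contraction_bound\<close>, with an error small against \<open>norm v\<close>.
  \<open>L\<close> linearises the explicit dependence of the integrand on \<open>x\<close> and
  \<open>A\<close> its dependence through \<open>y\<close>, so one argument covers linear equations
  and flows.\<close>

lemma volterra_differentiable:
  fixes y F B :: "real \<Rightarrow> 'a::euclidean_space \<Rightarrow> 'b::euclidean_space"
  assumes U: "open U" "x \<in> U"
    and y: "\<And>s x'. s \<in> {0..1} \<Longrightarrow> x' \<in> U \<Longrightarrow> y s x' = B s x' + primitive (\<lambda>\<sigma>. F \<sigma> x') s"
    and cy: "\<And>x'. x' \<in> U \<Longrightarrow> continuous_on {0..1} (\<lambda>s. y s x')"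
    and cF: "\<And>x'. x' \<in> U \<Longrightarrow> continuous_on {0..1} (\<lambda>s. F s x')"
    and B: "\<And>e. e > 0 \<Longrightarrow> \<exists>d>0. \<forall>v. norm v < d \<longrightarrow> (\<forall>s\<in>{0..1}. norm (B s (x + v) - B s x - \<beta> s v) \<le> e * norm v)"
    and F: "\<And>e. e > 0 \<Longrightarrow> \<exists>d>0. \<forall>v. norm v < d \<longrightarrow>
        (\<forall>s\<in>{0..1}. norm (F s (x + v) - F s x - L s v - A s (y s (x + v) - y s x)) \<le> e * (norm v + norm (y s (x + v) - y s x)))"
    and lin: "\<And>s. s \<in> {0..1} \<Longrightarrow> linear (\<beta> s)" "\<And>s. s \<in> {0..1} \<Longrightarrow> linear (L s)" "\<And>s. s \<in> {0..1} \<Longrightarrow> linear (A s)"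
    and half: "\<And>s z. s \<in> {0..1} \<Longrightarrow> norm (A s z) \<le> norm z / 2"
    and \<zeta>: "\<And>b. b \<in> Basis \<Longrightarrow> continuous_on {0..1} (\<zeta> b)"
      "\<And>b. b \<in> Basis \<Longrightarrow> continuous_on {0..1} (\<lambda>\<sigma>. L \<sigma> b + A \<sigma> (\<zeta> b \<sigma>))"
      "\<And>b s. b \<in> Basis \<Longrightarrow> s \<in> {0..1} \<Longrightarrow> \<zeta> b s = \<beta> s b + primitive (\<lambda>\<sigma>. L \<sigma> b + A \<sigma> (\<zeta> b \<sigma>)) s"
    and s: "s \<in> {0..1}"
  shows "(y s has_derivative (\<lambda>v. \<Sum>b\<in>Basis. inner v b *\<^sub>R \<zeta> b s)) (at x)"
proof -
  define Z where "Z v s = (\<Sum>b\<in>Basis. inner v b *\<^sub>R \<zeta> b s)" for v s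
  have cZ: "continuous_on {0..1} (Z v)" for v
    unfolding Z_def by (intro continuous_on_sum continuous_on_scaleR continuous_on_const \<zeta>(1))
  have comb: "L \<sigma> v + A \<sigma> (Z v \<sigma>) = (\<Sum>b\<in>Basis. inner v b *\<^sub>R (L \<sigma> b + A \<sigma> (\<zeta> b \<sigma>)))" if "\<sigma> \<in> {0..1}" for v \<sigma>
    using linear_frechet_sum[OF lin(2)[OF that], of v] lin(3)[OF that]
    by (simp add: Z_def linear_sum linear_scale scaleR_add_right sum.distrib)
  have cG: "continuous_on {0..1} (\<lambda>\<sigma>. L \<sigma> v + A \<sigma> (Z v \<sigma>))" for v
  proof (rule continuous_on_eq)
    show "continuous_on {0..1} (\<lambda>\<sigma>. \<Sum>b\<in>Basis. inner v b *\<^sub>R (L \<sigma> b + A \<sigma> (\<zeta> b \<sigma>)))"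
      by (intro continuous_on_sum continuous_on_scaleR continuous_on_const \<zeta>(2))
  qed (rule comb[symmetric])
  have Zeq: "Z v t = \<beta> t v + primitive (\<lambda>\<sigma>. L \<sigma> v + A \<sigma> (Z v \<sigma>)) t" if t: "t \<in> {0..1}" for v t
  proof -
    have "Z v t = (\<Sum>b\<in>Basis. inner v b *\<^sub>R \<beta> t b) + (\<Sum>b\<in>Basis. inner v b *\<^sub>R primitive (\<lambda>\<sigma>. L \<sigma> b + A \<sigma> (\<zeta> b \<sigma>)) t)"
      unfolding Z_def using \<zeta>(3)[OF _ t] by (simp add: scaleR_add_right flip: sum.distrib)
    also have "(\<Sum>b\<in>Basis. inner v b *\<^sub>R \<beta> t b) = \<beta> t v" using linear_frechet_sum[OF lin(1)[OF t]] by metis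
    also have "(\<Sum>b\<in>Basis. inner v b *\<^sub>R primitive (\<lambda>\<sigma>. L \<sigma> b + A \<sigma> (\<zeta> b \<sigma>)) t) =
       primitive (\<lambda>\<sigma>. \<Sum>b\<in>Basis. inner v b *\<^sub>R (L \<sigma> b + A \<sigma> (\<zeta> b \<sigma>))) t"
      by (rule primitive_sum[symmetric]) (use \<zeta>(2) t in auto)
    also have "\<dots> = primitive (\<lambda>\<sigma>. L \<sigma> v + A \<sigma> (Z v \<sigma>)) t" by (rule primitive_cong) (use comb t in auto)
    finally show ?thesis .
  qed
  have "\<exists>C. \<forall>t\<in>{0..1}. norm (\<zeta> b t) \<le> C" if "b \<in> Basis" for b
    using compact_imp_bounded[OF compact_continuous_image[OF \<zeta>(1)[OF that] compact_Icc]] by (auto simp: bounded_iff)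
  then obtain M where M: "\<And>b t. b \<in> Basis \<Longrightarrow> t \<in> {0..1} \<Longrightarrow> norm (\<zeta> b t) \<le> M b" by metis
  define C where "C = (\<Sum>b\<in>Basis. \<bar>M b\<bar>)"
  have C0: "C \<ge> 0" unfolding C_def by (simp add: sum_nonneg)
  have C: "norm (Z v t) \<le> C * norm v" if "t \<in> {0..1}" for v t
    unfolding Z_def C_def sum_distrib_right
  proof (rule sum_norm_le)
    fix b :: 'a assume b: "b \<in> Basis"
    have "norm (\<zeta> b t) \<le> \<bar>M b\<bar>" using M[OF b that] by linarith
    from mult_mono[OF this Basis_le_norm[OF b, of v]]
    show "norm (inner v b *\<^sub>R \<zeta> b t) \<le> \<bar>M b\<bar> * norm v" by (simp add: mult.commute)
  qed
  have "\<exists>d>0. \<forall>y'. norm (y' - x) < d \<longrightarrow> norm (y s y' - y s x - Z (y' - x) s) \<le> e * norm (y' - x)" if e: "e > 0" for e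
  proof -
    \<comment> \<open>1/4 is the share that \<open>contraction_bound\<close> leaves to the
      remainder; the other bound gives \<open>4 * (\<eta> * (2 + C)) \<le> e\<close>. In
      \<open>2 + C\<close>, one unit comes from the remainder of \<open>B\<close>, one from that of
      \<open>F\<close>, and \<open>C\<close> from the size of the candidate derivative.\<close>
    define \<eta> where "\<eta> = min (1/4) (e / (4 * (2 + C)))"
    have \<eta>: "\<eta> > 0" "\<eta> \<le> 1/4" "4 * (\<eta> * (2 + C)) \<le> e"
    proof -
      show "\<eta> > 0" using e C0 by (simp add: \<eta>_def)
      show "\<eta> \<le> 1/4" unfolding \<eta>_def by (rule min.cobounded1)
      have "\<eta> \<le> e / (4 * (2 + C))" by (simp add: \<eta>_def)
      then show "4 * (\<eta> * (2 + C)) \<le> e" using C0 by (simp add: pos_le_divide_eq mult_ac)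
    qed
    obtain d0 where d0: "d0 > 0" "ball x d0 \<subseteq> U" using openE[OF U] .
    obtain d1 where d1: "d1 > 0" "\<forall>v. norm v < d1 \<longrightarrow> (\<forall>s\<in>{0..1}. norm (B s (x + v) - B s x - \<beta> s v) \<le> \<eta> * norm v)"
      using B[OF \<eta>(1)] by (elim exE conjE)
    obtain d2 where d2: "d2 > 0" "\<forall>v. norm v < d2 \<longrightarrow>
        (\<forall>s\<in>{0..1}. norm (F s (x + v) - F s x - L s v - A s (y s (x + v) - y s x)) \<le> \<eta> * (norm v + norm (y s (x + v) - y s x)))"
      using F[OF \<eta>(1)] by (elim exE conjE)
    have "norm (y s (x + v) - y s x - Z v s) \<le> e * norm v" if v: "norm v < min d0 (min d1 d2)" for v
    proof -
      have xv: "x + v \<in> U" using d0 v by (auto simp: dist_norm subset_iff)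
      have "norm (y s (x + v) - y s x - Z v s) \<le> 4 * (\<eta> * (2 + C) * norm v)"
      proof (rule contraction_bound[OF _ _ s])
        show "continuous_on {0..1} (\<lambda>s. y s (x + v) - y s x - Z v s)"
          by (intro continuous_on_diff cy cZ xv U)
        fix N t assume N: "\<And>\<sigma>. \<sigma> \<in> {0..1} \<Longrightarrow> norm (y \<sigma> (x + v) - y \<sigma> x - Z v \<sigma>) \<le> N" and t: "t \<in> {0..1::real}"
        have N0: "N \<ge> 0" using N[OF t] norm_ge_zero order_trans by blast
        define G where "G \<sigma> = F \<sigma> (x + v) - F \<sigma> x - (L \<sigma> v + A \<sigma> (Z v \<sigma>))" for \<sigma>
        have "primitive G t = primitive (\<lambda>\<sigma>. F \<sigma> (x + v)) t - primitive (\<lambda>\<sigma>. F \<sigma> x) t - primitive (\<lambda>\<sigma>. L \<sigma> v + A \<sigma> (Z v \<sigma>)) t"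
          unfolding G_def
          using primitive_diff[OF continuous_on_diff[OF cF[OF xv] cF[OF U(2)]] cG t] primitive_diff[OF cF[OF xv] cF[OF U(2)] t] by simp
        then have E: "y t (x + v) - y t x - Z v t = (B t (x + v) - B t x - \<beta> t v) + primitive G t"
          using y[OF t xv] y[OF t U(2)] Zeq[OF t, of v] by simp
        have "norm (primitive G t) \<le> \<eta> * (norm v + (N + C * norm v)) + N / 2"
        proof (rule primitive_bound[OF _ t])
          show "continuous_on {0..1} G" unfolding G_def by (intro continuous_on_diff cF xv U cG)
          fix \<sigma> :: real assume \<sigma>: "\<sigma> \<in> {0..1}"
          define \<delta> where "\<delta> = y \<sigma> (x + v) - y \<sigma> x"
          have G1: "G \<sigma> = (F \<sigma> (x + v) - F \<sigma> x - L \<sigma> v - A \<sigma> \<delta>) + A \<sigma> (\<delta> - Z v \<sigma>)"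
            using lin(3)[OF \<sigma>] by (simp add: G_def linear_diff)
          have dN: "norm (\<delta> - Z v \<sigma>) \<le> N" using N[OF \<sigma>] by (simp add: \<delta>_def)
          have "norm \<delta> \<le> norm (\<delta> - Z v \<sigma>) + norm (Z v \<sigma>)" using norm_triangle_ineq[of "\<delta> - Z v \<sigma>" "Z v \<sigma>"] by simp
          then have "norm \<delta> \<le> N + C * norm v" using dN C[OF \<sigma>, of v] by linarith
          then have "\<eta> * (norm v + norm \<delta>) \<le> \<eta> * (norm v + (N + C * norm v))" using \<eta>(1) by simp
          moreover have "norm (F \<sigma> (x + v) - F \<sigma> x - L \<sigma> v - A \<sigma> \<delta>) \<le> \<eta> * (norm v + norm \<delta>)"
            using d2(2) v \<sigma> unfolding \<delta>_def by auto
          moreover have "norm (A \<sigma> (\<delta> - Z v \<sigma>)) \<le> N / 2" using half[OF \<sigma>, of "\<delta> - Z v \<sigma>"] dN by linarith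
          ultimately show "norm (G \<sigma>) \<le> \<eta> * (norm v + (N + C * norm v)) + N / 2"
            unfolding G1 using norm_triangle_ineq[of "F \<sigma> (x + v) - F \<sigma> x - L \<sigma> v - A \<sigma> \<delta>" "A \<sigma> (\<delta> - Z v \<sigma>)"] by linarith
        qed
        moreover have "norm (B t (x + v) - B t x - \<beta> t v) \<le> \<eta> * norm v" using d1(2) v t by auto
        moreover have "\<eta> * N \<le> N / 4" using mult_right_mono[OF \<eta>(2) N0] by simp
        ultimately show "norm (y t (x + v) - y t x - Z v t) \<le> \<eta> * (2 + C) * norm v + 3/4 * N"
          unfolding E using norm_triangle_ineq[of "B t (x + v) - B t x - \<beta> t v" "primitive G t"]
          by (simp add: algebra_simps)
      qed
      also have "\<dots> \<le> e * norm v" using mult_right_mono[OF \<eta>(3) norm_ge_zero[of v]] by (simp add: mult.assoc)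
      finally show ?thesis .
    qed
    from this[of "y' - x" for y'] show ?thesis using d0(1) d1(1) d2(1)
      by (intro exI[of _ "min d0 (min d1 d2)"]) auto
  qed
  moreover have "bounded_linear (\<lambda>v. Z v s)"
    unfolding Z_def by (intro bounded_linear_sum bounded_linear_scaleR_const bounded_linear_inner_left)
  ultimately show ?thesis unfolding has_derivative_at_alt Z_def by blast
qed

text \<open>The derivative solves an equation with the same coefficients \<open>a\<close> and a new
  inhomogeneity, which contains \<open>Z\<close> itself and is of class \<open>k\<close> because
  \<open>Z\<close> is. Hence the induction lets \<open>B\<close> and \<open>Z\<close> vary while
  \<open>a\<close> stays.\<close>

lemma Ckp_volterra_linear:
  fixes a :: "'b::euclidean_space \<Rightarrow> real \<Rightarrow> 'a::euclidean_space \<Rightarrow> 'b"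
  assumes U: "open U"
    and half: "\<And>s x z. s \<in> {0..1} \<Longrightarrow> x \<in> U \<Longrightarrow> norm (lin a s x z) \<le> norm z / 2"
    and a: "\<And>b. b \<in> Basis \<Longrightarrow> Ckp k {0..1} U (a b)" and B: "Ckp k {0..1} U B"
    and Z: "Ckp 0 {0..1} U Z"
    and Zeq: "\<And>s x. s \<in> {0..1} \<Longrightarrow> x \<in> U \<Longrightarrow> Z s x = B s x + primitive (\<lambda>\<sigma>. lin a \<sigma> x (Z \<sigma> x)) s"
  shows "Ckp k {0..1} U Z"
  using a B Z Zeq
proof (induction k arbitrary: B Z)
  case 0
  then show ?case by simp
next
  case (Suc k)
  note a = Suc.prems(1) and B = Suc.prems(2) and Z0 = Suc.prems(3) and Zeq = Suc.prems(4)
  have a': "Ckp k {0..1} U (a b)" if "b \<in> Basis" for b using Ckp_Suc_imp[OF a[OF that]] .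
  have Zk: "Ckp k {0..1} U Z" using Suc.IH[OF a' Ckp_Suc_imp[OF B] Z0 Zeq] .
  define da where "da w = (\<lambda>b s x. frechet_derivative (a b s) (at x) w)" for w
  define L where "L w = (\<lambda>s x. lin (da w) s x (Z s x))" for w
  define B' where "B' w = (\<lambda>s x. frechet_derivative (B s) (at x) w + primitive (\<lambda>\<sigma>. L w \<sigma> x) s)" for w
  have Lk: "Ckp k {0..1} U (L w)" for w
    unfolding L_def by (rule Ckp_lin[OF U _ Zk]) (use Ckp_SucD(2)[OF a] in \<open>simp add: da_def\<close>)
  have B'k: "Ckp k {0..1} U (B' w)" for w
    unfolding B'_def by (intro Ckp_add[OF U] Ckp_SucD(2)[OF B] Ckp_primitive[OF U Lk])
  have "\<exists>\<zeta>. Ckp 0 {0..1} U \<zeta> \<and> (\<forall>s\<in>{0..1}. \<forall>x\<in>U. \<zeta> s x = B' w s x + primitive (\<lambda>\<sigma>. lin a \<sigma> x (\<zeta> \<sigma> x)) s)" for w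
    by (rule volterra_linear_exists[OF U _ _ half]) (use Ckp_mono[OF a' le0] Ckp_mono[OF B'k le0] in auto)
  then obtain \<zeta> where \<zeta>: "\<And>w. Ckp 0 {0..1} U (\<zeta> w)"
      "\<And>w s x. s \<in> {0..1} \<Longrightarrow> x \<in> U \<Longrightarrow> \<zeta> w s x = B' w s x + primitive (\<lambda>\<sigma>. lin a \<sigma> x (\<zeta> w \<sigma> x)) s"
    by metis
  have \<zeta>k: "Ckp k {0..1} U (\<zeta> w)" for w
    using Suc.IH[OF a' B'k \<zeta>(1) \<zeta>(2)] .
  have cl: "Ckp 0 {0..1} U (\<lambda>s x. lin a s x (Y s x))" if "Ckp 0 {0..1} U Y" for Y
    by (rule Ckp_lin[OF U _ that]) (use Ckp_mono[OF a' le0] in auto)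
  show ?case
  proof (rule Ckp_SucI[OF U Ckp_continuous[OF Z0]])
    fix s :: real and x assume s: "s \<in> {0..1}" and x: "x \<in> U"
    have ck: "continuous_on {0..1} (\<lambda>\<sigma>. Y \<sigma> x)" if "Ckp 0 {0..1} U Y" for Y :: "real \<Rightarrow> 'a \<Rightarrow> 'b"
      using Ckp_continuous_fiber[OF that x] .
    obtain CZ where CZ: "\<And>t. t \<in> {0..1} \<Longrightarrow> norm (Z t x) \<le> CZ"
      using compact_imp_bounded[OF compact_continuous_image[OF ck[OF Z0] compact_Icc]] unfolding bounded_iff by blast
    have CZ0: "CZ \<ge> 0" using CZ[of 0] norm_ge_zero[of "Z 0 x"] by (metis atLeastAtMost_iff order.refl order.trans zero_le_one)
    show "(Z s has_derivative (\<lambda>v. \<Sum>b\<in>Basis. inner v b *\<^sub>R \<zeta> b s x)) (at x)"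
    proof (rule volterra_differentiable[where F="\<lambda>s x. lin a s x (Z s x)" and B=B and
          \<beta>="\<lambda>s. frechet_derivative (B s) (at x)" and L="\<lambda>s w. L w s x" and A="\<lambda>s. lin a s x" and \<zeta>="\<lambda>b s. \<zeta> b s x", OF U x Zeq])
      show "continuous_on {0..1} (\<lambda>s. Z s x')" if "x' \<in> U" for x' using Ckp_continuous_fiber[OF Z0 that] .
      show "continuous_on {0..1} (\<lambda>s. lin a s x' (Z s x'))" if "x' \<in> U" for x'
        using Ckp_continuous_fiber[OF cl[OF Z0] that] .
      show "\<exists>d>0. \<forall>v. norm v < d \<longrightarrow> (\<forall>s\<in>{0..1}. norm (B s (x + v) - B s x - frechet_derivative (B s) (at x) v) \<le> e * norm v)" if "e > 0" for e
        using family_differentiable_uniform[OF U x B that] .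
      show "\<exists>d>0. \<forall>v. norm v < d \<longrightarrow> (\<forall>s\<in>{0..1}.
          norm (lin a s (x + v) (Z s (x + v)) - lin a s x (Z s x) - L v s x - lin a s x (Z s (x + v) - Z s x))
          \<le> e * (norm v + norm (Z s (x + v) - Z s x)))" if e: "e > 0" for e
      proof -
        define N where "N = real DIM('b)"
        have N: "N > 0" by (simp add: N_def)
        \<comment> \<open>\<open>CZ + 1\<close> in place of \<open>CZ\<close> keeps the divisor
          positive.\<close>
        define e1 where "e1 = e / (N * (CZ + 1))"
        have e1: "e1 > 0" using e N CZ0 by (simp add: e1_def)
        have "\<exists>d>0. \<forall>b\<in>Basis. \<forall>v. norm v < d \<longrightarrow>
            (\<forall>s\<in>{0..1}. norm (a b s (x + v) - a b s x - frechet_derivative (a b s) (at x) v) \<le> e1 * norm v)"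
          by (intro finite_uniform_radius family_differentiable_uniform[OF U x a e1]) auto
        then obtain d1 where d1: "d1 > 0" "\<And>b v s. b \<in> Basis \<Longrightarrow> norm v < d1 \<Longrightarrow> s \<in> {0..1} \<Longrightarrow>
            norm (a b s (x + v) - a b s x - frechet_derivative (a b s) (at x) v) \<le> e1 * norm v" by blast
        have "\<exists>d>0. \<forall>b\<in>Basis. \<forall>v. norm v < d \<longrightarrow>
            x + v \<in> U \<and> (\<forall>s\<in>{0..1}. norm (a b s (x + v) - a b s x) \<le> e / N)"
          by (intro finite_uniform_radius family_uniform[OF U x Ckp_continuous[OF a]]) (use e N in auto)
        then obtain d2 where d2: "d2 > 0" "\<And>b v s. b \<in> Basis \<Longrightarrow> norm v < d2 \<Longrightarrow> s \<in> {0..1} \<Longrightarrow>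
            norm (a b s (x + v) - a b s x) \<le> e / N" by blast
        have "norm (lin a s (x + v) (Z s (x + v)) - lin a s x (Z s x) - L v s x - lin a s x (Z s (x + v) - Z s x))
          \<le> e * (norm v + norm (Z s (x + v) - Z s x))" if v: "norm v < min d1 d2" and s: "s \<in> {0..1}" for v s
        proof -
          define \<delta> where "\<delta> = Z s (x + v) - Z s x"
          define p where "p = (\<lambda>b (s::real) (x'::'a). a b s (x + v) - a b s x - frechet_derivative (a b s) (at x) v)"
          define r where "r = (\<lambda>b (s::real) (x'::'a). a b s (x + v) - a b s x)"
          have Zv: "Z s (x + v) = Z s x + \<delta>" by (simp add: \<delta>_def)
          \<comment> \<open>Product rule with remainder: \<open>p\<close> is the linearisation error
            of the coefficients, and \<open>r\<close> is their increment, which meets the increment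
            of \<open>Z\<close>.\<close>
          have eq: "lin a s (x + v) (Z s (x + v)) - lin a s x (Z s x) - L v s x - lin a s x \<delta> =
             lin p s x (Z s x) + lin r s x \<delta>"
            unfolding Zv L_def lin_def da_def p_def r_def
            by (simp add: inner_add_left scaleR_add_left scaleR_diff_right sum.distrib sum_subtractf)
          have "norm (lin p s x (Z s x)) \<le> N * (e1 * norm v) * norm (Z s x)"
            unfolding N_def by (rule lin_bound) (use d1 v s in \<open>simp add: p_def\<close>)
          also have "\<dots> \<le> N * (e1 * norm v) * (CZ + 1)"
            using CZ[OF s] N e1 by (intro mult_left_mono) auto
          also have "\<dots> = e * norm v" using N CZ0 by (simp add: e1_def)
          finally have 1: "norm (lin p s x (Z s x)) \<le> e * norm v" .
          have "norm (lin r s x \<delta>) \<le> N * (e / N) * norm \<delta>"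
            unfolding N_def by (rule lin_bound) (use d2 v s in \<open>simp add: r_def N_def\<close>)
          then have 2: "norm (lin r s x \<delta>) \<le> e * norm \<delta>" using N by simp
          show ?thesis unfolding \<delta>_def[symmetric] eq
            using norm_triangle_ineq[of "lin p s x (Z s x)" "lin r s x \<delta>"] 1 2 by (simp add: distrib_left)
        qed
        then show ?thesis using d1(1) d2(1) by (intro exI[of _ "min d1 d2"]) auto
      qed
      show "linear (frechet_derivative (B s) (at x))" if "s \<in> {0..1}" for s
        using has_derivative_linear[OF Ckp_SucD(1)[OF B that x]] .
      show "linear (\<lambda>w. L w s x)" if "s \<in> {0..1}" for s
      proof -
        have l: "linear (frechet_derivative (a b s) (at x))" if "b \<in> Basis" for b
          using has_derivative_linear[OF Ckp_SucD(1)[OF a[OF that] \<open>s \<in> {0..1}\<close> x]] .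
        show ?thesis unfolding L_def lin_def da_def
          by (rule linearI) (use linear_add[OF l] linear_scale[OF l] in
            \<open>simp_all add: scaleR_add_right sum.distrib scaleR_sum_right mult.commute\<close>)
      qed
      show "linear (lin a s x)" for s by (rule linear_lin)
      show "norm (lin a s x z) \<le> norm z / 2" if "s \<in> {0..1}" for s z using half[OF that x] .
      show "continuous_on {0..1} (\<lambda>s. \<zeta> b s x)" for b using ck[OF \<zeta>(1)] .
      have cL: "continuous_on {0..1} (\<lambda>\<sigma>. L b \<sigma> x)" for b using Ckp_continuous_fiber[OF Lk x] .
      have cA: "continuous_on {0..1} (\<lambda>\<sigma>. lin a \<sigma> x (\<zeta> b \<sigma> x))" for b using ck[OF cl[OF \<zeta>(1)]] .
      show "continuous_on {0..1} (\<lambda>\<sigma>. L b \<sigma> x + lin a \<sigma> x (\<zeta> b \<sigma> x))" for b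
        by (intro continuous_on_add cL cA)
      show "\<zeta> b s x = frechet_derivative (B s) (at x) b + primitive (\<lambda>\<sigma>. L b \<sigma> x + lin a \<sigma> x (\<zeta> b \<sigma> x)) s" if "s \<in> {0..1}" for b s
        using \<zeta>(2)[OF that x, of b] primitive_add[OF cL cA that] by (simp add: B'_def)
    qed (use s in auto)
  next
    show "Ckp k {0..1} U (\<lambda>s x. \<Sum>b\<in>Basis. inner w b *\<^sub>R \<zeta> b s x)" for w
      by (intro Ckp_sum[OF U] Ckp_scaleR[OF U] Ckp_const[OF U] \<zeta>k)
  qed
qed

text \<open>If \<open>y\<close> is of class \<open>k\<close>, so are the coefficients of the
  variational equation. By the linear case its solution is then of class \<open>k\<close>, and this
  solution is the derivative of \<open>y\<close>.\<close>

lemma Ckp_volterra_flow: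
  fixes H :: "'b::euclidean_space \<Rightarrow> 'b" and y :: "real \<Rightarrow> 'a::euclidean_space \<Rightarrow> 'b"
  assumes U: "open U" and W: "open W" and H: "\<And>k. Ckp k {0::real} W (\<lambda>_. H)"
    and yW: "\<And>s x. s \<in> {0..1} \<Longrightarrow> x \<in> U \<Longrightarrow> y s x \<in> W"
    and half: "\<And>s x z. s \<in> {0..1} \<Longrightarrow> x \<in> U \<Longrightarrow> norm (frechet_derivative H (at (y s x)) z) \<le> norm z / 2"
    and y0: "Ckp 0 {0..1} U y"
    and B: "Ckp k {0..1} U B"
    and yeq: "\<And>s x. s \<in> {0..1} \<Longrightarrow> x \<in> U \<Longrightarrow> y s x = B s x + primitive (\<lambda>\<sigma>. H (y \<sigma> x)) s"
  shows "Ckp k {0..1} U y"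
  using B
proof (induction k)
  case 0
  then show ?case using y0 by simp
next
  case (Suc k)
  note B = Suc.prems
  have yk: "Ckp k {0..1} U y" using Suc.IH[OF Ckp_Suc_imp[OF B]] .
  define a where "a b = (\<lambda>s x. frechet_derivative H (at (y s x)) b)" for b
  have dH: "(H has_derivative frechet_derivative H (at z)) (at z)" if "z \<in> W" for z
    using Ckp_SucD(1)[OF H[of "Suc 0"] singletonI that] .
  have lin_a: "lin a s x = frechet_derivative H (at (y s x))" if "s \<in> {0..1}" "x \<in> U" for s x
    unfolding lin_def a_def
    by (rule ext, rule frechet_sum_Basis[symmetric], rule differentiableI[OF dH[OF yW[OF that]]])
  have ak: "Ckp k {0..1} U (a b)" for b
    unfolding a_def by (rule Ckp_compose[OF U W Ckp_SucD(2)[OF H] yk yW])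
  have half': "norm (lin a s x z) \<le> norm z / 2" if "s \<in> {0..1}" "x \<in> U" for s x z
    using half[OF that] lin_a[OF that] by simp
  define B' where "B' w = (\<lambda>s x. frechet_derivative (B s) (at x) w)" for w
  have B'k: "Ckp k {0..1} U (B' w)" for w
    unfolding B'_def by (rule Ckp_SucD(2)[OF B])
  have "\<exists>\<zeta>. Ckp 0 {0..1} U \<zeta> \<and> (\<forall>s\<in>{0..1}. \<forall>x\<in>U. \<zeta> s x = B' w s x + primitive (\<lambda>\<sigma>. lin a \<sigma> x (\<zeta> \<sigma> x)) s)" for w
    by (rule volterra_linear_exists[OF U _ _ half']) (use Ckp_mono[OF ak le0] Ckp_mono[OF B'k le0] in auto)
  then obtain \<zeta> where \<zeta>: "\<And>w. Ckp 0 {0..1} U (\<zeta> w)"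
      "\<And>w s x. s \<in> {0..1} \<Longrightarrow> x \<in> U \<Longrightarrow> \<zeta> w s x = B' w s x + primitive (\<lambda>\<sigma>. lin a \<sigma> x (\<zeta> w \<sigma> x)) s"
    by metis
  have \<zeta>k: "Ckp k {0..1} U (\<zeta> w)" for w
    using Ckp_volterra_linear[OF U half' ak B'k \<zeta>(1) \<zeta>(2)] .
  show ?case
  proof (rule Ckp_SucI[OF U Ckp_continuous[OF y0]])
    fix s :: real and x assume s: "s \<in> {0..1}" and x: "x \<in> U"
    have cy: "continuous_on {0..1} (\<lambda>s. y s x')" if "x' \<in> U" for x' using Ckp_continuous_fiber[OF y0 that] .
    have cH: "continuous_on {0..1} (\<lambda>s. H (y s x'))" if "x' \<in> U" for x'
      using Ckp_continuous_fiber[OF Ckp_compose[OF U W H y0 yW] that] .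
    show "(y s has_derivative (\<lambda>v. \<Sum>b\<in>Basis. inner v b *\<^sub>R \<zeta> b s x)) (at x)"
    proof (rule volterra_differentiable[where F="\<lambda>s x. H (y s x)" and B=B and
          \<beta>="\<lambda>s. frechet_derivative (B s) (at x)" and L="\<lambda>s w. 0" and A="\<lambda>s. lin a s x" and \<zeta>="\<lambda>b s. \<zeta> b s x", OF U x yeq cy cH])
      show "\<exists>d>0. \<forall>v. norm v < d \<longrightarrow> (\<forall>s\<in>{0..1}. norm (B s (x + v) - B s x - frechet_derivative (B s) (at x) v) \<le> e * norm v)" if "e > 0" for e
        using family_differentiable_uniform[OF U x B that] .
      show "\<exists>d>0. \<forall>v. norm v < d \<longrightarrow> (\<forall>s\<in>{0..1}.
          norm (H (y s (x + v)) - H (y s x) - 0 - lin a s x (y s (x + v) - y s x))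
          \<le> e * (norm v + norm (y s (x + v) - y s x)))" if e: "e > 0" for e
      proof -
        \<comment> \<open>A tube of constant radius around the compact trajectory lies in
          \<open>W\<close>. There the translates of \<open>H\<close> along the trajectory form a
          family in \<open>s\<close>, whose linearisation at 0 is uniform in
          \<open>s\<close>.\<close>
        have "compact ((\<lambda>s. y s x) ` {0..1})" by (rule compact_continuous_image[OF cy[OF x] compact_Icc])
        moreover have "(\<lambda>s. y s x) ` {0..1} \<subseteq> W" using yW x by auto
        ultimately obtain r where r: "r > 0" "(\<Union>z\<in>(\<lambda>s. y s x) ` {0..1}. ball z r) \<subseteq> W"
          using compact_subset_open_imp_ball_epsilon_subset[OF _ W] by blast
        have rW: "y s x + z \<in> W" if "s \<in> {0..1}" "z \<in> ball 0 r" for s z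
        proof -
          have "y s x + z \<in> ball (y s x) r" using that by (simp add: dist_norm)
          then show ?thesis using r(2) that by blast
        qed
        have c: "Ckp (Suc 0) {0..1} (ball 0 r) (\<lambda>s z. H (y s x + z))"
          by (rule Ckp_compose[OF open_ball W H _ rW])
            (intro Ckp_add Ckp_fun_param Ckp_id cy x open_ball)
        have c0: "(0::'b) \<in> ball 0 r" using r(1) by simp
        obtain d1 where d1: "d1 > 0" and d1': "\<forall>v. norm v < d1 \<longrightarrow> (\<forall>s\<in>{0..1}.
           norm (H (y s x + (0 + v)) - H (y s x + 0) - frechet_derivative (\<lambda>z. H (y s x + z)) (at 0) v) \<le> e * norm v)"
          using family_differentiable_uniform[OF open_ball c0 c e] by (elim exE conjE)
        have fd: "frechet_derivative (\<lambda>z. H (y s x + z)) (at 0) = lin a s x" if "s \<in> {0..1}" for s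
        proof -
          have "((\<lambda>z. y s x + z) has_derivative (\<lambda>z. z)) (at 0)" by (auto intro!: derivative_eq_intros)
          from has_derivative_compose[OF this, of H "frechet_derivative H (at (y s x))"] dH[OF yW[OF that x]]
          have "((\<lambda>z. H (y s x + z)) has_derivative frechet_derivative H (at (y s x))) (at 0)" by simp
          then show ?thesis using lin_a[OF that x] by (simp add: frechet_derivative_eq)
        qed
        obtain d2 where d2: "d2 > 0" "\<And>v. norm v < d2 \<Longrightarrow> x + v \<in> U \<and> (\<forall>s\<in>{0..1}. norm (y s (x + v) - y s x) \<le> d1 / 2)"
          using family_uniform[OF U x Ckp_continuous[OF y0], of "d1/2"] d1 by auto
        have "norm (H (y s (x + v)) - H (y s x) - 0 - lin a s x (y s (x + v) - y s x))
          \<le> e * (norm v + norm (y s (x + v) - y s x))" if v: "norm v < d2" and s: "s \<in> {0..1}" for v s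
        proof -
          have "norm (y s (x + v) - y s x) \<le> d1 / 2" using d2(2)[OF v] s by blast
          then have "norm (y s (x + v) - y s x) < d1" using d1 by linarith
          from d1'[rule_format, OF this s] have "norm (H (y s (x + v)) - H (y s x) - lin a s x (y s (x + v) - y s x)) \<le> e * norm (y s (x + v) - y s x)"
            by (simp add: fd[OF s])
          moreover have "0 \<le> e * norm v" using e by simp
          ultimately show ?thesis by (simp add: distrib_left)
        qed
        then show ?thesis using d2(1) by blast
      qed
      show "linear (frechet_derivative (B s) (at x))" if "s \<in> {0..1}" for s
        using has_derivative_linear[OF Ckp_SucD(1)[OF B that x]] .
      show "linear (lin a s x)" for s by (rule linear_lin)
      show "norm (lin a s x z) \<le> norm z / 2" if "s \<in> {0..1}" for s z using half'[OF that x] .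
      show "continuous_on {0..1} (\<lambda>s. \<zeta> b s x)" for b using Ckp_continuous_fiber[OF \<zeta>(1) x] .
      have cA: "continuous_on {0..1} (\<lambda>\<sigma>. lin a \<sigma> x (\<zeta> b \<sigma> x))" for b
        by (rule Ckp_continuous_fiber[OF Ckp_lin[OF U _ \<zeta>(1)] x]) (use Ckp_mono[OF ak le0] in auto)
      show "continuous_on {0..1} (\<lambda>\<sigma>. 0 + lin a \<sigma> x (\<zeta> b \<sigma> x))" for b using cA by simp
      show "\<zeta> b s x = frechet_derivative (B s) (at x) b + primitive (\<lambda>\<sigma>. 0 + lin a \<sigma> x (\<zeta> b \<sigma> x)) s" if "s \<in> {0..1}" for b s
        using \<zeta>(2)[OF that x, of b] by (simp add: B'_def)
    qed (use s in \<open>auto intro: linear_zero\<close>)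
  next
    show "Ckp k {0..1} U (\<lambda>s x. \<Sum>b\<in>Basis. inner w b *\<^sub>R \<zeta> b s x)" for w
      by (intro Ckp_sum[OF U] Ckp_scaleR[OF U] Ckp_const[OF U] \<zeta>k)
  qed
qed

text \<open>\<open>y s\<close> is the flow of \<open>H\<close> after time \<open>\<tau> * s\<close>.
  The bound \<open>\<tau> * M \<le> R / 2\<close> keeps trajectories that start in the ball of
  radius \<open>R / 2\<close> inside the ball of radius \<open>R\<close>;
  \<open>\<tau> * L \<le> 1 / 2\<close> gives the contraction, which is exported for the uniqueness
  of the variational equation.\<close>

lemma local_flow:
  fixes H :: "'b::euclidean_space \<Rightarrow> 'b"
  assumes W: "open W" and H: "smooth_on W H" and z0: "z0 \<in> W"
  obtains \<tau> r y where "\<tau> > 0" "r > 0" "\<And>k. Ckp k {0..1} (ball z0 r) y"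
    "\<And>s z. s \<in> {0..1} \<Longrightarrow> z \<in> ball z0 r \<Longrightarrow> y s z \<in> W"
    "\<And>s z. s \<in> {0..1} \<Longrightarrow> z \<in> ball z0 r \<Longrightarrow> y s z = z + primitive (\<lambda>\<sigma>. \<tau> *\<^sub>R H (y \<sigma> z)) s"
    "\<And>s z w. s \<in> {0..1} \<Longrightarrow> z \<in> ball z0 r \<Longrightarrow> norm (\<tau> *\<^sub>R frechet_derivative H (at (y s z)) w) \<le> norm w / 2"
proof -
  obtain R where R: "R > 0" "cball z0 R \<subseteq> W" using W z0 open_contains_cball by blast
  let ?Q = "cball z0 R"
  have dH: "(H has_derivative frechet_derivative H (at z)) (at z)" if "z \<in> W" for z
    using smooth_on_has_derivative[OF H that] .
  have bd: "\<exists>C. \<forall>z\<in>?Q. norm (G z) \<le> C" if "smooth_on W G" for G :: "'b \<Rightarrow> 'b"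
    using compact_imp_bounded[OF compact_continuous_image[OF continuous_on_subset[OF smooth_on_continuous[OF that] R(2)] compact_cball]]
    by (auto simp: bounded_iff)
  obtain M where M: "\<And>z. z \<in> ?Q \<Longrightarrow> norm (H z) \<le> M" using bd[OF H] by blast
  have M0: "M \<ge> 0" using order_trans[OF norm_ge_zero M[of z0]] R(1) by simp
  have "\<forall>b. \<exists>C. \<forall>z\<in>?Q. norm (frechet_derivative H (at z) b) \<le> C" by (rule allI) (rule bd[OF smooth_on_frechet[OF H]])
  then obtain C where C: "\<And>b z. z \<in> ?Q \<Longrightarrow> norm (frechet_derivative H (at z) b) \<le> C b" by metis
  define L where "L = (\<Sum>b\<in>(Basis::'b set). \<bar>C b\<bar>)"
  have L0: "L \<ge> 0" unfolding L_def by (simp add: sum_nonneg)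
  have L: "norm (frechet_derivative H (at z) w) \<le> L * norm w" if z: "z \<in> ?Q" for z w
  proof -
    have "frechet_derivative H (at z) w = (\<Sum>b\<in>Basis. inner w b *\<^sub>R frechet_derivative H (at z) b)"
      using frechet_sum_Basis[OF differentiableI[OF dH]] z R(2) by blast
    also have "norm \<dots> \<le> (\<Sum>b\<in>Basis. \<bar>C b\<bar> * norm w)"
    proof (rule sum_norm_le)
      fix b :: 'b assume b: "b \<in> Basis"
      have "norm (frechet_derivative H (at z) b) \<le> \<bar>C b\<bar>" using C[OF z, of b] by linarith
      from mult_mono[OF this Basis_le_norm[OF b, of w]]
      show "norm (inner w b *\<^sub>R frechet_derivative H (at z) b) \<le> \<bar>C b\<bar> * norm w" by (simp add: mult.commute)
    qed
    finally show ?thesis by (simp add: L_def sum_distrib_right)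
  qed
  \<comment> \<open>The summands 1 prevent a division by zero when \<open>M\<close> or
    \<open>L\<close> vanishes.\<close>
  define \<tau> where "\<tau> = min (R / (2 * (M + 1))) (1 / (2 * (L + 1)))"
  have \<tau>: "\<tau> > 0" using R(1) M0 L0 by (simp add: \<tau>_def)
  have \<tau>M: "\<tau> * M \<le> R / 2"
  proof -
    have "\<tau> * M \<le> R / (2 * (M + 1)) * (M + 1)" using \<tau> M0 R(1) by (intro mult_mono) (auto simp: \<tau>_def)
    also have "\<dots> = R / 2" using M0 by (simp add: field_simps)
    finally show ?thesis .
  qed
  have \<tau>L: "\<tau> * L \<le> 1 / 2"
  proof -
    have "\<tau> * L \<le> 1 / (2 * (L + 1)) * (L + 1)" using \<tau> L0 by (intro mult_mono) (auto simp: \<tau>_def)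
    also have "\<dots> = 1 / 2" using L0 by (simp add: field_simps)
    finally show ?thesis .
  qed
  have \<tau>D: "norm (\<tau> *\<^sub>R frechet_derivative H (at z) w) \<le> norm w / 2" if "z \<in> ?Q" for z w
  proof -
    have "norm (\<tau> *\<^sub>R frechet_derivative H (at z) w) \<le> \<tau> * (L * norm w)"
      using mult_left_mono[OF L[OF that, of w], of \<tau>] \<tau> by simp
    also have "\<dots> \<le> 1/2 * norm w" using mult_right_mono[OF \<tau>L norm_ge_zero[of w]] by (simp add: mult.assoc)
    finally show ?thesis by simp
  qed
  have sm: "smooth_on W (\<lambda>z. \<tau> *\<^sub>R H z)" by (intro smooth_on_scaleR smooth_on_const W H)
  have cH: "continuous_on ?Q (\<lambda>z. \<tau> *\<^sub>R H z)"
    using continuous_on_subset[OF smooth_on_continuous[OF sm] R(2)] .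
  have d\<tau>: "frechet_derivative (\<lambda>z. \<tau> *\<^sub>R H z) (at z) = (\<lambda>w. \<tau> *\<^sub>R frechet_derivative H (at z) w)" if "z \<in> W" for z
    using has_derivative_scaleR_right[OF dH[OF that], of \<tau>] by (rule frechet_derivative_eq)
  let ?K = "cball z0 (R / 2)"
  have cB: "continuous_on ({0..1} \<times> ?K) (\<lambda>p. snd (p :: real \<times> 'b))" by (intro continuous_intros)
  have z0Q: "z0 \<in> ?Q" using R(1) by simp
  have comp: "continuous_on ({0..1} \<times> ?K) (\<lambda>p. \<tau> *\<^sub>R H (y (fst p) (snd p)))"
    if "continuous_on ({0..1} \<times> ?K) (\<lambda>p. y (fst p) (snd p))" "\<And>s x. s \<in> {0..1} \<Longrightarrow> x \<in> ?K \<Longrightarrow> y s x \<in> ?Q"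
    for y :: "real \<Rightarrow> 'b \<Rightarrow> 'b"
    by (rule continuous_on_compose2[OF cH that(1)]) (use that(2) in \<open>auto simp del: mem_cball\<close>)
  obtain y where y: "continuous_on ({0..1} \<times> ?K) (\<lambda>p. y (fst p) (snd p))"
    "\<And>s x. s \<in> {0..1} \<Longrightarrow> x \<in> ?K \<Longrightarrow> y s x \<in> ?Q"
    "\<And>s x. s \<in> {0..1} \<Longrightarrow> x \<in> ?K \<Longrightarrow> y s x = x + primitive (\<lambda>\<sigma>. \<tau> *\<^sub>R H (y \<sigma> x)) s"
  proof (rule picard_fixpoint[OF compact_cball closed_cball z0Q cB, of "\<lambda>s x z. \<tau> *\<^sub>R H z"])
    fix y :: "real \<Rightarrow> 'b \<Rightarrow> 'b"
    assume y: "continuous_on ({0..1} \<times> ?K) (\<lambda>p. y (fst p) (snd p))" "\<And>s x. s \<in> {0..1} \<Longrightarrow> x \<in> ?K \<Longrightarrow> y s x \<in> ?Q"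
    show "continuous_on ({0..1} \<times> ?K) (\<lambda>p. \<tau> *\<^sub>R H (y (fst p) (snd p)))" by (rule comp[OF y])
    fix s :: real and x assume s: "s \<in> {0..1}" and x: "x \<in> ?K"
    have "norm (primitive (\<lambda>\<sigma>. \<tau> *\<^sub>R H (y \<sigma> x)) s) \<le> R / 2"
    proof (rule primitive_bound[OF _ s])
      have "continuous_on {0..1::real} (\<lambda>\<sigma>. (\<sigma>, x))" by (intro continuous_intros)
      moreover have "(\<lambda>\<sigma>. (\<sigma>, x)) ` {0..1} \<subseteq> {0..1} \<times> ?K" using x by blast
      ultimately have "continuous_on {0..1} (\<lambda>\<sigma>. \<tau> *\<^sub>R H (y (fst (\<sigma>, x)) (snd (\<sigma>, x))))"
        by (rule continuous_on_compose2[OF comp[OF y], rotated 2])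
      then show "continuous_on {0..1} (\<lambda>\<sigma>. \<tau> *\<^sub>R H (y \<sigma> x))" by simp
    next
      show "norm (\<tau> *\<^sub>R H (y \<sigma> x)) \<le> R / 2" if "\<sigma> \<in> {0..1}" for \<sigma>
      proof -
        have "\<tau> * norm (H (y \<sigma> x)) \<le> \<tau> * M" using mult_left_mono[OF M[OF y(2)[OF that x]], of \<tau>] \<tau> by simp
        moreover have "norm (\<tau> *\<^sub>R H (y \<sigma> x)) = \<tau> * norm (H (y \<sigma> x))" using \<tau> by simp
        ultimately show ?thesis using \<tau>M by linarith
      qed
    qed
    moreover have "dist z0 (x + primitive (\<lambda>\<sigma>. \<tau> *\<^sub>R H (y \<sigma> x)) s) \<le> dist z0 x + norm (primitive (\<lambda>\<sigma>. \<tau> *\<^sub>R H (y \<sigma> x)) s)"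
      using norm_triangle_ineq4[of "z0 - x" "primitive (\<lambda>\<sigma>. \<tau> *\<^sub>R H (y \<sigma> x)) s"] by (simp add: dist_norm diff_diff_eq)
    ultimately show "x + primitive (\<lambda>\<sigma>. \<tau> *\<^sub>R H (y \<sigma> x)) s \<in> ?Q" using x by (simp only: mem_cball)
  next
    fix s :: real and x y z assume yz: "y \<in> ?Q" "z \<in> ?Q"
    have "norm (\<tau> *\<^sub>R H y - \<tau> *\<^sub>R H z) \<le> 1/2 * norm (y - z)"
    proof (rule differentiable_bound[OF convex_cball _ _ yz])
      show "((\<lambda>z. \<tau> *\<^sub>R H z) has_derivative (\<lambda>w. \<tau> *\<^sub>R frechet_derivative H (at x) w)) (at x within ?Q)" if "x \<in> ?Q" for x
        using has_derivative_at_withinI[OF has_derivative_scaleR_right[OF dH]] that R(2) by blast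
      show "onorm (\<lambda>w. \<tau> *\<^sub>R frechet_derivative H (at x) w) \<le> 1/2" if "x \<in> ?Q" for x
        by (rule onorm_bound) (use \<tau>D[OF that] in auto)
    qed
    then show "norm (\<tau> *\<^sub>R H y - \<tau> *\<^sub>R H z) \<le> norm (y - z) / 2" by simp
  next
    fix y :: "real \<Rightarrow> 'b \<Rightarrow> 'b"
    assume "continuous_on ({0..1} \<times> ?K) (\<lambda>p. y (fst p) (snd p))"
      "\<And>s x. s \<in> {0..1} \<Longrightarrow> x \<in> ?K \<Longrightarrow> y s x \<in> ?Q"
      "\<And>s x. s \<in> {0..1} \<Longrightarrow> x \<in> ?K \<Longrightarrow> y s x = x + primitive (\<lambda>\<sigma>. \<tau> *\<^sub>R H (y \<sigma> x)) s"
    then show thesis by (rule that)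
  qed
  let ?B = "ball z0 (R / 2)"
  have BK: "z \<in> ?K" if "z \<in> ?B" for z using that by simp
  have yW: "y s z \<in> W" if "s \<in> {0..1}" "z \<in> ?B" for s z
    using subsetD[OF R(2) y(2)[OF that(1) BK[OF that(2)]]] .
  have yk: "Ckp k {0..1} ?B y" for k
  proof (rule Ckp_volterra_flow[OF open_ball W _ yW _ _ Ckp_id[OF open_ball]])
    show "Ckp k {0::real} W (\<lambda>_ z. \<tau> *\<^sub>R H z)" for k using smooth_on_Ckp[OF W sm] .
    show "norm (frechet_derivative (\<lambda>z. \<tau> *\<^sub>R H z) (at (y s x)) z) \<le> norm z / 2" if "s \<in> {0..1}" "x \<in> ?B" for s x z
      using \<tau>D[OF y(2)[OF that(1) BK[OF that(2)]]] d\<tau>[OF yW[OF that]] by simp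
    have "continuous_on ({0..1} \<times> ?B) (\<lambda>p. y (fst p) (snd p))"
      by (rule continuous_on_subset[OF y(1)]) (use ball_subset_cball in blast)
    then show "Ckp 0 {0..1} ?B y" by simp
    show "y s x = x + primitive (\<lambda>\<sigma>. \<tau> *\<^sub>R H (y \<sigma> x)) s" if "s \<in> {0..1}" "x \<in> ?B" for s x
      using y(3)[OF that(1) BK[OF that(2)]] .
  qed
  show ?thesis
  proof (rule that[OF \<tau> _ yk yW])
    show "R / 2 > 0" using R(1) by simp
    show "y s z = z + primitive (\<lambda>\<sigma>. \<tau> *\<^sub>R H (y \<sigma> z)) s" if "s \<in> {0..1}" "z \<in> ?B" for s z
      using y(3)[OF that(1) BK[OF that(2)]] .
    show "norm (\<tau> *\<^sub>R frechet_derivative H (at (y s z)) w) \<le> norm w / 2" if "s \<in> {0..1}" "z \<in> ?B" for s z w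
      using \<tau>D[OF y(2)[OF that(1) BK[OF that(2)]]] .
  qed
qed

section \<open>Smooth solutions of linear systems and local diffeomorphisms\<close>

lemma Ckp_det:
  assumes "open U" "\<And>i j. i < r \<Longrightarrow> j < r \<Longrightarrow> Ckp k T U (A i j)"
  shows "Ckp k T U (\<lambda>s x. det (mat r r (\<lambda>(i, j). A i j s x) :: real mat))"
proof -
  have eq: "det (mat r r (\<lambda>(i, j). A i j s x)) =
     (\<Sum>p\<in>{p. p permutes {0..<r}}. signof p * (\<Prod>i\<in>{0..<r}. A i (p i) s x))" for s x
    unfolding det_def by (auto intro!: sum.cong prod.cong simp: permutes_in_image)
  show ?thesis unfolding eq
  proof (intro Ckp_sum Ckp_mult Ckp_const Ckp_prod assms)
    fix p i assume "p \<in> {p. p permutes {0..<r}}" "i \<in> {0..<r}"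
    then show "i < r" "p i < r" using permutes_in_image[of p "{0..<r}" i] by auto
  qed
qed

lemma Ckp_adj_mat:
  assumes "open U" "\<And>i j. i < r \<Longrightarrow> j < r \<Longrightarrow> Ckp k T U (A i j)" "a < r" "b < r"
  shows "Ckp k T U (\<lambda>s x. adj_mat (mat r r (\<lambda>(i, j). A i j s x) :: real mat) $$ (a, b))"
proof -
  \<comment> \<open>\<open>sh c\<close> enumerates the indices other than \<open>c\<close>. Because
    of the transposition in the adjugate, its entry \<open>(a, b)\<close> deletes row
    \<open>b\<close> and column \<open>a\<close>.\<close>
  define sh where "sh c i = (if i < c then i else Suc i)" for c i :: nat
  have sh: "sh c i < r" if "i < r - 1" for c i using that by (auto simp: sh_def)
  have eq: "adj_mat (mat r r (\<lambda>(i, j). A i j s x)) $$ (a, b) =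
     (-1) ^ (b + a) * det (mat (r - 1) (r - 1) (\<lambda>(i, j). A (sh b i) (sh a j) s x))" for s x
  proof -
    have "mat_delete (mat r r (\<lambda>(i, j). A i j s x)) b a = mat (r - 1) (r - 1) (\<lambda>(i, j). A (sh b i) (sh a j) s x)"
      unfolding mat_delete_def by (rule cong_mat) (use sh in \<open>auto simp: sh_def\<close>)
    then show ?thesis using assms(3,4) by (simp add: adj_mat_def cofactor_def)
  qed
  show ?thesis unfolding eq
    by (intro Ckp_mult Ckp_const Ckp_det assms sh)
qed

lemma linear_solve_adj:
  fixes M :: "real mat"
  assumes M: "M \<in> carrier_mat r r" "det M \<noteq> 0" and v: "v \<in> carrier_vec r" "M *\<^sub>v v = w" and "j < r"
  shows "v $ j = inverse (det M) * (\<Sum>i<r. adj_mat M $$ (j, i) * w $ i)"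
proof -
  note adj = adj_mat[OF M(1)]
  have w: "w \<in> carrier_vec r" using v M(1) mult_mat_vec_carrier by blast
  have "adj_mat M *\<^sub>v w = (adj_mat M * M) *\<^sub>v v"
    using assoc_mult_mat_vec[OF adj(1) M(1) v(1)] v(2) by simp
  also have "\<dots> = (det M \<cdot>\<^sub>m 1\<^sub>m r) *\<^sub>v v" using adj(3) by simp
  also have "\<dots> = det M \<cdot>\<^sub>v v" using v(1) by auto
  finally have "(adj_mat M *\<^sub>v w) $ j = det M * v $ j" using v(1) \<open>j < r\<close> by simp
  moreover have "(adj_mat M *\<^sub>v w) $ j = (\<Sum>i<r. adj_mat M $$ (j, i) * w $ i)"
    using adj(1) w \<open>j < r\<close> by (simp add: scalar_prod_def atLeast0LessThan)
  ultimately show ?thesis using M(2) by simp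
qed

text \<open>Cramer's rule writes a pointwise solution as a rational expression in the coefficients,
  so it inherits their class.\<close>

lemma Ckp_linear_solve:
  fixes A :: "nat \<Rightarrow> nat \<Rightarrow> 's::topological_space \<Rightarrow> 'a::real_normed_vector \<Rightarrow> real"
  assumes U: "open U" and A: "\<And>i j. i < r \<Longrightarrow> j < r \<Longrightarrow> Ckp k T U (A i j)"
    and w: "\<And>i. i < r \<Longrightarrow> Ckp k T U (w i)"
    and nz: "\<And>s x. s \<in> T \<Longrightarrow> x \<in> U \<Longrightarrow> det (mat r r (\<lambda>(i, j). A i j s x)) \<noteq> 0"
    and eq: "\<And>s x i. s \<in> T \<Longrightarrow> x \<in> U \<Longrightarrow> i < r \<Longrightarrow> (\<Sum>j<r. A i j s x * v j s x) = w i s x"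
    and j: "j < r"
  shows "Ckp k T U (v j)"
proof -
  define M where "M s x = mat r r (\<lambda>(i, j). A i j s x)" for s x
  have "Ckp k T U (\<lambda>s x. inverse (det (M s x)) * (\<Sum>i<r. adj_mat (M s x) $$ (j, i) * w i s x))"
    unfolding M_def
    by (intro Ckp_mult Ckp_inverse Ckp_sum Ckp_det Ckp_adj_mat U A nz j w) auto
  moreover have "inverse (det (M s x)) * (\<Sum>i<r. adj_mat (M s x) $$ (j, i) * w i s x) = v j s x"
    if "s \<in> T" "x \<in> U" for s x
  proof -
    have M: "M s x \<in> carrier_mat r r" by (simp add: M_def)
    have "M s x *\<^sub>v vec r (\<lambda>j. v j s x) = vec r (\<lambda>i. w i s x)"
      by (rule eq_vecI) (use eq[OF that] in \<open>simp_all add: M_def scalar_prod_def atLeast0LessThan row_def\<close>)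
    from linear_solve_adj[OF M _ _ this j] nz[OF that] j show ?thesis by (simp add: M_def)
  qed
  ultimately show ?thesis by (rule Ckp_cong_imp[OF U, rotated])
qed

lemma smooth_on_linear_solve:
  assumes U: "open U" and A: "\<And>i j. i < r \<Longrightarrow> j < r \<Longrightarrow> smooth_on U (A i j)"
    and w: "\<And>i. i < r \<Longrightarrow> smooth_on U (w i)"
    and nz: "\<And>x. x \<in> U \<Longrightarrow> det (mat r r (\<lambda>(i, j). A i j x) :: real mat) \<noteq> 0"
    and eq: "\<And>x i. x \<in> U \<Longrightarrow> i < r \<Longrightarrow> (\<Sum>j<r. A i j x * v j x) = w i x"
    and j: "j < r"
  shows "smooth_on U (v j)"
  unfolding smooth_on_iff_Ckp[OF U]
proof
  show "Ckp k {0::real} U (\<lambda>_. v j)" for k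
    by (rule Ckp_linear_solve[where A="\<lambda>i j _. A i j" and w="\<lambda>i _. w i" and r=r and v="\<lambda>j _. v j",
          OF U smooth_on_Ckp[OF U A] smooth_on_Ckp[OF U w] nz eq j])
qed

lemma linear_inj_det:
  fixes D :: "'a::euclidean_space \<Rightarrow> 'a"
  assumes "linear D" "inj D" "bij_betw e {..<r} (Basis :: 'a set)"
  shows "det (mat r r (\<lambda>(i, j). inner (D (e j)) (e i))) \<noteq> 0"
proof
  define M where "M = mat r r (\<lambda>(i, j). inner (D (e j)) (e i))"
  assume "det (mat r r (\<lambda>(i, j). inner (D (e j)) (e i))) = 0"
  then obtain v where v: "v \<in> carrier_vec r" "v \<noteq> 0\<^sub>v r" "M *\<^sub>v v = 0\<^sub>v r"
    using det_0_iff_vec_prod_zero_field[of M r] by (auto simp: M_def)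
  define z where "z = (\<Sum>j<r. v $ j *\<^sub>R e j)"
  have Dz: "inner (D z) b = 0" if "b \<in> Basis" for b
  proof -
    have "b \<in> e ` {..<r}" using that bij_betw_imp_surj_on[OF assms(3)] by simp
    then obtain i where i: "i < r" "b = e i" by blast
    have "(M *\<^sub>v v) $ i = (\<Sum>j<r. inner (D (e j)) (e i) * v $ j)"
      using i v(1) by (simp add: M_def scalar_prod_def atLeast0LessThan row_def)
    moreover have "inner (D z) b = (\<Sum>j<r. v $ j * inner (D (e j)) (e i))"
      using assms(1) by (simp add: z_def i linear_sum linear_scale inner_sum_left)
    ultimately show ?thesis using v(3) i by (simp add: mult.commute)
  qed
  have "D z = 0" by (rule euclidean_eqI) (simp add: Dz)
  then have z0: "z = 0" using assms(1,2) linear_injective_0 by blast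
  have "v $ i = 0" if "i < r" for i
  proof -
    have ei: "e i \<in> Basis" using assms(3) that by (auto simp: bij_betw_def)
    have "inner z (e i) = (\<Sum>j<r. v $ j * inner (e j) (e i))" by (simp add: z_def inner_sum_left)
    also have "\<dots> = (\<Sum>j<r. if j = i then v $ j else 0)"
    proof (rule sum.cong[OF refl])
      fix j assume "j \<in> {..<r}"
      then have "e j \<in> Basis" "e j = e i \<longleftrightarrow> j = i" using assms(3) that by (auto simp: bij_betw_def inj_on_def)
      then show "v $ j * inner (e j) (e i) = (if j = i then v $ j else 0)" using ei by (simp add: inner_Basis)
    qed
    also have "\<dots> = v $ i" using that by simp
    finally show ?thesis using z0 by simp
  qed
  then have "v = 0\<^sub>v r" using v(1) by (intro eq_vecI) auto
  then show False using v(2) by simp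
qed

text \<open>The derivative of \<open>g\<close> solves a linear system whose matrix is the derivative
  of \<open>F\<close> at \<open>g y\<close>. If \<open>g\<close> is of class \<open>k\<close>, so is
  this matrix, and Cramer's rule raises \<open>g\<close> to class \<open>k + 1\<close>.\<close>

lemma Ckp_inverse_function:
  fixes F :: "'a::euclidean_space \<Rightarrow> 'a"
  assumes U: "open U" and V: "open V" and F: "smooth_on U F"
    and g: "\<And>y. y \<in> V \<Longrightarrow> g y \<in> U" "\<And>y. y \<in> V \<Longrightarrow> (g has_derivative g' y) (at y)"
    and inv: "\<And>y w. y \<in> V \<Longrightarrow> frechet_derivative F (at (g y)) (g' y w) = w"
    and inj: "\<And>y. y \<in> V \<Longrightarrow> inj (frechet_derivative F (at (g y)))"
  shows "Ckp k {0::real} V (\<lambda>_. g)"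
proof (induction k)
  case 0
  have "continuous_on V g" using g(2) has_derivative_continuous continuous_at_imp_continuous_on by blast
  then show ?case using continuous_on_const_param[of V g] by simp
next
  case (Suc k)
  obtain e where "bij_betw e {0..<DIM('a)} (Basis :: 'a set)"
    using ex_bij_betw_nat_finite[OF finite_Basis] by blast
  then have e: "bij_betw e {..<DIM('a)} (Basis :: 'a set)" by (simp add: atLeast0LessThan)
  have dF: "(F has_derivative frechet_derivative F (at (g y))) (at (g y))" if "y \<in> V" for y
    using smooth_on_has_derivative[OF F g(1)[OF that]] .
  have comp: "Ckp k {0::real} V (\<lambda>_ y. inner (g' y w) b)" if "b \<in> Basis" for w and b :: 'a
  proof -
    have "b \<in> e ` {..<DIM('a)}" using that bij_betw_imp_surj_on[OF e] by simp
    then obtain j where j: "j < DIM('a)" "b = e j" by blast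
    have "Ckp k {0::real} V (\<lambda>_ y. inner (g' y w) (e j))"
    proof (rule Ckp_linear_solve[where r="DIM('a)" and A="\<lambda>i j _ y. inner (frechet_derivative F (at (g y)) (e j)) (e i)"
            and w="\<lambda>i _ y. inner w (e i)" and v="\<lambda>j _ y. inner (g' y w) (e j)"])
      show "Ckp k {0::real} V (\<lambda>_ y. inner (frechet_derivative F (at (g y)) (e j)) (e i))" for i j
        by (intro Ckp_compose_linear[OF V bounded_linear_inner_left]
            Ckp_compose[OF V U smooth_on_Ckp[OF U smooth_on_frechet[OF F]] Suc g(1)])
      show "det (mat DIM('a) DIM('a) (\<lambda>(i, j). inner (frechet_derivative F (at (g y)) (e j)) (e i))) \<noteq> 0" if "y \<in> V" for y
        by (rule linear_inj_det[OF has_derivative_linear[OF dF[OF that]] inj[OF that] e])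
      show "(\<Sum>j<DIM('a). inner (frechet_derivative F (at (g y)) (e j)) (e i) * inner (g' y w) (e j)) = inner w (e i)"
        if "y \<in> V" for y i
      proof -
        have "inner w (e i) = inner (frechet_derivative F (at (g y)) (g' y w)) (e i)" using inv[OF that] by simp
        also have "frechet_derivative F (at (g y)) (g' y w) = (\<Sum>b\<in>Basis. inner (g' y w) b *\<^sub>R frechet_derivative F (at (g y)) b)"
          by (rule frechet_sum_Basis[OF differentiableI[OF dF[OF that]]])
        also have "\<dots> = (\<Sum>j<DIM('a). inner (g' y w) (e j) *\<^sub>R frechet_derivative F (at (g y)) (e j))"
          by (rule sum.reindex_bij_betw[OF e, symmetric])
        finally show ?thesis by (simp add: inner_sum_left mult.commute)
      qed
    qed (use j V in \<open>auto intro: Ckp_const\<close>)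
    then show ?thesis using j by simp
  qed
  show ?case
  proof (rule Ckp_SucI[OF V _ g(2)])
    show "continuous_on ({0::real} \<times> V) (\<lambda>p. g (snd p))" using Ckp_continuous[OF Suc] .
    show "Ckp k {0::real} V (\<lambda>s x. g' x w)" for w
    proof -
      have "Ckp k {0::real} V (\<lambda>s x. \<Sum>b\<in>Basis. inner (g' x w) b *\<^sub>R b)"
        by (intro Ckp_sum[OF V] Ckp_scaleR[OF V] Ckp_const[OF V] comp)
      then show ?thesis by (simp add: euclidean_representation)
    qed
  qed
qed

theorem local_diffeo:
  fixes F :: "'a::euclidean_space \<Rightarrow> 'a"
  assumes U: "open U" "x0 \<in> U" and F: "smooth_on U F"
    and inj: "\<And>w. frechet_derivative F (at x0) w = 0 \<Longrightarrow> w = 0"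
  obtains V where "open V" "x0 \<in> V" "V \<subseteq> U" "diffeo_on V F"
proof -
  define f' where "f' x = Blinfun (frechet_derivative F (at x))" for x
  have dF: "(F has_derivative frechet_derivative F (at x)) (at x)" if "x \<in> U" for x
    using smooth_on_has_derivative[OF F that] .
  have f': "blinfun_apply (f' x) = frechet_derivative F (at x)" if "x \<in> U" for x
    unfolding f'_def using dF[OF that] by (simp add: bounded_linear_Blinfun_apply has_derivative_bounded_linear)
  have cont: "continuous_on U f'"
  proof (rule continuous_on_blinfun_componentwise)
    show "continuous_on U (\<lambda>x. blinfun_apply (f' x) i)" for i
      by (rule continuous_on_eq[OF smooth_on_continuous[OF smooth_on_frechet[OF F, of i]]]) (simp add: f')
  qed
  have lin: "linear (frechet_derivative F (at x0))" using has_derivative_linear[OF dF[OF U(2)]] .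
  have "inj (frechet_derivative F (at x0))" using inj lin linear_injective_0 by blast
  \<comment> \<open>An injective endomorphism of a finite-dimensional space has a left inverse; this
    is the form in which the inverse function theorem receives invertibility.\<close>
  then obtain h where h: "linear h" "h \<circ> frechet_derivative F (at x0) = id"
    using linear_injective_left_inverse[OF lin] by blast
  have inv0: "Blinfun h o\<^sub>L f' x0 = id_blinfun"
  proof (rule blinfun_eqI)
    fix i
    show "blinfun_apply (Blinfun h o\<^sub>L f' x0) i = blinfun_apply id_blinfun i"
      using h(2) f'[OF U(2)] h(1) by (simp add: bounded_linear_Blinfun_apply linear_linear fun_eq_iff)
  qed
  have derf: "(F has_derivative blinfun_apply (f' x)) (at x)" if "x \<in> U" for x
    using dF[OF that] f'[OF that] by simp
  obtain V' V g g' where V': "open V'" "V' \<subseteq> U" "x0 \<in> V'" and V: "open V" "F x0 \<in> V" "homeomorphism V' V F g"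
    and g: "\<And>y. y \<in> V \<Longrightarrow> (g has_derivative (g' y)) (at y)"
    "\<And>y. y \<in> V \<Longrightarrow> g' y = inv_into UNIV (blinfun_apply (f'(g y)))"
    "\<And>y. y \<in> V \<Longrightarrow> bij (blinfun_apply (f'(g y)))"
    by (rule inverse_function_theorem[OF U(1) derf cont U(2) inv0]) (assumption | (rule that; assumption))+
  have gV: "g y \<in> V'" if "y \<in> V" for y
    using imageI[OF that, of g] homeomorphism_image2[OF V(3)] by simp
  have gU: "g y \<in> U" if "y \<in> V" for y using subsetD[OF V'(2) gV[OF that]] .
  have Vim: "F ` V' = V" by (rule homeomorphism_image1[OF V(3)])
  have gF: "g (F x) = x" if "x \<in> V'" for x by (rule homeomorphism_apply1[OF V(3) that])
  have inj': "inj_on F V'" by (rule inj_on_inverseI[of _ g]) (rule gF)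
  have "smooth_on V g"
    unfolding smooth_on_iff_Ckp[OF V(1)]
  proof (rule allI, rule Ckp_inverse_function[OF U(1) V(1) F gU g(1)])
    fix y assume y: "y \<in> V"
    have b: "bij (frechet_derivative F (at (g y)))" using g(3)[OF y] f'[OF gU[OF y]] by simp
    show "frechet_derivative F (at (g y)) (g' y w) = w" for w
      using g(2)[OF y] f'[OF gU[OF y]] bij_is_surj[OF b] by (simp add: surj_f_inv_f)
    show "inj (frechet_derivative F (at (g y)))" using bij_is_inj[OF b] .
  qed
  moreover have "inv_into V' F y = g y" if "y \<in> V" for y
    using inv_into_f_f[OF inj' gV[OF that]] homeomorphism_apply2[OF V(3) that] by simp
  ultimately have "smooth_on V (inv_into V' F)" using smooth_on_cong[OF V(1), of "inv_into V' F" g] by simp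
  then have "diffeo_on V' F"
    unfolding diffeo_on_def Vim using V'(1) V(1) inj' smooth_on_subset[OF F U(1) V'(1,2)] by simp
  then show thesis by (rule that[OF V'(1,3,2)])
qed

section \<open>First integrals of commuting vector fields\<close>

lemma primitive_linear:
  fixes f :: "real \<Rightarrow> 'b::euclidean_space" and L :: "'b \<Rightarrow> 'c::euclidean_space"
  assumes "bounded_linear L" "continuous_on {0..1} f" "s \<in> {0..1}"
  shows "L (primitive f s) = primitive (\<lambda>\<sigma>. L (f \<sigma>)) s"
proof -
  have "L (primitive f s) = s *\<^sub>R L (integral {0..1} (\<lambda>\<sigma>. f (s * \<sigma>)))"
    using assms(1) by (simp add: primitive_def bounded_linear.linear linear_scale)
  also have "L (integral {0..1} (\<lambda>\<sigma>. f (s * \<sigma>))) = integral {0..1} (L \<circ> (\<lambda>\<sigma>. f (s * \<sigma>)))"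
    by (rule integral_linear[OF primitive_integrable[OF assms(2,3)] assms(1), symmetric])
  finally show ?thesis by (simp add: primitive_def o_def)
qed

lemma primitive_zero: "primitive (\<lambda>_. 0) s = 0"
  by (simp add: primitive_def)

lemma primitive_at_0: "primitive f 0 = 0"
  by (simp add: primitive_def)

text \<open>
  Flowing from \<open>x\<close> along \<open>-\<Sum>\<^sub>i (Om\<^sub>i(x) - Om\<^sub>i(x\<^sub>0)) X\<^sub>i\<close> for unit time ends on the common level set of the \<open>Om\<^sub>i\<close>
  through \<open>x\<^sub>0\<close>; the end point \<open>\<lambda>(x)\<close> is constant along the leaves. Indeed the derivative of the
  flow in direction \<open>X\<^sub>j\<close> is \<open>(1 - s) X\<^sub>j\<close>, because that solves the variational equation when the fields commute.
\<close>

theorem commuting_first_integrals: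
  fixes X :: "nat \<Rightarrow> 'a::euclidean_space \<Rightarrow> 'a" and Om :: "nat \<Rightarrow> 'a \<Rightarrow> real"
  assumes U: "open U" "x0 \<in> U" and m: "m \<le> DIM('a)"
    and X: "\<And>i. i < m \<Longrightarrow> smooth_on U (X i)" and Om: "\<And>i. i < m \<Longrightarrow> smooth_on U (Om i)"
    and dual: "\<And>i j x. i < m \<Longrightarrow> j < m \<Longrightarrow> x \<in> U \<Longrightarrow>
        frechet_derivative (Om i) (at x) (X j x) = (if i = j then 1 else 0)"
    and comm: "\<And>i j x. i < m \<Longrightarrow> j < m \<Longrightarrow> x \<in> U \<Longrightarrow>
        frechet_derivative (X i) (at x) (X j x) = frechet_derivative (X j) (at x) (X i x)"
  obtains V lam where "open V" "x0 \<in> V" "V \<subseteq> U" "smooth_on V (lam :: 'a \<Rightarrow> 'a)"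
    "\<And>x j. x \<in> V \<Longrightarrow> j < m \<Longrightarrow> frechet_derivative lam (at x) (X j x) = 0"
    "\<And>w. frechet_derivative lam (at x0) w = w - (\<Sum>i<m. frechet_derivative (Om i) (at x0) w *\<^sub>R X i x0)"
proof -
  \<comment> \<open>\<open>m\<close> is a number and not a type, so the \<open>m\<close> flow times
    are packed into one vector of the state space along its first \<open>m\<close> basis vectors.
    This is where the bound on \<open>m\<close> enters.\<close>
  obtain e where eb: "bij_betw e {0..<DIM('a)} (Basis :: 'a set)"
    using ex_bij_betw_nat_finite[OF finite_Basis] by blast
  have ee: "inner (e i) (e j) = (if i = j then 1 else 0)" if "i < m" "j < m" for i j
  proof -
    have ij: "i \<in> {0..<DIM('a)}" "j \<in> {0..<DIM('a)}" using that m by simp_all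
    then have "e i \<in> Basis" "e j \<in> Basis" using bij_betwE[OF eb] by simp_all
    then show ?thesis using inj_on_eq_iff[OF bij_betw_imp_inj_on[OF eb] ij] by (simp add: inner_Basis)
  qed
  define W where "W = (UNIV :: 'a set) \<times> U"
  have W: "open W" unfolding W_def by (intro open_Times open_UNIV U)
  \<comment> \<open>In the doubled space the first component stores the flow times and stays
    constant. The dependence on the flow times thereby becomes dependence on the initial value,
    which \<open>local_flow\<close> covers.\<close>
  define H where "H z = (0 :: 'a, - (\<Sum>i<m. inner (fst z) (e i) *\<^sub>R X i (snd z)))" for z :: "'a \<times> 'a"
  have sH: "smooth_on W H"
  proof -
    have "smooth_on W (\<lambda>z. - (\<Sum>i<m. inner (fst z) (e i) *\<^sub>R X i (snd z)))"
    proof (intro smooth_on_minus smooth_on_sum smooth_on_scaleR W)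
      fix i assume "i \<in> {..<m}"
      then have i: "i < m" by simp
      show "smooth_on W (\<lambda>z. inner (fst z) (e i))"
        by (rule smooth_on_linear[OF W bounded_linear_compose[OF bounded_linear_inner_left bounded_linear_fst]])
      show "smooth_on W (\<lambda>z. X i (snd z))"
        by (rule smooth_on_compose[OF W U(1) X[OF i] smooth_on_linear[OF W bounded_linear_snd]]) (auto simp: W_def)
    qed
    from smooth_on_compose_linear[OF W _ this, of "\<lambda>y. (0, y)"]
    show ?thesis unfolding H_def[abs_def] by (simp add: bounded_linear_Pair bounded_linear_zero bounded_linear_ident)
  qed
  have dX: "(X i has_derivative frechet_derivative (X i) (at y)) (at y)" if "i < m" "y \<in> U" for i y
    using smooth_on_has_derivative[OF X[OF that(1)] that(2)] .
  have dOm: "(Om i has_derivative frechet_derivative (Om i) (at y)) (at y)" if "i < m" "y \<in> U" for i y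
    using smooth_on_has_derivative[OF Om[OF that(1)] that(2)] .
  have dH: "frechet_derivative H (at z) h = (0, - (\<Sum>i<m. inner (fst z) (e i) *\<^sub>R frechet_derivative (X i) (at (snd z)) (snd h)
       + inner (fst h) (e i) *\<^sub>R X i (snd z)))" if z: "z \<in> W" for z h
  proof -
    have zU: "snd z \<in> U" using z by (auto simp: W_def)
    have "(H has_derivative (\<lambda>h. (0, - (\<Sum>i<m. inner (fst z) (e i) *\<^sub>R frechet_derivative (X i) (at (snd z)) (snd h)
       + inner (fst h) (e i) *\<^sub>R X i (snd z))))) (at z)"
      unfolding H_def
    proof (intro has_derivative_Pair has_derivative_const has_derivative_minus has_derivative_sum has_derivative_scaleR)
      fix i assume "i \<in> {..<m}"
      then have i: "i < m" by simp
      show "((\<lambda>z. inner (fst z) (e i)) has_derivative (\<lambda>h. inner (fst h) (e i))) (at z)"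
        by (intro bounded_linear_imp_has_derivative bounded_linear_compose[OF bounded_linear_inner_left bounded_linear_fst])
      show "((\<lambda>z. X i (snd z)) has_derivative (\<lambda>h. frechet_derivative (X i) (at (snd z)) (snd h))) (at z)"
        using has_derivative_compose[OF bounded_linear_imp_has_derivative[OF bounded_linear_snd] dX[OF i zU]] .
    qed
    then show ?thesis by (simp add: frechet_derivative_eq)
  qed
  have z0: "(0, x0) \<in> W" using U by (simp add: W_def)
  obtain \<tau> r Y where \<tau>: "\<tau> > 0" and r: "r > 0"
    and Yk: "\<And>k. Ckp k {0..1} (ball (0, x0) r) Y"
    and YW: "\<And>s z. s \<in> {0..1} \<Longrightarrow> z \<in> ball (0, x0) r \<Longrightarrow> Y s z \<in> W"
    and Yeq: "\<And>s z. s \<in> {0..1} \<Longrightarrow> z \<in> ball (0, x0) r \<Longrightarrow> Y s z = z + primitive (\<lambda>\<sigma>. \<tau> *\<^sub>R H (Y \<sigma> z)) s"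
    and Yh: "\<And>s z w. s \<in> {0..1} \<Longrightarrow> z \<in> ball (0, x0) r \<Longrightarrow> norm (\<tau> *\<^sub>R frechet_derivative H (at (Y s z)) w) \<le> norm w / 2"
    by (rule local_flow[OF W sH z0]) (assumption | (rule that; assumption))+
  \<comment> \<open>The divisor cancels the speed \<open>\<tau>\<close> of
    \<open>local_flow\<close>: over the unit interval the state follows the \<open>X i\<close> with
    coefficients \<open>- (Om i x - Om i x0)\<close>.\<close>
  define t where "t x = (\<Sum>i<m. ((Om i x - Om i x0) / \<tau>) *\<^sub>R e i)" for x
  define c where "c x = (t x, x)" for x
  have te: "inner (t x) (e i) = (Om i x - Om i x0) / \<tau>" if i: "i < m" for i x
  proof -
    have "inner (t x) (e i) = (\<Sum>j<m. if j = i then (Om j x - Om j x0) / \<tau> else 0)"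
      unfolding t_def inner_sum_left by (rule sum.cong) (use ee i in auto)
    then show ?thesis using i by simp
  qed
  have st: "smooth_on U t"
  proof -
    have "smooth_on U (\<lambda>x. \<Sum>i<m. (inverse \<tau> * (Om i x - Om i x0)) *\<^sub>R e i)"
      by (intro smooth_on_sum smooth_on_scaleR smooth_on_mult smooth_on_diff smooth_on_const U Om) auto
    then show ?thesis unfolding t_def[abs_def] by (simp add: divide_inverse mult.commute)
  qed
  have sc: "smooth_on U c"
  proof -
    have "smooth_on U (\<lambda>x. (t x, 0) + (0, x))"
      by (intro smooth_on_add U smooth_on_compose_linear[OF _ _ st] smooth_on_linear
          bounded_linear_Pair bounded_linear_zero bounded_linear_ident)
    then show ?thesis unfolding c_def[abs_def] by simp
  qed
  have c0: "c x0 = (0, x0)" by (simp add: c_def t_def)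
  define V where "V = U \<inter> c -` ball (0, x0) r"
  have V: "open V" unfolding V_def using continuous_open_preimage[OF smooth_on_continuous[OF sc] U(1) open_ball] .
  have VU: "V \<subseteq> U" and cV: "c x \<in> ball (0, x0) r" if "x \<in> V" for x using that by (auto simp: V_def)
  have VU: "V \<subseteq> U" by (auto simp: V_def)
  have x0V: "x0 \<in> V" using U(2) r c0 by (simp add: V_def)
  define \<Gamma> where "\<Gamma> s x = Y s (c x)" for s x
  have \<Gamma>W: "\<Gamma> s x \<in> W" if "s \<in> {0..1}" "x \<in> V" for s x unfolding \<Gamma>_def using YW[OF that(1) cV[OF that(2)]] .
  have \<Gamma>U: "snd (\<Gamma> s x) \<in> U" if "s \<in> {0..1}" "x \<in> V" for s x using \<Gamma>W[OF that] by (auto simp: W_def)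
  have \<Gamma>k: "Ckp k {0..1} V \<Gamma>" for k
    unfolding \<Gamma>_def
    by (rule Ckp_compose_family[OF V open_ball Yk smooth_on_Ckp[OF V smooth_on_subset[OF sc U(1) V VU]] cV])
  have \<Gamma>eq: "\<Gamma> s x = c x + primitive (\<lambda>\<sigma>. \<tau> *\<^sub>R H (\<Gamma> \<sigma> x)) s" if "s \<in> {0..1}" "x \<in> V" for s x
    unfolding \<Gamma>_def using Yeq[OF that(1) cV[OF that(2)]] .
  have sH': "smooth_on W (\<lambda>z. \<tau> *\<^sub>R H z)" by (intro smooth_on_scaleR smooth_on_const W sH)
  have H\<Gamma>k: "Ckp k {0..1} V (\<lambda>s x. \<tau> *\<^sub>R H (\<Gamma> s x))" for k
    by (rule Ckp_compose[OF V W smooth_on_Ckp[OF W sH'] \<Gamma>k \<Gamma>W])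
  have cH\<Gamma>: "continuous_on {0..1} (\<lambda>s. \<tau> *\<^sub>R H (\<Gamma> s x))" if "x \<in> V" for x
    using Ckp_continuous_fiber[OF H\<Gamma>k that] .
  have c\<Gamma>: "continuous_on {0..1} (\<lambda>s. \<Gamma> s x)" if "x \<in> V" for x
    using Ckp_continuous_fiber[OF \<Gamma>k that] .
  have fst\<Gamma>: "fst (\<Gamma> s x) = t x" if "s \<in> {0..1}" "x \<in> V" for s x
  proof -
    have "fst (primitive (\<lambda>\<sigma>. \<tau> *\<^sub>R H (\<Gamma> \<sigma> x)) s) = primitive (\<lambda>\<sigma>. fst (\<tau> *\<^sub>R H (\<Gamma> \<sigma> x))) s"
      by (rule primitive_linear[OF bounded_linear_fst cH\<Gamma>[OF that(2)] that(1)])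
    also have "\<dots> = 0" by (simp add: H_def primitive_zero)
    finally show ?thesis using \<Gamma>eq[OF that] by (simp add: c_def)
  qed
  define D where "D s x v = frechet_derivative (\<Gamma> s) (at x) v" for s x v
  define dc where "dc x v = ((\<Sum>i<m. (frechet_derivative (Om i) (at x) v / \<tau>) *\<^sub>R e i), v)" for x v
  have dc: "(c has_derivative dc x) (at x)" if x: "x \<in> U" for x
    unfolding c_def t_def dc_def
  proof (intro has_derivative_Pair has_derivative_ident has_derivative_sum)
    fix i assume "i \<in> {..<m}"
    then have i: "i < m" by simp
    show "((\<lambda>x. ((Om i x - Om i x0) / \<tau>) *\<^sub>R e i) has_derivative (\<lambda>v. (frechet_derivative (Om i) (at x) v / \<tau>) *\<^sub>R e i)) (at x)"
      using dOm[OF i x] by (auto intro!: derivative_eq_intros simp: \<tau>[THEN less_imp_neq, symmetric])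
  qed
  have dH': "((\<lambda>z. \<tau> *\<^sub>R H z) has_derivative (\<lambda>h. \<tau> *\<^sub>R frechet_derivative H (at z) h)) (at z)" if "z \<in> W" for z
    using has_derivative_scaleR_right[OF smooth_on_has_derivative[OF sH that]] .
  have Deq: "D s x v = dc x v + primitive (\<lambda>\<sigma>. \<tau> *\<^sub>R frechet_derivative H (at (\<Gamma> \<sigma> x)) (D \<sigma> x v)) s"
    if s: "s \<in> {0..1}" and x: "x \<in> V" for s x v
  proof -
    have f: "frechet_derivative (\<lambda>x. \<tau> *\<^sub>R H (\<Gamma> \<sigma> x)) (at x) v = \<tau> *\<^sub>R frechet_derivative H (at (\<Gamma> \<sigma> x)) (D \<sigma> x v)" if "\<sigma> \<in> {0..1}" for \<sigma>
      using has_derivative_compose[OF Ckp_SucD(1)[OF \<Gamma>k that x] dH'[OF \<Gamma>W[OF that x]]]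
      by (simp add: frechet_derivative_eq D_def)
    have "((\<lambda>x. c x + primitive (\<lambda>\<sigma>. \<tau> *\<^sub>R H (\<Gamma> \<sigma> x)) s) has_derivative
        (\<lambda>v. dc x v + primitive (\<lambda>\<sigma>. frechet_derivative (\<lambda>x. \<tau> *\<^sub>R H (\<Gamma> \<sigma> x)) (at x) v) s)) (at x)"
      using x VU by (intro has_derivative_add dc primitive_has_derivative[OF V H\<Gamma>k s x]) auto
    then have "(\<Gamma> s has_derivative
        (\<lambda>v. dc x v + primitive (\<lambda>\<sigma>. frechet_derivative (\<lambda>x. \<tau> *\<^sub>R H (\<Gamma> \<sigma> x)) (at x) v) s)) (at x)"
      by (rule has_derivative_transform_within_open[OF _ V x]) (simp add: \<Gamma>eq[OF s])
    then have "D s x v = dc x v + primitive (\<lambda>\<sigma>. frechet_derivative (\<lambda>x. \<tau> *\<^sub>R H (\<Gamma> \<sigma> x)) (at x) v) s"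
      by (simp add: D_def frechet_derivative_eq)
    also have "primitive (\<lambda>\<sigma>. frechet_derivative (\<lambda>x. \<tau> *\<^sub>R H (\<Gamma> \<sigma> x)) (at x) v) s =
        primitive (\<lambda>\<sigma>. \<tau> *\<^sub>R frechet_derivative H (at (\<Gamma> \<sigma> x)) (D \<sigma> x v)) s"
      by (rule primitive_cong[OF f s])
    finally show ?thesis .
  qed
  \<comment> \<open>The variational equation has one solution for each initial value, so any closed
    form that satisfies it is the derivative of \<open>\<Gamma>\<close>. It is used with two such
    closed forms below.\<close>
  have Duniq: "D s x v = E s" if x: "x \<in> V" and s: "s \<in> {0..1}" and E0: "E 0 = dc x v"
    and E: "\<And>s. s \<in> {0..1} \<Longrightarrow> (E has_vector_derivative \<tau> *\<^sub>R frechet_derivative H (at (\<Gamma> s x)) (E s)) (at s within {0..1})"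
    for s x v E
  proof -
    have cE: "continuous_on {0..1} E" using continuous_on_vector_derivative[OF E] .
    have cD: "continuous_on {0..1} (\<lambda>s. D s x v)"
      unfolding D_def using Ckp_continuous_fiber[OF Ckp_SucD(2)[OF \<Gamma>k] x] .
    have cA: "continuous_on {0..1} (\<lambda>s. \<tau> *\<^sub>R frechet_derivative H (at (\<Gamma> s x)) (F s))" if cF: "continuous_on {0..1} F" for F :: "real \<Rightarrow> 'a \<times> 'a"
    proof -
      have "continuous_on {0..1} (\<lambda>s. \<Sum>b\<in>Basis. inner (F s) b *\<^sub>R frechet_derivative H (at (\<Gamma> s x)) b)"
        by (intro continuous_on_sum continuous_on_scaleR continuous_on_inner continuous_on_const cF
            Ckp_continuous_fiber[OF Ckp_compose[OF V W smooth_on_Ckp[OF W smooth_on_frechet[OF sH]] \<Gamma>k[of 0] \<Gamma>W] x])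
      then have "continuous_on {0..1} (\<lambda>s. frechet_derivative H (at (\<Gamma> s x)) (F s))"
        by (rule continuous_on_eq)
          (rule frechet_sum_Basis[symmetric], rule smooth_on_differentiable[OF sH \<Gamma>W[OF _ x]])
      then show ?thesis by (intro continuous_on_scaleR continuous_on_const)
    qed
    show ?thesis
    proof (rule volterra_unique[of "\<lambda>s. D s x v" E "\<lambda>s z. \<tau> *\<^sub>R frechet_derivative H (at (\<Gamma> s x)) z" "\<lambda>_. dc x v",
          OF cD cE cA[OF cD] cA[OF cE] _ Deq[OF _ x] _ s])
      fix s :: real assume s: "s \<in> {0..1}"
      show "E s = dc x v + primitive (\<lambda>\<sigma>. \<tau> *\<^sub>R frechet_derivative H (at (\<Gamma> \<sigma> x)) (E \<sigma>)) s"
        using primitive_fundamental[OF E cA[OF cE] s] E0 by simp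
      have "linear (frechet_derivative H (at (\<Gamma> s x)))"
        using has_derivative_linear[OF smooth_on_has_derivative[OF sH \<Gamma>W[OF s x]]] .
      then have "\<tau> *\<^sub>R frechet_derivative H (at (\<Gamma> s x)) (D s x v) - \<tau> *\<^sub>R frechet_derivative H (at (\<Gamma> s x)) (E s)
          = \<tau> *\<^sub>R frechet_derivative H (at (\<Gamma> s x)) (D s x v - E s)"
        by (simp add: linear_diff scaleR_diff_right)
      then show "norm (\<tau> *\<^sub>R frechet_derivative H (at (\<Gamma> s x)) (D s x v) - \<tau> *\<^sub>R frechet_derivative H (at (\<Gamma> s x)) (E s))
          \<le> norm (D s x v - E s) / 2"
        using Yh[OF s cV[OF x], of "D s x v - E s"] by (simp add: \<Gamma>_def)
    qed
  qed
  define lam where "lam x = snd (\<Gamma> 1 x)" for x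
  have slam: "smooth_on V lam"
    unfolding smooth_on_iff_Ckp[OF V] lam_def
  proof
    fix k
    have "Ckp k {0::real} V (\<lambda>_. \<Gamma> 1)"
      by (rule Ckp_reparam[OF \<Gamma>k, of "{0::real}" "\<lambda>_. 1"]) auto
    then show "Ckp k {0::real} V (\<lambda>_ x. snd (\<Gamma> 1 x))" by (rule Ckp_compose_linear[OF V bounded_linear_snd])
  qed
  have dlam: "frechet_derivative lam (at x) v = snd (D 1 x v)" if x: "x \<in> V" for x v
  proof -
    have "(lam has_derivative (\<lambda>v. snd (D 1 x v))) (at x)"
      unfolding lam_def D_def
      by (rule has_derivative_snd, rule Ckp_SucD(1)[OF \<Gamma>k _ x]) simp
    then show ?thesis by (simp add: frechet_derivative_eq)
  qed
  have "frechet_derivative lam (at x) (X j x) = 0" if x: "x \<in> V" and j: "j < m" for x j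
  proof -
    \<comment> \<open>By duality, moving along \<open>X j\<close> changes the flow time
      \<open>j\<close> at rate \<open>inverse \<tau>\<close> and no other. The second component
      vanishes at \<open>s = 1\<close>, which is the claim.\<close>
    define E where "E s = (inverse \<tau> *\<^sub>R e j, (1 - s) *\<^sub>R X j (snd (\<Gamma> s x)))" for s
    have xU: "x \<in> U" using x VU by blast
    have "D 1 x (X j x) = E 1"
    proof (rule Duniq[OF x])
      have "(\<Sum>i<m. (frechet_derivative (Om i) (at x) (X j x) / \<tau>) *\<^sub>R e i) = (\<Sum>i<m. if i = j then inverse \<tau> *\<^sub>R e i else 0)"
        using dual[OF _ j xU] by (intro sum.cong) (auto simp: divide_inverse)
      moreover have "\<Gamma> 0 x = c x" using \<Gamma>eq[OF _ x, of 0] by (simp add: primitive_at_0)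
      ultimately show "E 0 = dc x (X j x)" using j by (simp add: E_def dc_def c_def)
      fix s :: real assume s: "s \<in> {0..1}"
      define y where "y = snd (\<Gamma> s x)"
      have yU: "y \<in> U" using \<Gamma>U[OF s x] by (simp add: y_def)
      define G where "G = snd (\<tau> *\<^sub>R H (\<Gamma> s x))"
      have "((\<lambda>s. c x + primitive (\<lambda>\<sigma>. \<tau> *\<^sub>R H (\<Gamma> \<sigma> x)) s) has_vector_derivative \<tau> *\<^sub>R H (\<Gamma> s x)) (at s within {0..1})"
        using has_vector_derivative_add[OF has_vector_derivative_const primitive_has_vector_derivative[OF cH\<Gamma>[OF x] s]] by simp
      then have "((\<lambda>s. \<Gamma> s x) has_vector_derivative \<tau> *\<^sub>R H (\<Gamma> s x)) (at s within {0..1})"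
        by (rule has_vector_derivative_transform[OF s, rotated]) (simp add: \<Gamma>eq[OF _ x])
      then have "((\<lambda>s. snd (\<Gamma> s x)) has_vector_derivative G) (at s within {0..1})"
        unfolding G_def by (rule bounded_linear.has_vector_derivative[OF bounded_linear_snd])
      then have ds: "((\<lambda>s. snd (\<Gamma> s x)) has_derivative (\<lambda>h. h *\<^sub>R G)) (at s within {0..1})"
        by (simp add: has_vector_derivative_def)
      have dy: "(X j has_derivative frechet_derivative (X j) (at y)) (at (snd (\<Gamma> s x)))"
        using dX[OF j yU] by (simp add: y_def)
      have "((\<lambda>s. X j (snd (\<Gamma> s x))) has_derivative (\<lambda>h. frechet_derivative (X j) (at y) (h *\<^sub>R G))) (at s within {0..1})"
        by (rule has_derivative_compose[OF ds dy])
      then have "((\<lambda>s. X j (snd (\<Gamma> s x))) has_vector_derivative frechet_derivative (X j) (at y) G) (at s within {0..1})"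
        using has_derivative_linear[OF dX[OF j yU]] by (simp add: has_vector_derivative_def linear_scale)
      moreover have "((\<lambda>s. 1 - s) has_real_derivative -1) (at s within {0..1})"
        by (auto intro!: derivative_eq_intros)
      ultimately have "((\<lambda>s. (1 - s) *\<^sub>R X j (snd (\<Gamma> s x))) has_vector_derivative
          ((1 - s) *\<^sub>R frechet_derivative (X j) (at y) G + (-1) *\<^sub>R X j (snd (\<Gamma> s x)))) (at s within {0..1})"
        by (intro has_vector_derivative_scaleR)
      then
      have "((\<lambda>s. (1 - s) *\<^sub>R X j (snd (\<Gamma> s x))) has_vector_derivative
          ((1 - s) *\<^sub>R frechet_derivative (X j) (at y) G - X j y)) (at s within {0..1})"
        by (simp add: y_def)
      then have dE: "(E has_vector_derivative (0, (1 - s) *\<^sub>R frechet_derivative (X j) (at y) G - X j y)) (at s within {0..1})"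
        unfolding E_def by (intro has_vector_derivative_Pair has_vector_derivative_const)
      have Gs: "G = - (\<Sum>i<m. (Om i x - Om i x0) *\<^sub>R X i y)"
        using fst\<Gamma>[OF s x] te \<tau> by (simp add: G_def H_def y_def scaleR_sum_right)
      \<comment> \<open>Commutation exchanges the roles of \<open>X i\<close> and
        \<open>X j\<close>, so that this term matches the one in the derivative of
        \<open>H\<close>.\<close>
      have 1: "frechet_derivative (X j) (at y) G = - (\<Sum>i<m. (Om i x - Om i x0) *\<^sub>R frechet_derivative (X i) (at y) (X j y))"
        unfolding Gs using has_derivative_linear[OF dX[OF j yU]] comm[OF j _ yU]
        by (simp add: linear_neg linear_sum linear_scale)
      have 2: "(\<Sum>i<m. inner (inverse \<tau> *\<^sub>R e j) (e i) *\<^sub>R X i y) = inverse \<tau> *\<^sub>R X j y"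
      proof -
        have "(\<Sum>i<m. inner (inverse \<tau> *\<^sub>R e j) (e i) *\<^sub>R X i y) = (\<Sum>i<m. if i = j then inverse \<tau> *\<^sub>R X i y else 0)"
          by (intro sum.cong) (use ee[OF j] in auto)
        then show ?thesis using j by simp
      qed
      have 3: "(\<Sum>i<m. inner (t x) (e i) *\<^sub>R frechet_derivative (X i) (at y) ((1 - s) *\<^sub>R X j y)) =
          inverse \<tau> *\<^sub>R (1 - s) *\<^sub>R (\<Sum>i<m. (Om i x - Om i x0) *\<^sub>R frechet_derivative (X i) (at y) (X j y))"
        unfolding scaleR_sum_right
      proof (rule sum.cong[OF refl])
        fix i assume "i \<in> {..<m}"
        then show "inner (t x) (e i) *\<^sub>R frechet_derivative (X i) (at y) ((1 - s) *\<^sub>R X j y) =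
          inverse \<tau> *\<^sub>R (1 - s) *\<^sub>R (Om i x - Om i x0) *\<^sub>R frechet_derivative (X i) (at y) (X j y)"
          using has_derivative_linear[OF dX[OF _ yU]] te by (simp add: linear_scale divide_inverse mult_ac)
      qed
      have "\<tau> *\<^sub>R frechet_derivative H (at (\<Gamma> s x)) (E s) = (0, (1 - s) *\<^sub>R frechet_derivative (X j) (at y) G - X j y)"
        unfolding dH[OF \<Gamma>W[OF s x]] fst\<Gamma>[OF s x] y_def[symmetric] E_def fst_conv snd_conv sum.distrib 2 3 1
        using \<tau> by (simp add: scaleR_right_diff_distrib flip: mult.assoc)
      then show "(E has_vector_derivative \<tau> *\<^sub>R frechet_derivative H (at (\<Gamma> s x)) (E s)) (at s within {0..1})"
        using dE by simp
    qed simp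
    then show ?thesis using dlam[OF x] by (simp add: E_def)
  qed
  moreover have "frechet_derivative lam (at x0) v = v - (\<Sum>i<m. frechet_derivative (Om i) (at x0) v *\<^sub>R X i x0)" for v
  proof -
    have t0: "t x0 = 0" by (simp add: t_def)
    have \<Gamma>0: "\<Gamma> s x0 = (0, x0)" if s: "s \<in> {0..1}" for s
    proof -
      have "primitive (\<lambda>\<sigma>. \<tau> *\<^sub>R H (\<Gamma> \<sigma> x0)) s = primitive (\<lambda>_. 0) s"
        using fst\<Gamma>[OF _ x0V] by (intro primitive_cong s) (simp add: H_def t0 zero_prod_def)
      then show ?thesis using \<Gamma>eq[OF s x0V] by (simp add: primitive_zero c0)
    qed
    define S where "S = (\<Sum>i<m. frechet_derivative (Om i) (at x0) v *\<^sub>R X i x0)"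
    \<comment> \<open>At \<open>x0\<close> the flow times vanish and the trajectory is constant, so
      along \<open>E\<close> the variational equation has the constant right-hand side
      \<open>(0, - S)\<close>.\<close>
    define E where "E s = (fst (dc x0 v), v - s *\<^sub>R S)" for s :: real
    have de: "inner (fst (dc x0 v)) (e i) = frechet_derivative (Om i) (at x0) v / \<tau>" if i: "i < m" for i
    proof -
      have "inner (fst (dc x0 v)) (e i) = (\<Sum>j<m. frechet_derivative (Om j) (at x0) v / \<tau> * inner (e j) (e i))"
        by (simp add: dc_def inner_sum_left)
      also have "\<dots> = (\<Sum>j<m. if j = i then frechet_derivative (Om j) (at x0) v / \<tau> else 0)"
        by (rule sum.cong) (use ee i in auto)
      finally show ?thesis using i by simp
    qed
    have "D 1 x0 v = E 1"
    proof (rule Duniq[OF x0V])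
      show "E 0 = dc x0 v" by (simp add: E_def dc_def)
      fix s :: real assume s: "s \<in> {0..1}"
      have "\<tau> *\<^sub>R frechet_derivative H (at (\<Gamma> s x0)) (E s) = (0, - S)"
        unfolding dH[OF \<Gamma>W[OF s x0V]] unfolding \<Gamma>0[OF s]
        using de \<tau> by (simp add: E_def S_def scaleR_sum_right)
      moreover have "(E has_vector_derivative (0, - S)) (at s within {0..1})"
        unfolding E_def by (intro has_vector_derivative_Pair has_vector_derivative_const) (auto intro!: derivative_eq_intros)
      ultimately show "(E has_vector_derivative \<tau> *\<^sub>R frechet_derivative H (at (\<Gamma> s x0)) (E s)) (at s within {0..1})" by simp
    qed simp
    then show ?thesis using dlam[OF x0V] by (simp add: E_def S_def)
  qed
  ultimately show thesis by (rule that[OF V x0V VU slam])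
qed

section \<open>Involutive distributions transversal to a level set\<close>

text \<open>Differentiate \<open>F(y + s w) = F(y) + \<integral>\<^sub>0\<^sup>s dF(y + \<sigma> w) w d\<sigma>\<close> in \<open>y\<close>, then in \<open>s\<close> at 0.\<close>

lemma second_derivative_symmetric:
  fixes F :: "'a::euclidean_space \<Rightarrow> 'b::euclidean_space"
  assumes U: "open U" "x \<in> U" and F: "smooth_on U F"
  shows "frechet_derivative (\<lambda>y. frechet_derivative F (at y) w) (at x) v =
    frechet_derivative (\<lambda>y. frechet_derivative F (at y) v) (at x) w"
proof -
  define DF where "DF w y = frechet_derivative F (at y) w" for w y
  have sD: "smooth_on U (DF w)" for w unfolding DF_def by (rule smooth_on_frechet[OF F])
  have dF: "(F has_derivative (\<lambda>w. DF w y)) (at y)" if "y \<in> U" for y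
    using smooth_on_has_derivative[OF F that] by (simp add: DF_def)
  have dD: "(DF w has_derivative frechet_derivative (DF w) (at y)) (at y)" if "y \<in> U" for w y
    using smooth_on_has_derivative[OF sD that] .
  obtain r where r: "r > 0" "ball x r \<subseteq> U" using openE[OF U] .
  \<comment> \<open>\<open>w\<close> is shrunk to \<open>u\<close> so that segments in direction
    \<open>u\<close> starting in the half ball stay in \<open>U\<close>; the summand 1 admits
    \<open>w = 0\<close>. Linearity undoes the scaling at the end.\<close>
  define c where "c = norm w + 1"
  have c: "c > 0" "norm w \<le> c" using norm_ge_zero[of w] unfolding c_def by linarith+
  define \<epsilon> where "\<epsilon> = r / 2 / c"
  have \<epsilon>: "\<epsilon> > 0" using r(1) c(1) by (simp add: \<epsilon>_def)
  define u where "u = \<epsilon> *\<^sub>R w"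
  have nu: "norm u \<le> r / 2"
  proof -
    have "norm u = \<epsilon> * norm w" using \<epsilon> by (simp add: u_def)
    also have "\<dots> \<le> \<epsilon> * c" using \<epsilon> c(2) by simp
    also have "\<dots> = r / 2" using c(1) by (simp add: \<epsilon>_def)
    finally show ?thesis .
  qed
  let ?V = "ball x (r / 2)"
  have yU: "y + s *\<^sub>R u \<in> U" if "s \<in> {0..1}" "y \<in> ?V" for s y
  proof -
    have "norm (s *\<^sub>R u) \<le> norm u" using that(1) mult_right_mono[of "\<bar>s\<bar>" 1 "norm u"] by simp
    then have "dist x (y + s *\<^sub>R u) < r"
      using that(2) nu dist_triangle[of x "y + s *\<^sub>R u" y] by (simp add: dist_norm)
    then show ?thesis using r(2) by auto
  qed
  have sh: "Ckp k {0..1} ?V (\<lambda>s y. y + s *\<^sub>R u)" for k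
    by (intro Ckp_add Ckp_id Ckp_fun_param open_ball continuous_intros)
  have fk: "Ckp k {0..1} ?V (\<lambda>s y. DF w (y + s *\<^sub>R u))" for k w
    by (rule Ckp_compose[OF open_ball U(1) smooth_on_Ckp[OF U(1) sD] sh yU])
  have xV: "x \<in> ?V" using r(1) by simp
  have ds: "((\<lambda>s. G (y + s *\<^sub>R u)) has_vector_derivative G' u) (at s within {0..1})"
    if "(G has_derivative G') (at (y + s *\<^sub>R u))" for G :: "'a \<Rightarrow> 'b" and G' y s
  proof -
    have "((\<lambda>s. y + s *\<^sub>R u) has_derivative (\<lambda>h. h *\<^sub>R u)) (at s within {0..1})"
      by (auto intro!: derivative_eq_intros)
    from has_derivative_compose[OF this that] show ?thesis
      using has_derivative_linear[OF that] by (simp add: has_vector_derivative_def linear_scale)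
  qed
  have int: "F (y + s *\<^sub>R u) = F y + primitive (\<lambda>\<sigma>. DF u (y + \<sigma> *\<^sub>R u)) s" if s: "s \<in> {0..1}" and y: "y \<in> ?V" for s y
  proof -
    have "F (y + s *\<^sub>R u) = F (y + 0 *\<^sub>R u) + primitive (\<lambda>\<sigma>. DF u (y + \<sigma> *\<^sub>R u)) s"
    proof (rule primitive_fundamental[OF _ Ckp_continuous_fiber[OF fk y] s])
      show "((\<lambda>s. F (y + s *\<^sub>R u)) has_vector_derivative DF u (y + s *\<^sub>R u)) (at s within {0..1})" if "s \<in> {0..1}" for s
        using ds[OF dF[OF yU[OF that y]]] .
    qed
    then show ?thesis by simp
  qed
  have shift: "frechet_derivative (\<lambda>y. G (y + s *\<^sub>R u)) (at x) v = frechet_derivative G (at (x + s *\<^sub>R u)) v"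
    if "smooth_on U G" "s \<in> {0..1}" for G :: "'a \<Rightarrow> 'b" and s v
  proof -
    have "((\<lambda>y. y + s *\<^sub>R u) has_derivative (\<lambda>h. h)) (at x)" by (auto intro!: derivative_eq_intros)
    from has_derivative_compose[OF this smooth_on_has_derivative[OF that(1) yU[OF that(2) xV]]]
    show ?thesis by (simp add: frechet_derivative_eq)
  qed
  have eq: "DF v (x + s *\<^sub>R u) = DF v x + primitive (\<lambda>\<sigma>. frechet_derivative (DF u) (at (x + \<sigma> *\<^sub>R u)) v) s" if s: "s \<in> {0..1}" for s
  proof -
    have "((\<lambda>y. F y + primitive (\<lambda>\<sigma>. DF u (y + \<sigma> *\<^sub>R u)) s) has_derivative
       (\<lambda>v. DF v x + primitive (\<lambda>\<sigma>. frechet_derivative (\<lambda>y. DF u (y + \<sigma> *\<^sub>R u)) (at x) v) s)) (at x)"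
      by (intro has_derivative_add dF U primitive_has_derivative[OF open_ball fk s xV])
    then have "((\<lambda>y. F (y + s *\<^sub>R u)) has_derivative
       (\<lambda>v. DF v x + primitive (\<lambda>\<sigma>. frechet_derivative (\<lambda>y. DF u (y + \<sigma> *\<^sub>R u)) (at x) v) s)) (at x)"
      by (rule has_derivative_transform_within_open[OF _ open_ball xV]) (simp only: int[OF s])
    then have "frechet_derivative (\<lambda>y. F (y + s *\<^sub>R u)) (at x) v =
       DF v x + primitive (\<lambda>\<sigma>. frechet_derivative (\<lambda>y. DF u (y + \<sigma> *\<^sub>R u)) (at x) v) s"
      by (simp only: frechet_derivative_eq)
    also have "primitive (\<lambda>\<sigma>. frechet_derivative (\<lambda>y. DF u (y + \<sigma> *\<^sub>R u)) (at x) v) s =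
        primitive (\<lambda>\<sigma>. frechet_derivative (DF u) (at (x + \<sigma> *\<^sub>R u)) v) s"
      by (rule primitive_cong[OF shift[OF sD] s])
    finally show ?thesis using shift[OF F s] by (simp add: DF_def)
  qed
  have c: "continuous_on {0..1} (\<lambda>\<sigma>. frechet_derivative (DF u) (at (x + \<sigma> *\<^sub>R u)) v)"
    by (rule continuous_on_eq[OF Ckp_continuous_fiber[OF Ckp_SucD(2)[OF fk] xV]]) (rule shift[OF sD])
  have 0: "(0::real) \<in> {0..1}" by simp
  have "((\<lambda>s. DF v x + primitive (\<lambda>\<sigma>. frechet_derivative (DF u) (at (x + \<sigma> *\<^sub>R u)) v) s) has_vector_derivative
      frechet_derivative (DF u) (at (x + 0 *\<^sub>R u)) v) (at 0 within {0..1})"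
    using has_vector_derivative_add[OF has_vector_derivative_const primitive_has_vector_derivative[OF c 0]] by simp
  then have 1: "((\<lambda>s. DF v (x + s *\<^sub>R u)) has_vector_derivative
      frechet_derivative (DF u) (at (x + 0 *\<^sub>R u)) v) (at 0 within {0..1})"
    by (rule has_vector_derivative_transform[OF 0, rotated]) (rule eq)
  have 2: "((\<lambda>s. DF v (x + s *\<^sub>R u)) has_vector_derivative frechet_derivative (DF v) (at (x + 0 *\<^sub>R u)) u) (at 0 within {0..1})"
    by (rule ds) (rule dD[OF yU[OF 0 xV]])
  have "frechet_derivative (DF u) (at x) v = frechet_derivative (DF v) (at x) u"
    by (rule vector_derivative_unique_within_closed_interval[of "0::real" 1 0 "\<lambda>s. DF v (x + s *\<^sub>R u)"])
      (use 1 2 in simp_all)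
  moreover have "frechet_derivative (DF u) (at x) v = \<epsilon> *\<^sub>R frechet_derivative (DF w) (at x) v"
  proof -
    have "((\<lambda>y. \<epsilon> *\<^sub>R DF w y) has_derivative (\<lambda>h. \<epsilon> *\<^sub>R frechet_derivative (DF w) (at x) h)) (at x)"
      by (rule has_derivative_scaleR_right[OF dD[OF U(2)]])
    then have "(DF u has_derivative (\<lambda>h. \<epsilon> *\<^sub>R frechet_derivative (DF w) (at x) h)) (at x)"
    proof (rule has_derivative_transform_within_open[OF _ U])
      show "\<epsilon> *\<^sub>R DF w y = DF u y" if "y \<in> U" for y
        using linear_scale[OF has_derivative_linear[OF dF[OF that]], of \<epsilon> w] by (simp add: u_def)
    qed
    then show ?thesis by (simp add: frechet_derivative_eq)
  qed
  moreover have "frechet_derivative (DF v) (at x) u = \<epsilon> *\<^sub>R frechet_derivative (DF v) (at x) w"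
    using has_derivative_linear[OF dD[OF U(2)]] by (simp add: u_def linear_scale)
  ultimately show ?thesis using \<epsilon> by (simp add: DF_def[abs_def])
qed

text \<open>Product rule for a function paired with a moving direction. In the second summand the
  symmetry of second derivatives has moved \<open>v\<close> into the inner slot, so that the outer
  direction is \<open>X x\<close>.\<close>

lemma derivative_of_directional:
  fixes F :: "'a::euclidean_space \<Rightarrow> real"
  assumes U: "open U" "x \<in> U" and F: "smooth_on U F" and X: "smooth_on U X"
  shows "((\<lambda>y. frechet_derivative F (at y) (X y)) has_derivative
    (\<lambda>v. frechet_derivative F (at x) (frechet_derivative X (at x) v) +
         frechet_derivative (\<lambda>y. frechet_derivative F (at y) v) (at x) (X x))) (at x)"
proof -
  define Db where "Db b y = frechet_derivative F (at y) b" for b y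
  have sD: "smooth_on U (Db b)" for b unfolding Db_def by (rule smooth_on_frechet[OF F])
  have "((\<lambda>y. \<Sum>b\<in>Basis. inner (X y) b *\<^sub>R Db b y) has_derivative
     (\<lambda>v. \<Sum>b\<in>Basis. inner (X x) b *\<^sub>R frechet_derivative (Db b) (at x) v + inner (frechet_derivative X (at x) v) b *\<^sub>R Db b x)) (at x)"
    by (intro has_derivative_sum has_derivative_scaleR smooth_on_has_derivative[OF sD U(2)]
        has_derivative_inner_left smooth_on_has_derivative[OF X U(2)])
  then have "((\<lambda>y. frechet_derivative F (at y) (X y)) has_derivative
     (\<lambda>v. \<Sum>b\<in>Basis. inner (X x) b *\<^sub>R frechet_derivative (Db b) (at x) v + inner (frechet_derivative X (at x) v) b *\<^sub>R Db b x)) (at x)"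
  proof (rule has_derivative_transform_within_open[OF _ U])
    show "(\<Sum>b\<in>Basis. inner (X y) b *\<^sub>R Db b y) = frechet_derivative F (at y) (X y)" if "y \<in> U" for y
      unfolding Db_def by (rule frechet_sum_Basis[symmetric]) (rule smooth_on_differentiable[OF F that])
  qed
  moreover have "(\<Sum>b\<in>Basis. inner (X x) b *\<^sub>R frechet_derivative (Db b) (at x) v + inner (frechet_derivative X (at x) v) b *\<^sub>R Db b x) =
    frechet_derivative F (at x) (frechet_derivative X (at x) v) +
         frechet_derivative (\<lambda>y. frechet_derivative F (at y) v) (at x) (X x)" for v
  proof -
    have "frechet_derivative F (at x) (frechet_derivative X (at x) v) = (\<Sum>b\<in>Basis. inner (frechet_derivative X (at x) v) b *\<^sub>R Db b x)"
      unfolding Db_def by (rule frechet_sum_Basis) (rule smooth_on_differentiable[OF F U(2)])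
    moreover have "frechet_derivative (Db v) (at x) (X x) = (\<Sum>b\<in>Basis. inner (X x) b *\<^sub>R frechet_derivative (Db v) (at x) b)"
      by (rule frechet_sum_Basis) (rule smooth_on_differentiable[OF sD U(2)])
    moreover have "frechet_derivative (Db v) (at x) b = frechet_derivative (Db b) (at x) v" for b
      unfolding Db_def[abs_def] by (rule second_derivative_symmetric[OF U F])
    ultimately show ?thesis by (simp add: sum.distrib Db_def[abs_def])
  qed
  ultimately show ?thesis by simp
qed

text \<open>Differentiate the constant pairing with \<open>X\<close> along \<open>Y\<close>, and the
  one with \<open>Y\<close> along \<open>X\<close>. In the difference the second derivatives cancel
  by symmetry, and the differential of \<open>F\<close> on the bracket remains.\<close>

lemma dual_fields_commute:
  fixes X Y :: "'a::euclidean_space \<Rightarrow> 'a" and F :: "'a \<Rightarrow> real"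
  assumes U: "open U" "x \<in> U" and F: "smooth_on U F" and X: "smooth_on U X" and Y: "smooth_on U Y"
    and "\<And>y. y \<in> U \<Longrightarrow> frechet_derivative F (at y) (X y) = c" "\<And>y. y \<in> U \<Longrightarrow> frechet_derivative F (at y) (Y y) = d"
  shows "frechet_derivative F (at x) (lie_bracket X Y x) = 0"
proof -
  have *: "frechet_derivative F (at x) (frechet_derivative Z (at x) v) +
         frechet_derivative (\<lambda>y. frechet_derivative F (at y) v) (at x) (Z x) = 0"
    if "smooth_on U Z" "\<And>y. y \<in> U \<Longrightarrow> frechet_derivative F (at y) (Z y) = e" for Z e v
  proof -
    have "((\<lambda>y. e) has_derivative (\<lambda>v. frechet_derivative F (at x) (frechet_derivative Z (at x) v) +
         frechet_derivative (\<lambda>y. frechet_derivative F (at y) v) (at x) (Z x))) (at x)"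
      by (rule has_derivative_transform_within_open[OF derivative_of_directional[OF U F that(1)] U]) (rule that(2))
    from has_derivative_unique[OF this has_derivative_const] show ?thesis by (simp add: fun_eq_iff)
  qed
  have "linear (frechet_derivative F (at x))" using has_derivative_linear[OF smooth_on_has_derivative[OF F U(2)]] .
  then show ?thesis
    using *[OF X assms(6), of "Y x"] *[OF Y assms(7), of "X x"] second_derivative_symmetric[OF U F, of "X x" "Y x"]
    by (simp add: lie_bracket_def linear_diff)
qed

lemma mult_mat_index_sum:
  fixes A B :: "'a::semiring_0 mat"
  assumes "A \<in> carrier_mat n r" "B \<in> carrier_mat r c" "i < n" "j < c"
  shows "(A * B) $$ (i, j) = (\<Sum>l<r. A $$ (i, l) * B $$ (l, j))"
  using assms by (auto simp: scalar_prod_def atLeast0LessThan intro!: sum.cong)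

theorem involutive_first_integrals:
  fixes g :: "nat \<Rightarrow> 'a::euclidean_space \<Rightarrow> 'a" and Om :: "nat \<Rightarrow> 'a \<Rightarrow> real"
  assumes U: "open U" "x0 \<in> U" and m: "m \<le> DIM('a)"
    and g: "\<And>j. j < m \<Longrightarrow> smooth_on U (g j)" and Om: "\<And>i. i < m \<Longrightarrow> smooth_on U (Om i)"
    and nz: "\<And>x. x \<in> U \<Longrightarrow> det (mat m m (\<lambda>(i, j). frechet_derivative (Om i) (at x) (g j x))) \<noteq> 0"
    and inv: "involutive_on U (\<lambda>x. span {g j x | j. j < m})"
  obtains V lam where "open V" "x0 \<in> V" "V \<subseteq> U" "smooth_on V (lam :: 'a \<Rightarrow> 'a)"
    "\<And>x j. x \<in> V \<Longrightarrow> j < m \<Longrightarrow> frechet_derivative lam (at x) (g j x) = 0"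
    "\<And>w. frechet_derivative lam (at x0) w = 0 \<Longrightarrow> (\<And>i. i < m \<Longrightarrow> frechet_derivative (Om i) (at x0) w = 0) \<Longrightarrow> w = 0"
proof -
  define A where "A i j x = frechet_derivative (Om i) (at x) (g j x)" for i j x
  define M where "M x = mat m m (\<lambda>(i, j). A i j x)" for x
  have M: "M x \<in> carrier_mat m m" for x by (simp add: M_def)
  have MA: "M x $$ (i, j) = A i j x" if "i < m" "j < m" for i j x using that by (simp add: M_def)
  have nzM: "det (M x) \<noteq> 0" if "x \<in> U" for x using nz[OF that] by (simp add: M_def A_def)
  have sA: "smooth_on U (A i j)" if "i < m" "j < m" for i j
    unfolding A_def using smooth_on_frechet_apply[OF U(1) Om[OF that(1)] g[OF that(2)]] .
  \<comment> \<open>The inverse of \<open>M\<close>, written through the adjugate so that its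
    entries are visibly smooth.\<close>
  define N where "N j k x = inverse (det (M x)) * adj_mat (M x) $$ (j, k)" for j k x
  have sN: "smooth_on U (N j k)" if "j < m" "k < m" for j k
    unfolding smooth_on_iff_Ckp[OF U(1)] N_def M_def
  proof
    fix r
    show "Ckp r {0::real} U (\<lambda>_ x. inverse (det (mat m m (\<lambda>(i, j). A i j x))) * adj_mat (mat m m (\<lambda>(i, j). A i j x)) $$ (j, k))"
      by (intro Ckp_mult Ckp_inverse Ckp_det Ckp_adj_mat U(1) smooth_on_Ckp[OF U(1) sA] that nzM[unfolded M_def])
  qed
  have MN: "(\<Sum>l<m. A i l x * N l k x) = (if i = k then 1 else 0)" if "i < m" "k < m" "x \<in> U" for i k x
  proof -
    have "(M x * adj_mat (M x)) $$ (i, k) = (\<Sum>l<m. A i l x * adj_mat (M x) $$ (l, k))"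
      using mult_mat_index_sum[OF M adj_mat(1)[OF M] that(1,2)] MA[OF that(1)] by simp
    also have "(M x * adj_mat (M x)) $$ (i, k) = (if i = k then det (M x) else 0)"
      using adj_mat(2)[OF M] that by simp
    finally have eq: "(if i = k then det (M x) else 0) = (\<Sum>l<m. A i l x * adj_mat (M x) $$ (l, k))" .
    have "(\<Sum>l<m. A i l x * N l k x) = inverse (det (M x)) * (\<Sum>l<m. A i l x * adj_mat (M x) $$ (l, k))"
      by (simp add: N_def sum_distrib_left mult.left_commute)
    then show ?thesis using nzM[OF that(3)] by (simp flip: eq)
  qed
  have NM: "(\<Sum>k<m. N l k x * A k j x) = (if l = j then 1 else 0)" if "l < m" "j < m" "x \<in> U" for l j x
  proof -
    have "(adj_mat (M x) * M x) $$ (l, j) = (\<Sum>k<m. adj_mat (M x) $$ (l, k) * A k j x)"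
      using mult_mat_index_sum[OF adj_mat(1)[OF M] M that(1,2)] MA[OF _ that(2)] by simp
    also have "(adj_mat (M x) * M x) $$ (l, j) = (if l = j then det (M x) else 0)"
      using adj_mat(3)[OF M] that by simp
    finally have eq: "(if l = j then det (M x) else 0) = (\<Sum>k<m. adj_mat (M x) $$ (l, k) * A k j x)" .
    have "(\<Sum>k<m. N l k x * A k j x) = inverse (det (M x)) * (\<Sum>k<m. adj_mat (M x) $$ (l, k) * A k j x)"
      by (simp add: N_def sum_distrib_left mult.assoc)
    then show ?thesis using nzM[OF that(3)] by (simp flip: eq)
  qed
  define X where "X k x = (\<Sum>j<m. N j k x *\<^sub>R g j x)" for k x
  have sX: "smooth_on U (X k)" if "k < m" for k
    unfolding X_def by (intro smooth_on_sum smooth_on_scaleR U(1) sN g that) auto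
  have lOm: "linear (frechet_derivative (Om i) (at x))" if "i < m" "x \<in> U" for i x
    using has_derivative_linear[OF smooth_on_has_derivative[OF Om[OF that(1)] that(2)]] .
  have dual: "frechet_derivative (Om i) (at x) (X j x) = (if i = j then 1 else 0)" if "i < m" "j < m" "x \<in> U" for i j x
    using MN[OF that] lOm[OF that(1,3)] by (simp add: X_def linear_sum linear_scale A_def mult.commute)
  have gX: "g j x = (\<Sum>k<m. A k j x *\<^sub>R X k x)" if "j < m" "x \<in> U" for j x
  proof -
    have "(\<Sum>k<m. A k j x *\<^sub>R X k x) = (\<Sum>k<m. \<Sum>l<m. (N l k x * A k j x) *\<^sub>R g l x)"
      by (simp add: X_def scaleR_sum_right mult.commute)
    also have "\<dots> = (\<Sum>l<m. (\<Sum>k<m. N l k x * A k j x) *\<^sub>R g l x)"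
      by (subst sum.swap) (simp add: scaleR_sum_left)
    also have "\<dots> = (\<Sum>l<m. if l = j then g l x else 0)"
      using NM[OF _ that] by (intro sum.cong) auto
    finally show ?thesis using that by simp
  qed
  \<comment> \<open>On the span of the inputs a vector is recovered from its values under the
    differentials of \<open>Om\<close>. A bracket that lies in the span and is annihilated by all of
    them therefore vanishes.\<close>
  have span0: "z = 0" if z: "z \<in> span {g j x | j. j < m}" and x: "x \<in> U"
    and z0: "\<And>i. i < m \<Longrightarrow> frechet_derivative (Om i) (at x) z = 0" for z x
  proof -
    have "z = (\<Sum>k<m. frechet_derivative (Om k) (at x) z *\<^sub>R X k x)"
      using z
    proof (induction rule: span_induct_alt)
      case base
      show ?case using lOm[OF _ x] by (simp add: linear_0)
    next
      case (step c y z)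
      then obtain j where j: "j < m" "y = g j x" by blast
      have "(\<Sum>k<m. frechet_derivative (Om k) (at x) (c *\<^sub>R y + z) *\<^sub>R X k x) =
          (\<Sum>k<m. c *\<^sub>R (frechet_derivative (Om k) (at x) y *\<^sub>R X k x) + frechet_derivative (Om k) (at x) z *\<^sub>R X k x)"
        using lOm[OF _ x] by (intro sum.cong) (simp_all add: linear_add linear_scale scaleR_add_left)
      also have "\<dots> = c *\<^sub>R (\<Sum>k<m. frechet_derivative (Om k) (at x) y *\<^sub>R X k x) + z"
        by (simp only: sum.distrib scaleR_sum_right step(2)[symmetric])
      also have "(\<Sum>k<m. frechet_derivative (Om k) (at x) y *\<^sub>R X k x) = y"
        using gX[OF j(1) x] by (simp add: j(2) A_def)
      finally show ?case by simp
    qed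
    then show ?thesis using z0 by simp
  qed
  have Xspan: "X k x \<in> span {g j x | j. j < m}" for k x
    unfolding X_def by (intro span_sum span_scale span_base) auto
  have comm: "frechet_derivative (X i) (at x) (X j x) = frechet_derivative (X j) (at x) (X i x)"
    if "i < m" "j < m" "x \<in> U" for i j x
  proof -
    have "lie_bracket (X j) (X i) x \<in> span {g j x | j. j < m}"
      using inv sX that Xspan unfolding involutive_on_def by blast
    moreover have "frechet_derivative (Om k) (at x) (lie_bracket (X j) (X i) x) = 0" if k: "k < m" for k
      by (rule dual_fields_commute[OF U(1) \<open>x \<in> U\<close> Om[OF k] sX[OF \<open>j < m\<close>] sX[OF \<open>i < m\<close>] dual[OF k \<open>j < m\<close>] dual[OF k \<open>i < m\<close>]])
    ultimately have "lie_bracket (X j) (X i) x = 0" using span0 that(3) by blast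
    then show ?thesis by (simp add: lie_bracket_def)
  qed
  obtain V lam where V: "open V" "x0 \<in> V" "V \<subseteq> U" and lam: "smooth_on V (lam :: 'a \<Rightarrow> 'a)"
    "\<And>x j. x \<in> V \<Longrightarrow> j < m \<Longrightarrow> frechet_derivative lam (at x) (X j x) = 0"
    "\<And>w. frechet_derivative lam (at x0) w = w - (\<Sum>i<m. frechet_derivative (Om i) (at x0) w *\<^sub>R X i x0)"
    by (rule commuting_first_integrals[OF U m sX Om dual comm]) (assumption | (rule that; assumption))+
  show thesis
  proof (rule that[OF V lam(1)])
    fix x j assume x: "x \<in> V" and j: "j < m"
    have "linear (frechet_derivative lam (at x))"
      using has_derivative_linear[OF smooth_on_has_derivative[OF lam(1) x]] .
    then show "frechet_derivative lam (at x) (g j x) = 0"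
      using gX[OF j subsetD[OF V(3) x]] lam(2)[OF x] by (simp add: linear_sum linear_scale)
  next
    \<comment> \<open>When every differential of \<open>Om\<close> kills \<open>w\<close>, the
      formula for the derivative of \<open>lam\<close> at \<open>x0\<close> reduces to
      \<open>w\<close> itself.\<close>
    fix w assume "frechet_derivative lam (at x0) w = 0" "\<And>i. i < m \<Longrightarrow> frechet_derivative (Om i) (at x0) w = 0"
    then show "w = 0" using lam(3)[of w] by simp
  qed
qed

section \<open>Rank and rows\<close>

lemma append_rows_index:
  assumes "A \<in> carrier_mat n1 c" "B \<in> carrier_mat n2 c" "j < c"
  shows "i < n1 \<Longrightarrow> (A @\<^sub>r B) $$ (i, j) = A $$ (i, j)"
    and "i < n2 \<Longrightarrow> (A @\<^sub>r B) $$ (n1 + i, j) = B $$ (i, j)"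
  using assms by (auto simp: append_rows_def)

lemma mult_mat_vec_index_sum:
  fixes A :: "'a::semiring_0 mat"
  assumes "A \<in> carrier_mat n r" "v \<in> carrier_vec r" "i < n"
  shows "(A *\<^sub>v v) $ i = (\<Sum>l<r. A $$ (i, l) * v $ l)"
  using assms by (auto simp: scalar_prod_def atLeast0LessThan intro!: sum.cong)

text \<open>\<open>mat_rank\<close> counts independent columns, while the algorithm argues about
  rows. A maximal independent set of columns yields a rank factorisation that links the two.\<close>

lemma rank_column_basis:
  fixes M :: "real mat"
  assumes M: "M \<in> carrier_mat n c" and r: "mat_rank M = r"
  obtains B C where "B \<in> carrier_mat n r" "C \<in> carrier_mat r c" "M = B * C" "mat_rank B = r"
    "\<And>l. l < r \<Longrightarrow> \<exists>j<c. col B l = col M j"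
proof -
  interpret vec_space "TYPE(real)" n .
  have cM: "set (cols M) \<subseteq> carrier_vec n" using cols_dim M by blast
  obtain S where S: "maximal S (\<lambda>T. T \<subseteq> set (cols M) \<and> lin_indpt T)"
    using maximal_exists[of "\<lambda>T. T \<subseteq> set (cols M) \<and> lin_indpt T" "card (set (cols M))" "{}"]
    by (meson List.finite_set card_mono empty_iff empty_subsetI finite_lin_indpt2 rev_finite_subset)
  then have SM: "S \<subseteq> set (cols M)" "lin_indpt S" unfolding maximal_def by blast+
  then have Sc: "S \<subseteq> carrier_vec n" "finite S" using cM finite_subset by blast+
  have "card S = r" using rank_card_indpt[OF M S] r M by (simp add: mat_rank_def)
  obtain xs where xs: "set xs = S" "distinct xs" using finite_distinct_list[OF Sc(2)] by blast
  have lx: "length xs = r" using xs \<open>card S = r\<close> distinct_card by metis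
  define B where "B = mat_of_cols n xs"
  have B: "B \<in> carrier_mat n r" "cols B = xs" using lx xs Sc by (auto simp: B_def)
  have "\<exists>v\<in>carrier_vec r. w = B *\<^sub>v v" if w: "w \<in> set (cols M)" for w
  proof -
    have "w \<in> span S"
    proof (cases "w \<in> S")
      case True
      then show ?thesis using span_mem Sc(1) by auto
    next
      case False
      have "lin_dep (S \<union> {w})"
      proof (rule ccontr)
        assume "\<not> lin_dep (S \<union> {w})"
        then have "S \<union> {w} \<subseteq> set (cols M) \<and> lin_indpt (S \<union> {w})" using SM w by simp
        then have "S = S \<union> {w}" using S unfolding maximal_def by blast
        then show False using False by blast
      qed
      then show ?thesis using lin_dep_iff_in_span[of S w] Sc(1) SM(2) w cM False by auto
    qed
    then obtain a where "w = lincomb a S" using finite_span[of S] Sc by auto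
    then have "w = B *\<^sub>v vec r (\<lambda>i. a (col B i))" using mat_mult_eq_lincomb[OF B(1), of a] B(2) xs by simp
    then show ?thesis by auto
  qed
  then have "\<forall>j<c. \<exists>v\<in>carrier_vec r. col M j = B *\<^sub>v v"
    using M by (metis carrier_matD(2) cols_length cols_nth nth_mem)
  then obtain v where v: "\<And>j. j < c \<Longrightarrow> v j \<in> carrier_vec r \<and> col M j = B *\<^sub>v v j" by metis
  define C where "C = mat r c (\<lambda>(i, j). v j $ i)"
  have C: "C \<in> carrier_mat r c" by (simp add: C_def)
  have "M = B * C"
  proof (rule eq_matI)
    fix i j assume "i < dim_row (B * C)" "j < dim_col (B * C)"
    then have i: "i < n" and j: "j < c" using B C by auto
    have "M $$ (i, j) = col M j $ i" using M i j by auto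
    also have "\<dots> = (\<Sum>l<r. B $$ (i, l) * v j $ l)"
      using v[OF j] mult_mat_vec_index_sum[OF B(1) _ i] by auto
    also have "\<dots> = (B * C) $$ (i, j)"
      using mult_mat_index_sum[OF B(1) C i j] j by (simp add: C_def)
    finally show "M $$ (i, j) = (B * C) $$ (i, j)" .
  qed (use M B C in auto)
  moreover have "rank B = r"
    by (rule lin_indpt_full_rank[OF B(1)]) (use B xs SM in auto)
  then have "mat_rank B = r" using B by (simp add: mat_rank_def)
  moreover have "\<exists>j<c. col B l = col M j" if "l < r" for l
  proof -
    have "col B l \<in> set (cols M)" using B SM(1) xs(1) lx that by (metis carrier_matD(2) cols_nth nth_mem subsetD)
    then show ?thesis using M by (auto simp: cols_def)
  qed
  ultimately show ?thesis using that B(1) C by blast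
qed

text \<open>When the rank equals the number of rows, the factor \<open>B\<close> is square and
  invertible, and its columns are columns of \<open>N\<close>. A relation among the rows of
  \<open>N\<close> is thus one among the rows of \<open>B\<close>.\<close>

lemma full_row_rank_rows:
  fixes N :: "real mat"
  assumes N: "N \<in> carrier_mat r c" "full_row_rank N"
    and z: "\<And>j. j < c \<Longrightarrow> (\<Sum>i<r. t i * N $$ (i, j)) = 0" and "i < r"
  shows "t i = 0"
proof -
  interpret vec_space "TYPE(real)" r .
  obtain B C where BC: "B \<in> carrier_mat r r" "C \<in> carrier_mat r c" "N = B * C" "mat_rank B = r"
    and colB: "\<And>l. l < r \<Longrightarrow> \<exists>j<c. col B l = col N j"
    using rank_column_basis[OF N(1), of r] N by (metis full_row_rank_def carrier_matD(1))
  have "rank B = r" using BC by (simp add: mat_rank_def)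
  then have dB: "det B \<noteq> 0" using det_rank_iff[OF BC(1)] by simp
  define D where "D = transpose_mat B"
  have D: "D \<in> carrier_mat r r" "det D \<noteq> 0" using BC dB det_transpose[OF BC(1)] by (auto simp: D_def)
  have "D *\<^sub>v vec r t = 0\<^sub>v r"
  proof (rule eq_vecI)
    fix l assume "l < dim_vec (0\<^sub>v r :: real vec)"
    then have l: "l < r" by simp
    obtain j where j: "j < c" "col B l = col N j" using colB[OF l] by blast
    have BN: "B $$ (i, l) = N $$ (i, j)" if "i < r" for i
    proof -
      have "B $$ (i, l) = col B l $ i" using BC(1) l that by simp
      also have "\<dots> = N $$ (i, j)" using j N(1) that by simp
      finally show ?thesis .
    qed
    have "(D *\<^sub>v vec r t) $ l = (\<Sum>i<r. D $$ (l, i) * t i)"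
      using mult_mat_vec_index_sum[OF D(1) vec_carrier l] by simp
    also have "\<dots> = (\<Sum>i<r. t i * N $$ (i, j))"
      using BC(1) l BN by (intro sum.cong) (auto simp: D_def mult.commute)
    finally show "(D *\<^sub>v vec r t) $ l = 0\<^sub>v r $ l" using z[OF j(1)] l by simp
  qed (use D in simp)
  then have "vec r t = 0\<^sub>v r" using det_0_iff_vec_prod_zero_field[OF D(1)] D(2) vec_carrier by blast
  then show ?thesis using \<open>i < r\<close> by (metis index_vec index_zero_vec(1))
qed

lemma det_nonzero_inverse:
  fixes A :: "real mat"
  assumes "A \<in> carrier_mat n n" "det A \<noteq> 0"
  shows "\<exists>Z\<in>carrier_mat n n. Z * A = 1\<^sub>m n \<and> A * Z = 1\<^sub>m n"
  using det_non_zero_imp_unit[OF assms, of "()"] by (auto simp: Units_def ring_mat_def)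

text \<open>With \<open>M = B C\<close> of rank \<open>r\<close> and \<open>N = T M\<close> of full row rank \<open>r\<close>, the matrix \<open>T B\<close> is invertible, so \<open>M = B (T B)\<inverse> N\<close>.\<close>

lemma rows_combination:
  fixes M N :: "real mat"
  assumes M: "M \<in> carrier_mat n c" "mat_rank M = r" and N: "N \<in> carrier_mat r c" "full_row_rank N"
    and rows: "\<And>i. i < r \<Longrightarrow> \<exists>t. \<forall>j<c. N $$ (i, j) = (\<Sum>a<n. t a * M $$ (a, j))"
  obtains Q where "\<And>a j. a < n \<Longrightarrow> j < c \<Longrightarrow> M $$ (a, j) = (\<Sum>i<r. Q a i * N $$ (i, j))"
proof -
  obtain B C where BC: "B \<in> carrier_mat n r" "C \<in> carrier_mat r c" "M = B * C"
    using rank_column_basis[OF M] by metis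
  obtain t where t: "\<And>i j. i < r \<Longrightarrow> j < c \<Longrightarrow> N $$ (i, j) = (\<Sum>a<n. t i a * M $$ (a, j))"
    using rows by metis
  define T where "T = mat r n (\<lambda>(i, a). t i a)"
  have T: "T \<in> carrier_mat r n" by (simp add: T_def)
  define W where "W = T * B"
  have W: "W \<in> carrier_mat r r" using T BC by (simp add: W_def)
  have "N = T * M"
  proof (rule eq_matI)
    fix i j assume "i < dim_row (T * M)" "j < dim_col (T * M)"
    then have ij: "i < r" "j < c" using T M by auto
    show "N $$ (i, j) = (T * M) $$ (i, j)"
      using mult_mat_index_sum[OF T M(1) ij] t[OF ij] ij by (simp add: T_def)
  qed (use T M N in auto)
  then have NWC: "N = W * C" using BC T by (simp add: W_def assoc_mult_mat[of _ r n _ r _ c])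
  \<comment> \<open>A row vector that annihilates \<open>W\<close> also annihilates
    \<open>N = W * C\<close>, so full row rank makes it zero.\<close>
  have dW: "det W \<noteq> 0"
  proof
    assume "det W = 0"
    then have "det (transpose_mat W) = 0" using det_transpose[OF W] by simp
    then obtain v where v: "v \<in> carrier_vec r" "v \<noteq> 0\<^sub>v r" "transpose_mat W *\<^sub>v v = 0\<^sub>v r"
      using det_0_iff_vec_prod_zero_field[of "transpose_mat W" r] W by auto
    have vW: "(\<Sum>i<r. v $ i * W $$ (i, l)) = 0" if l: "l < r" for l
    proof -
      have "(transpose_mat W *\<^sub>v v) $ l = (\<Sum>i<r. transpose_mat W $$ (l, i) * v $ i)"
        by (rule mult_mat_vec_index_sum[OF _ v(1) l]) (use W in simp)
      also have "\<dots> = (\<Sum>i<r. v $ i * W $$ (i, l))"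
        using W l by (intro sum.cong) (auto simp: mult.commute)
      finally show ?thesis using v(3) l by simp
    qed
    have "v $ i = 0" if i: "i < r" for i
    proof (rule full_row_rank_rows[OF N _ i])
      fix j assume j: "j < c"
      have "(\<Sum>i<r. v $ i * N $$ (i, j)) = (\<Sum>i<r. \<Sum>l<r. v $ i * W $$ (i, l) * C $$ (l, j))"
        using mult_mat_index_sum[OF W BC(2) _ j] by (intro sum.cong) (auto simp: NWC sum_distrib_left mult.assoc)
      also have "\<dots> = (\<Sum>l<r. (\<Sum>i<r. v $ i * W $$ (i, l)) * C $$ (l, j))"
        by (subst sum.swap) (simp add: sum_distrib_right)
      finally show "(\<Sum>i<r. v $ i * N $$ (i, j)) = 0" using vW by simp
    qed
    then have "v = 0\<^sub>v r" using v(1) by (intro eq_vecI) auto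
    then show False using v(2) by simp
  qed
  obtain Z where Z: "Z \<in> carrier_mat r r" "Z * W = 1\<^sub>m r"
    using det_nonzero_inverse[OF W dW] by blast
  have "Z * N = C" using assoc_mult_mat[OF Z(1) W BC(2)] Z(2) BC(2) by (simp add: NWC)
  then have MBZ: "M = (B * Z) * N" using assoc_mult_mat[OF BC(1) Z(1) N(1)] BC(3) by simp
  show thesis
  proof (rule that[of "\<lambda>a i. (B * Z) $$ (a, i)"])
    fix a j assume "a < n" "j < c"
    have "B * Z \<in> carrier_mat n r" using BC Z by simp
    from mult_mat_index_sum[OF this N(1) \<open>a < n\<close> \<open>j < c\<close>]
    show "M $$ (a, j) = (\<Sum>i<r. (B * Z) $$ (a, i) * N $$ (i, j))"
      by (simp only: MBZ[symmetric])
  qed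
qed

text \<open>If \<open>v\<close> is in the kernel of the Gram matrix, the quadratic form at
  \<open>v\<close> is the sum of squares of \<open>w\<close>, so \<open>w\<close> vanishes and
  independence applies. The Gram matrix serves to replace a system with more equations than unknowns
  by a square one.\<close>

lemma gram_det:
  fixes L :: "nat \<Rightarrow> nat \<Rightarrow> real"
  assumes "\<And>t. (\<And>j. j < c \<Longrightarrow> (\<Sum>i<r. t i * L i j) = 0) \<Longrightarrow> \<forall>i<r. t i = 0"
  shows "det (mat r r (\<lambda>(i, l). \<Sum>j<c. L i j * L l j)) \<noteq> 0"
proof
  define G where "G = mat r r (\<lambda>(i, l). \<Sum>j<c. L i j * L l j)"
  have G: "G \<in> carrier_mat r r" by (simp add: G_def)
  assume "det (mat r r (\<lambda>(i, l). \<Sum>j<c. L i j * L l j)) = 0"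
  then obtain v where v: "v \<in> carrier_vec r" "v \<noteq> 0\<^sub>v r" "G *\<^sub>v v = 0\<^sub>v r"
    using det_0_iff_vec_prod_zero_field[OF G] by (auto simp: G_def)
  define w where "w j = (\<Sum>i<r. v $ i * L i j)" for j
  have Gv: "(\<Sum>j<c. L i j * w j) = 0" if i: "i < r" for i
  proof -
    have "(G *\<^sub>v v) $ i = (\<Sum>l<r. (\<Sum>j<c. L i j * L l j) * v $ l)"
      using mult_mat_vec_index_sum[OF G v(1) i] i by (simp add: G_def)
    also have "\<dots> = (\<Sum>j<c. \<Sum>l<r. L i j * L l j * v $ l)"
      by (simp add: sum_distrib_right) (rule sum.swap)
    also have "\<dots> = (\<Sum>j<c. L i j * w j)"
      by (simp add: w_def sum_distrib_left mult_ac)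
    finally show ?thesis using v(3) i by simp
  qed
  have "(\<Sum>j<c. w j * w j) = (\<Sum>j<c. \<Sum>i<r. v $ i * (L i j * w j))"
    by (intro sum.cong refl) (simp add: w_def sum_distrib_right mult.assoc)
  also have "\<dots> = (\<Sum>i<r. v $ i * (\<Sum>j<c. L i j * w j))"
    by (subst sum.swap) (simp add: sum_distrib_left)
  also have "\<dots> = 0" using Gv by simp
  finally have "(\<Sum>j<c. w j * w j) = 0" .
  then have "\<forall>j\<in>{..<c}. w j * w j = 0"
    by (subst (asm) sum_nonneg_eq_0_iff) auto
  then have w0: "w j = 0" if "j < c" for j using that by simp
  have "\<forall>i<r. v $ i = 0"
  proof (rule assms)
    show "(\<Sum>i<r. v $ i * L i j) = 0" if "j < c" for j using w0[OF that] by (simp add: w_def)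
  qed
  then have "v = 0\<^sub>v r" using v(1) by (intro eq_vecI) auto
  then show False using v(2) by simp
qed

lemma invertible_mat_det:
  fixes A :: "real mat"
  assumes "A \<in> carrier_mat n n"
  shows "invertible_mat A \<longleftrightarrow> det A \<noteq> 0"
proof
  assume "invertible_mat A"
  then obtain B where B: "A * B = 1\<^sub>m n" "B * A = 1\<^sub>m (dim_row B)"
    using assms by (auto simp: invertible_mat_def inverts_mat_def)
  have "dim_col B = n" using B(1) by (metis index_mult_mat(3) index_one_mat(3))
  moreover have "dim_row B = n" using B(2) assms by (metis carrier_matD(2) index_mult_mat(3) index_one_mat(3))
  ultimately have "B \<in> carrier_mat n n" by blast
  then have "det A * det B = 1" using B(1) det_mult[OF assms, of B] by simp
  then show "det A \<noteq> 0" by auto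
next
  assume "det A \<noteq> 0"
  then obtain B where "B \<in> carrier_mat n n" "B * A = 1\<^sub>m n" "A * B = 1\<^sub>m n"
    using det_nonzero_inverse[OF assms] by blast
  then show "invertible_mat A" using assms by (auto simp: invertible_mat_def inverts_mat_def square_mat.simps)
qed

section \<open>Regular runs of the structure algorithm\<close>

lemma sum_lessThan_add:
  fixes f :: "nat \<Rightarrow> 'a::comm_monoid_add"
  shows "(\<Sum>q<a + b. f q) = (\<Sum>q<a. f q) + (\<Sum>q<b. f (a + q))"
  by (induction b) (simp_all add: add.assoc)

section \<open>Componentwise rules for vector-valued functions and their derivatives along
  fields\<close>

lemma smooth_vec_onD:
  assumes "smooth_vec_on U r \<Theta>"
  shows "x \<in> U \<Longrightarrow> \<Theta> x \<in> carrier_vec r" "x \<in> U \<Longrightarrow> dim_vec (\<Theta> x) = r" "i < r \<Longrightarrow> smooth_on U (\<lambda>x. \<Theta> x $ i)"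
  using assms by (auto simp: smooth_vec_on_def)

lemma smooth_vec_onI:
  assumes "\<And>x. x \<in> U \<Longrightarrow> \<Theta> x \<in> carrier_vec r" "open U" "\<And>i x. i < r \<Longrightarrow> x \<in> U \<Longrightarrow> \<Theta> x $ i = G i x"
    "\<And>i. i < r \<Longrightarrow> smooth_on U (G i)"
  shows "smooth_vec_on U r \<Theta>"
  unfolding smooth_vec_on_def
proof (intro conjI allI impI ballI)
  fix i assume "i < r"
  then show "smooth_on U (\<lambda>x. \<Theta> x $ i)" using assms smooth_on_cong[of U "\<lambda>x. \<Theta> x $ i" "G i"] by simp
qed (rule assms(1))

lemma smooth_vec_on_mult:
  assumes "open U" "A \<in> carrier_mat a b" "smooth_vec_on U b \<Theta>"
  shows "smooth_vec_on U a (\<lambda>x. A *\<^sub>v \<Theta> x)"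
proof (rule smooth_vec_onI[where G="\<lambda>i x. \<Sum>l<b. A $$ (i, l) * \<Theta> x $ l"])
  show "A *\<^sub>v \<Theta> x \<in> carrier_vec a" if "x \<in> U" for x
    using mult_mat_vec_carrier[OF assms(2) smooth_vec_onD(1)[OF assms(3) that]] .
  show "(A *\<^sub>v \<Theta> x) $ i = (\<Sum>l<b. A $$ (i, l) * \<Theta> x $ l)" if "i < a" "x \<in> U" for i x
    using mult_mat_vec_index_sum[OF assms(2) smooth_vec_onD(1)[OF assms(3) that(2)] that(1)] .
  show "smooth_on U (\<lambda>x. \<Sum>l<b. A $$ (i, l) * \<Theta> x $ l)" for i
    by (intro smooth_on_sum smooth_on_mult smooth_on_const assms(1) smooth_vec_onD(3)[OF assms(3)]) auto
qed fact

lemma frechet_mult_mat_vec: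
  assumes "open U" "A \<in> carrier_mat a b" "smooth_vec_on U b \<Theta>" "x \<in> U" "i < a"
  shows "frechet_derivative (\<lambda>z. (A *\<^sub>v \<Theta> z) $ i) (at x) v = (\<Sum>l<b. A $$ (i, l) * frechet_derivative (\<lambda>z. \<Theta> z $ l) (at x) v)"
proof -
  have "((\<lambda>z. \<Sum>l<b. A $$ (i, l) * \<Theta> z $ l) has_derivative
      (\<lambda>v. \<Sum>l<b. A $$ (i, l) * frechet_derivative (\<lambda>z. \<Theta> z $ l) (at x) v)) (at x)"
    by (intro has_derivative_sum has_derivative_mult_right smooth_on_has_derivative[OF smooth_vec_onD(3)[OF assms(3)] assms(4)]) auto
  then have "((\<lambda>z. (A *\<^sub>v \<Theta> z) $ i) has_derivative
      (\<lambda>v. \<Sum>l<b. A $$ (i, l) * frechet_derivative (\<lambda>z. \<Theta> z $ l) (at x) v)) (at x)"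
    by (rule has_derivative_transform_within_open[OF _ assms(1,4)])
      (rule mult_mat_vec_index_sum[symmetric, OF assms(2) smooth_vec_onD(1)[OF assms(3)] assms(5)])
  then show ?thesis by (simp add: frechet_derivative_eq)
qed

lemma smooth_vec_on_append:
  assumes "open U" "smooth_vec_on U a \<Theta>" "smooth_vec_on U b \<Psi>"
  shows "smooth_vec_on U (a + b) (\<lambda>x. \<Theta> x @\<^sub>v \<Psi> x)"
proof (rule smooth_vec_onI[where G="\<lambda>i x. if i < a then \<Theta> x $ i else \<Psi> x $ (i - a)"])
  show "\<Theta> x @\<^sub>v \<Psi> x \<in> carrier_vec (a + b)" if "x \<in> U" for x
    using smooth_vec_onD(1)[OF assms(2) that] smooth_vec_onD(1)[OF assms(3) that] by simp
  show "(\<Theta> x @\<^sub>v \<Psi> x) $ i = (if i < a then \<Theta> x $ i else \<Psi> x $ (i - a))" if "i < a + b" "x \<in> U" for i x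
    using smooth_vec_onD(2)[OF assms(2) that(2)] smooth_vec_onD(2)[OF assms(3) that(2)] that by simp
  show "smooth_on U (\<lambda>x. if i < a then \<Theta> x $ i else \<Psi> x $ (i - a))" if "i < a + b" for i
    using that smooth_vec_onD(3)[OF assms(2), of i] smooth_vec_onD(3)[OF assms(3), of "i - a"] by (cases "i < a") auto
qed fact

lemma smooth_vec_on_Lf:
  assumes "open U" "smooth_vec_on U r \<Theta>" "smooth_on U f"
  shows "smooth_vec_on U r (Lf f (\<Theta> :: 'a::euclidean_space \<Rightarrow> real vec))"
proof (rule smooth_vec_onI[where G="\<lambda>i x. frechet_derivative (\<lambda>z. \<Theta> z $ i) (at x) (f x)"])
  show "Lf f \<Theta> x \<in> carrier_vec r" if "x \<in> U" for x
    using smooth_vec_onD(2)[OF assms(2) that] by (simp add: Lf_def)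
  show "Lf f \<Theta> x $ i = frechet_derivative (\<lambda>z. \<Theta> z $ i) (at x) (f x)" if "i < r" "x \<in> U" for i x
    using smooth_vec_onD(2)[OF assms(2) that(2)] that by (simp add: Lf_def)
  show "smooth_on U (\<lambda>x. frechet_derivative (\<lambda>z. \<Theta> z $ i) (at x) (f x))" if "i < r" for i
    using smooth_on_frechet_apply[OF assms(1) smooth_vec_onD(3)[OF assms(2) that] assms(3)] .
qed fact

lemma Lg_carrier: "smooth_vec_on U r \<Theta> \<Longrightarrow> x \<in> U \<Longrightarrow> Lg g m \<Theta> x \<in> carrier_mat r m"
  by (simp add: Lg_def smooth_vec_onD(2))

lemma Lg_index:
  assumes "smooth_vec_on U r \<Theta>" "x \<in> U" "i < r" "j < m"
  shows "Lg g m \<Theta> x $$ (i, j) = frechet_derivative (\<lambda>z. \<Theta> z $ i) (at x) (g j x)"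
  using assms smooth_vec_onD(2)[OF assms(1,2)] by (simp add: Lg_def)

lemma Lf_index:
  assumes "smooth_vec_on U r \<Theta>" "x \<in> U" "i < r"
  shows "Lf f \<Theta> x $ i = frechet_derivative (\<lambda>z. \<Theta> z $ i) (at x) (f x)"
  using assms smooth_vec_onD(2)[OF assms(1,2)] by (simp add: Lf_def)

lemma frechet_append:
  assumes "open U" "smooth_vec_on U a \<Theta>" "smooth_vec_on U b \<Psi>" "x \<in> U"
  shows "i < a \<Longrightarrow> frechet_derivative (\<lambda>z. (\<Theta> z @\<^sub>v \<Psi> z) $ i) (at x) = frechet_derivative (\<lambda>z. \<Theta> z $ i) (at x)"
    and "i < b \<Longrightarrow> frechet_derivative (\<lambda>z. (\<Theta> z @\<^sub>v \<Psi> z) $ (a + i)) (at x) = frechet_derivative (\<lambda>z. \<Psi> z $ i) (at x)"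
proof -
  have d: "dim_vec (\<Theta> z) = a" "dim_vec (\<Psi> z) = b" if "z \<in> U" for z
    using smooth_vec_onD(2)[OF assms(2) that] smooth_vec_onD(2)[OF assms(3) that] by auto
  show "frechet_derivative (\<lambda>z. (\<Theta> z @\<^sub>v \<Psi> z) $ i) (at x) = frechet_derivative (\<lambda>z. \<Theta> z $ i) (at x)" if "i < a"
    by (rule frechet_derivative_cong_open[OF assms(1,4)]) (use d that in simp)
  show "frechet_derivative (\<lambda>z. (\<Theta> z @\<^sub>v \<Psi> z) $ (a + i)) (at x) = frechet_derivative (\<lambda>z. \<Psi> z $ i) (at x)" if "i < b"
    by (rule frechet_derivative_cong_open[OF assms(1,4)]) (use d that in simp)
qed

lemma Lg_append:
  assumes "open U" "smooth_vec_on U a \<Theta>" "smooth_vec_on U b \<Psi>" "x \<in> U"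
  shows "Lg g m (\<lambda>z. \<Theta> z @\<^sub>v \<Psi> z) x = Lg g m \<Theta> x @\<^sub>r Lg g m \<Psi> x" (is "?L = ?R")
proof (rule eq_matI)
  note sa = smooth_vec_on_append[OF assms(1-3)]
  have L: "?L \<in> carrier_mat (a + b) m" using Lg_carrier[OF sa assms(4)] .
  have C: "Lg g m \<Theta> x \<in> carrier_mat a m" "Lg g m \<Psi> x \<in> carrier_mat b m"
    using Lg_carrier[OF assms(2,4)] Lg_carrier[OF assms(3,4)] by auto
  then have R: "?R \<in> carrier_mat (a + b) m" by simp
  show "dim_row ?L = dim_row ?R" "dim_col ?L = dim_col ?R" using L R by auto
  fix i j assume "i < dim_row ?R" "j < dim_col ?R"
  then have i: "i < a + b" and j: "j < m" using R by auto
  show "?L $$ (i, j) = ?R $$ (i, j)"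
  proof (cases "i < a")
    case True
    then show ?thesis using append_rows_index(1)[OF C j, of i] Lg_index[OF sa assms(4) i j] Lg_index[OF assms(2,4) _ j]
        frechet_append(1)[OF assms] by simp
  next
    case False
    then obtain k where k: "i = a + k" "k < b" using i by (metis add_diff_inverse_nat nat_add_left_cancel_less)
    then show ?thesis using append_rows_index(2)[OF C j, of k] Lg_index[OF sa assms(4) i j] Lg_index[OF assms(3,4) _ j]
        frechet_append(2)[OF assms] by simp
  qed
qed

text \<open>Full row rank in terms of coefficients. It holds trivially for \<open>r = 0\<close>,
  where the algorithm starts.\<close>

definition independent_rows :: "real mat \<Rightarrow> nat \<Rightarrow> nat \<Rightarrow> bool" where
  "independent_rows L r c \<longleftrightarrow> (\<forall>t. (\<forall>j<c. (\<Sum>i<r. t i * L $$ (i, j)) = 0) \<longrightarrow> (\<forall>i<r. t i = 0))"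

section \<open>Well-posedness of the algorithm along a regular run\<close>

locale regular_system =
  fixes U :: "(real ^ 'n::finite) set"
    and f :: "real ^ 'n \<Rightarrow> real ^ 'n"
    and g :: "nat \<Rightarrow> real ^ 'n \<Rightarrow> real ^ 'n"
    and h :: "real ^ 'n \<Rightarrow> real vec"
    and m p :: nat and \<rho> :: "nat \<Rightarrow> nat" and R S :: "nat \<Rightarrow> real mat" and kstar :: nat
  assumes sys: "affine_system U f g h m p"
    and run: "regular_run U f g h m p \<rho> R S kstar"
begin

abbreviation Th where "Th k \<equiv> Theta f g h m R S k"
abbreviation Om where "Om k \<equiv> Omega f g h m R S k"
definition Psi where "Psi k = (\<lambda>x. S k *\<^sub>v Th (k - 1) x)"
definition P where "P k x = Pcoeff g m (Om k) (Psi k) x"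

lemma U: "open U" "0 \<in> U" and f: "smooth_on U f" and g: "j < m \<Longrightarrow> smooth_on U (g j)"
  and h: "smooth_vec_on U p h"
  using sys by (auto simp: affine_system_def)

lemma rho_0: "\<rho> 0 = 0"
  using run by (simp add: regular_run_def)

lemma step:
  assumes "k < kstar"
  shows "\<And>x. x \<in> U \<Longrightarrow> mat_rank (Lg g m (Om k) x @\<^sub>r Lg g m (Th k) x) = \<rho> (Suc k)"
    and "R (Suc k) \<in> carrier_mat (\<rho> (Suc k) - \<rho> k) (p - \<rho> k)"
    and "\<And>x. x \<in> U \<Longrightarrow> full_row_rank (Lg g m (Om k) x @\<^sub>r Lg g m (\<lambda>z. R (Suc k) *\<^sub>v Th k z) x)"
    and "S (Suc k) \<in> carrier_mat (p - \<rho> (Suc k)) (p - \<rho> k)"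
    and "invertible_mat (R (Suc k) @\<^sub>r S (Suc k))"
proof -
  have k: "Suc k \<in> {1..kstar}" using assms by auto
  then have 1: "step_assumption U f g h m p \<rho> R S (Suc k)" "S (Suc k) \<in> carrier_mat (p - \<rho> (Suc k)) (p - \<rho> (Suc k - 1))"
    "invertible_mat (R (Suc k) @\<^sub>r S (Suc k))"
    using run unfolding regular_run_def by blast+
  then show "\<And>x. x \<in> U \<Longrightarrow> mat_rank (Lg g m (Om k) x @\<^sub>r Lg g m (Th k) x) = \<rho> (Suc k)"
    and "R (Suc k) \<in> carrier_mat (\<rho> (Suc k) - \<rho> k) (p - \<rho> k)"
    and "\<And>x. x \<in> U \<Longrightarrow> full_row_rank (Lg g m (Om k) x @\<^sub>r Lg g m (\<lambda>z. R (Suc k) *\<^sub>v Th k z) x)"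
    and "S (Suc k) \<in> carrier_mat (p - \<rho> (Suc k)) (p - \<rho> k)"
    and "invertible_mat (R (Suc k) @\<^sub>r S (Suc k))"
    by (simp_all add: step_assumption_def Let_def)
qed

text \<open>Both inequalities come from the squareness of \<open>R\<close> stacked on
  \<open>S\<close>. As subtraction of naturals is truncated, the equation between the dimensions
  yields them in combination with \<open>\<rho> k \<le> p\<close>, which the previous step
  provides.\<close>

lemma rho_step: "k < kstar \<Longrightarrow> \<rho> k \<le> \<rho> (Suc k) \<and> \<rho> (Suc k) \<le> p"
proof (induction k)
  have sq: "\<rho> (Suc k) - \<rho> k + (p - \<rho> (Suc k)) = p - \<rho> k" if k: "k < kstar" for k
  proof -
    have "R (Suc k) @\<^sub>r S (Suc k) \<in> carrier_mat (\<rho> (Suc k) - \<rho> k + (p - \<rho> (Suc k))) (p - \<rho> k)"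
      using step[OF k] by simp
    moreover have "square_mat (R (Suc k) @\<^sub>r S (Suc k))" using step(5)[OF k] by (simp add: invertible_mat_def)
    ultimately show ?thesis unfolding square_mat.simps by (metis carrier_matD)
  qed
  {
    case 0
    then show ?case using sq[OF 0] rho_0 by linarith
  next
    case (Suc k)
    then show ?case using sq[OF Suc.prems] by linarith
  }
qed

lemma rho_mono: "j \<le> k \<Longrightarrow> k \<le> kstar \<Longrightarrow> \<rho> j \<le> \<rho> k"
proof (induction k rule: dec_induct)
  case (step k)
  then show ?case using rho_step[of k] by linarith
qed simp

lemma rho_le: "k \<le> kstar \<Longrightarrow> \<rho> k \<le> p"
  using rho_step rho_0 by (cases k) auto

lemma Th_0: "Th 0 = h" and Om_0: "Om 0 = (\<lambda>x. 0\<^sub>v 0)"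
  by (simp_all add: Theta_def Omega_def)

lemma Om_Suc: "Om (Suc k) = (\<lambda>x. Om k x @\<^sub>v (R (Suc k) *\<^sub>v Th k x))"
  by (simp add: Theta_def Omega_def Let_def)

lemma Th_Suc: "Th (Suc k) = (\<lambda>x. Lf f (Psi (Suc k)) x - P (Suc k) x *\<^sub>v Lf f (Om (Suc k)) x)"
  by (simp add: Theta_def Omega_def Let_def P_def Psi_def)

text \<open>The invariant carried through the induction over the steps.\<close>

definition regular_at where
  "regular_at k \<longleftrightarrow> smooth_vec_on U (p - \<rho> k) (Th k) \<and> smooth_vec_on U (\<rho> k) (Om k) \<and>
     (\<forall>x\<in>U. independent_rows (Lg g m (Om k) x) (\<rho> k) m)"

text \<open>\<open>Pcoeff\<close> is a definite description, so existence and uniqueness are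
  established at each state. Existence: the stacked matrix \<open>A\<close> and the matrix
  \<open>L\<close> have the same rank, and the rows of \<open>L\<close> are combinations of those of
  \<open>A\<close>, so \<open>rows_combination\<close> expresses the rows of \<open>A\<close> by
  those of \<open>L\<close>. Uniqueness: the rows of \<open>L\<close> are independent. Smoothness of
  \<open>P\<close> then passes to the next \<open>Th\<close>.\<close>

lemma
  assumes k: "k < kstar" and reg: "regular_at k"
  shows P_carrier: "\<And>x. x \<in> U \<Longrightarrow> P (Suc k) x \<in> carrier_mat (p - \<rho> (Suc k)) (\<rho> (Suc k))"
    and Lg_Psi: "\<And>x. x \<in> U \<Longrightarrow> Lg g m (Psi (Suc k)) x = P (Suc k) x * Lg g m (Om (Suc k)) x"
    and P_smooth: "\<And>i l. i < p - \<rho> (Suc k) \<Longrightarrow> l < \<rho> (Suc k) \<Longrightarrow> smooth_on U (\<lambda>x. P (Suc k) x $$ (i, l))"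
    and regular_at_Suc: "regular_at (Suc k)"
proof -
  define r where "r = \<rho> (Suc k)"
  define s where "s = p - \<rho> k"
  define L where "L x = Lg g m (Om (Suc k)) x" for x
  have rk: "\<rho> k + (r - \<rho> k) = r" using rho_step[OF k] by (simp add: r_def)
  have sTh: "smooth_vec_on U s (Th k)" and sOm: "smooth_vec_on U (\<rho> k) (Om k)"
    using reg by (auto simp: regular_at_def s_def)
  have Rc: "R (Suc k) \<in> carrier_mat (r - \<rho> k) s" using step(2)[OF k] by (simp add: r_def s_def)
  have Sc: "S (Suc k) \<in> carrier_mat (p - r) s" using step(4)[OF k] by (simp add: r_def s_def)
  have sR: "smooth_vec_on U (r - \<rho> k) (\<lambda>x. R (Suc k) *\<^sub>v Th k x)" using smooth_vec_on_mult[OF U(1) Rc sTh] .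
  have sPsi: "smooth_vec_on U (p - r) (Psi (Suc k))" using smooth_vec_on_mult[OF U(1) Sc sTh] by (simp add: Psi_def)
  have sOm': "smooth_vec_on U r (Om (Suc k))" using smooth_vec_on_append[OF U(1) sOm sR] rk by (simp add: Om_Suc)
  have LN: "L x = Lg g m (Om k) x @\<^sub>r Lg g m (\<lambda>x. R (Suc k) *\<^sub>v Th k x) x" if "x \<in> U" for x
    unfolding L_def Om_Suc using Lg_append[OF U(1) sOm sR that] .
  have Lc: "L x \<in> carrier_mat r m" if "x \<in> U" for x unfolding L_def using Lg_carrier[OF sOm' that] .
  have Lfull: "full_row_rank (L x)" if "x \<in> U" for x using LN[OF that] step(3)[OF k that] by simp
  have indep: "independent_rows (L x) r m" if "x \<in> U" for x
    unfolding independent_rows_def using full_row_rank_rows[OF Lc[OF that] Lfull[OF that]] by blast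
  have LgPsi: "Lg g m (Psi (Suc k)) x $$ (i, j) = (\<Sum>b<s. S (Suc k) $$ (i, b) * Lg g m (Th k) x $$ (b, j))"
    if "x \<in> U" "i < p - r" "j < m" for x i j
    using frechet_mult_mat_vec[OF U(1) Sc sTh that(1,2), of "g j x"] Lg_index[OF sPsi that, of g] Lg_index[OF sTh that(1) _ that(3), of _ g]
    by (simp add: Psi_def)
  have LgPsic: "Lg g m (Psi (Suc k)) x \<in> carrier_mat (p - r) m" if "x \<in> U" for x using Lg_carrier[OF sPsi that] .
  have ex: "\<exists>M. M \<in> carrier_mat (p - r) r \<and> Lg g m (Psi (Suc k)) x = M * L x" if x: "x \<in> U" for x
  proof -
    define A where "A = Lg g m (Om k) x @\<^sub>r Lg g m (Th k) x"
    have c1: "Lg g m (Om k) x \<in> carrier_mat (\<rho> k) m" and c2: "Lg g m (Th k) x \<in> carrier_mat s m"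
      and c3: "Lg g m (\<lambda>x. R (Suc k) *\<^sub>v Th k x) x \<in> carrier_mat (r - \<rho> k) m"
      using Lg_carrier[OF sOm x] Lg_carrier[OF sTh x] Lg_carrier[OF sR x] by auto
    have Ac: "A \<in> carrier_mat (\<rho> k + s) m" using c1 c2 by (simp add: A_def)
    have Ar: "mat_rank A = r" using step(1)[OF k x] by (simp add: A_def r_def)
    \<comment> \<open>The first \<open>\<rho> k\<close> rows of \<open>L\<close> are rows of
      \<open>A\<close>; the others combine the lower block of \<open>A\<close> with the entries of
      \<open>R (Suc k)\<close> as coefficients.\<close>
    have rows: "\<exists>t. \<forall>j<m. L x $$ (i, j) = (\<Sum>a<\<rho> k + s. t a * A $$ (a, j))" if i: "i < r" for i
    proof (cases "i < \<rho> k")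
      case True
      have "L x $$ (i, j) = (\<Sum>a<\<rho> k + s. (if a = i then 1 else 0) * A $$ (a, j))" if "j < m" for j
      proof -
        have "(\<Sum>a<\<rho> k + s. (if a = i then 1 else 0) * A $$ (a, j)) = (\<Sum>a<\<rho> k + s. if a = i then A $$ (a, j) else 0)"
          by (intro sum.cong) auto
        also have "\<dots> = A $$ (i, j)" using True by simp
        also have "\<dots> = Lg g m (Om k) x $$ (i, j)" unfolding A_def by (rule append_rows_index(1)[OF c1 c2 that True])
        also have "\<dots> = L x $$ (i, j)" unfolding LN[OF x] by (rule append_rows_index(1)[OF c1 c3 that True, symmetric])
        finally show ?thesis by (rule sym)
      qed
      then show ?thesis by (intro exI[of _ "\<lambda>a. if a = i then 1 else 0"] allI impI)
    next
      case False
      then have "\<rho> k \<le> i" by simp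
      then obtain c where c: "i = \<rho> k + c" using le_Suc_ex by blast
      have c': "c < r - \<rho> k" using i c by simp
      define t where "t a = (if a < \<rho> k then 0 else R (Suc k) $$ (c, a - \<rho> k))" for a
      have "L x $$ (i, j) = (\<Sum>a<\<rho> k + s. t a * A $$ (a, j))" if j: "j < m" for j
      proof -
        have "L x $$ (i, j) = Lg g m (\<lambda>x. R (Suc k) *\<^sub>v Th k x) x $$ (c, j)"
          using append_rows_index(2)[OF c1 c3 j c'] LN[OF x] c by simp
        also have "\<dots> = (\<Sum>b<s. R (Suc k) $$ (c, b) * Lg g m (Th k) x $$ (b, j))"
          using frechet_mult_mat_vec[OF U(1) Rc sTh x c', of "g j x"] Lg_index[OF sR x c' j, of g] Lg_index[OF sTh x _ j, of _ g]
          by simp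
        also have "\<dots> = (\<Sum>b<s. t (\<rho> k + b) * A $$ (\<rho> k + b, j))"
          using append_rows_index(2)[OF c1 c2 j] by (intro sum.cong) (auto simp: t_def A_def)
        also have "\<dots> = (\<Sum>a<\<rho> k + s. t a * A $$ (a, j))"
          by (simp add: sum_lessThan_add t_def)
        finally show ?thesis .
      qed
      then show ?thesis by (intro exI[of _ t] allI impI)
    qed
    obtain Q where Q: "\<And>a j. a < \<rho> k + s \<Longrightarrow> j < m \<Longrightarrow> A $$ (a, j) = (\<Sum>i<r. Q a i * L x $$ (i, j))"
      by (rule rows_combination[OF Ac Ar Lc[OF x] Lfull[OF x] rows]) (assumption | (rule that; assumption))+
    define M where "M = mat (p - r) r (\<lambda>(i, l). \<Sum>b<s. S (Suc k) $$ (i, b) * Q (\<rho> k + b) l)"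
    have Mc: "M \<in> carrier_mat (p - r) r" by (simp add: M_def)
    have "Lg g m (Psi (Suc k)) x = M * L x"
    proof (rule eq_matI)
      fix i j assume "i < dim_row (M * L x)" "j < dim_col (M * L x)"
      then have i: "i < p - r" and j: "j < m" using Mc Lc[OF x] by auto
      have "Lg g m (Psi (Suc k)) x $$ (i, j) = (\<Sum>b<s. S (Suc k) $$ (i, b) * (\<Sum>l<r. Q (\<rho> k + b) l * L x $$ (l, j)))"
        unfolding LgPsi[OF x i j]
      proof (rule sum.cong[OF refl])
        fix b assume "b \<in> {..<s}"
        then have b: "b < s" by simp
        have "Lg g m (Th k) x $$ (b, j) = A $$ (\<rho> k + b, j)" using append_rows_index(2)[OF c1 c2 j b] by (simp add: A_def)
        then show "S (Suc k) $$ (i, b) * Lg g m (Th k) x $$ (b, j) = S (Suc k) $$ (i, b) * (\<Sum>l<r. Q (\<rho> k + b) l * L x $$ (l, j))"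
          using Q[of "\<rho> k + b" j] b j by simp
      qed
      also have "\<dots> = (\<Sum>l<r. \<Sum>b<s. S (Suc k) $$ (i, b) * Q (\<rho> k + b) l * L x $$ (l, j))"
        by (subst sum.swap) (simp add: sum_distrib_left mult.assoc)
      also have "\<dots> = (\<Sum>l<r. M $$ (i, l) * L x $$ (l, j))"
        using i by (intro sum.cong) (auto simp: M_def sum_distrib_right)
      finally show "Lg g m (Psi (Suc k)) x $$ (i, j) = (M * L x) $$ (i, j)"
        using mult_mat_index_sum[OF Mc Lc[OF x] i j] by simp
    qed (use Mc Lc[OF x] LgPsic[OF x] in auto)
    then show ?thesis using Mc by blast
  qed
  have uniq: "M = M'" if x: "x \<in> U" and M: "M \<in> carrier_mat (p - r) r" "Lg g m (Psi (Suc k)) x = M * L x"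
      and M': "M' \<in> carrier_mat (p - r) r" "Lg g m (Psi (Suc k)) x = M' * L x" for x M M'
  proof (rule eq_matI)
    fix i l assume "i < dim_row M'" "l < dim_col M'"
    then have i: "i < p - r" and l: "l < r" using M' by auto
    have "(\<Sum>l<r. (M $$ (i, l) - M' $$ (i, l)) * L x $$ (l, j)) = 0" if j: "j < m" for j
      using mult_mat_index_sum[OF M(1) Lc[OF x] i j] mult_mat_index_sum[OF M'(1) Lc[OF x] i j] M(2) M'(2)
      by (simp add: left_diff_distrib sum_subtractf)
    then have "\<forall>l<r. M $$ (i, l) - M' $$ (i, l) = 0"
      using indep[OF x, unfolded independent_rows_def, rule_format, of "\<lambda>l. M $$ (i, l) - M' $$ (i, l)"] by blast
    then show "M $$ (i, l) = M' $$ (i, l)" using l by simp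
  qed (use M M' in auto)
  have P: "P (Suc k) x \<in> carrier_mat (p - r) r \<and> Lg g m (Psi (Suc k)) x = P (Suc k) x * L x" if x: "x \<in> U" for x
  proof -
    have d: "dim_vec (Psi (Suc k) x) = p - r" "dim_vec (Om (Suc k) x) = r"
      using smooth_vec_onD(2)[OF sPsi x] smooth_vec_onD(2)[OF sOm' x] by auto
    have "\<exists>!M. M \<in> carrier_mat (p - r) r \<and> Lg g m (Psi (Suc k)) x = M * L x"
      using ex[OF x] uniq[OF x] by blast
    from theI'[OF this] show ?thesis unfolding P_def Pcoeff_def d L_def .
  qed
  show Pc: "P (Suc k) x \<in> carrier_mat (p - \<rho> (Suc k)) (\<rho> (Suc k))" if "x \<in> U" for x using P[OF that] by (simp add: r_def)
  show PL: "Lg g m (Psi (Suc k)) x = P (Suc k) x * Lg g m (Om (Suc k)) x" if "x \<in> U" for x using P[OF that] by (simp add: L_def)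
  have sL: "smooth_on U (\<lambda>x. Lg g m (Om (Suc k)) x $$ (i, j))" if "i < r" "j < m" for i j
  proof -
    have "smooth_on U (\<lambda>x. frechet_derivative (\<lambda>z. Om (Suc k) z $ i) (at x) (g j x))"
      using smooth_on_frechet_apply[OF U(1) smooth_vec_onD(3)[OF sOm' that(1)] g[OF that(2)]] .
    then show ?thesis using smooth_on_cong[OF U(1)] Lg_index[OF sOm' _ that] by (metis (no_types, lifting))
  qed
  have sLPsi: "smooth_on U (\<lambda>x. Lg g m (Psi (Suc k)) x $$ (i, j))" if "i < p - r" "j < m" for i j
  proof -
    have "smooth_on U (\<lambda>x. frechet_derivative (\<lambda>z. Psi (Suc k) z $ i) (at x) (g j x))"
      using smooth_on_frechet_apply[OF U(1) smooth_vec_onD(3)[OF sPsi that(1)] g[OF that(2)]] .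
    then show ?thesis using smooth_on_cong[OF U(1)] Lg_index[OF sPsi _ that] by (metis (no_types, lifting))
  qed
  \<comment> \<open>A row of \<open>P\<close> has \<open>r\<close> unknowns and \<open>m\<close>
    equations. Multiplication by the transpose of \<open>L\<close> leaves a square system with a
    Gram matrix, which has a smooth solution.\<close>
  show Ps: "smooth_on U (\<lambda>x. P (Suc k) x $$ (i, l))" if il: "i < p - \<rho> (Suc k)" "l < \<rho> (Suc k)" for i l
  proof (rule smooth_on_linear_solve[where r=r and v="\<lambda>l x. P (Suc k) x $$ (i, l)"
        and A="\<lambda>a l x. \<Sum>j<m. L x $$ (a, j) * L x $$ (l, j)"
        and w="\<lambda>a x. \<Sum>j<m. Lg g m (Psi (Suc k)) x $$ (i, j) * L x $$ (a, j)", OF U(1)])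
    have i: "i < p - r" using il by (simp add: r_def)
    show "smooth_on U (\<lambda>x. \<Sum>j<m. L x $$ (a, j) * L x $$ (l, j))" if "a < r" "l < r" for a l
      unfolding L_def by (intro smooth_on_sum smooth_on_mult U(1) sL) (use that in auto)
    show "smooth_on U (\<lambda>x. \<Sum>j<m. Lg g m (Psi (Suc k)) x $$ (i, j) * L x $$ (a, j))" if "a < r" for a
      unfolding L_def by (intro smooth_on_sum smooth_on_mult U(1) sL sLPsi) (use that i in auto)
    show "det (mat r r (\<lambda>(a, l). \<Sum>j<m. L x $$ (a, j) * L x $$ (l, j))) \<noteq> 0" if "x \<in> U" for x
      by (rule gram_det) (use indep[OF that] in \<open>simp add: independent_rows_def\<close>)
    show "(\<Sum>l<r. (\<Sum>j<m. L x $$ (a, j) * L x $$ (l, j)) * P (Suc k) x $$ (i, l)) =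
        (\<Sum>j<m. Lg g m (Psi (Suc k)) x $$ (i, j) * L x $$ (a, j))" if x: "x \<in> U" for x a
    proof -
      have "Lg g m (Psi (Suc k)) x $$ (i, j) = (\<Sum>l<r. P (Suc k) x $$ (i, l) * L x $$ (l, j))" if "j < m" for j
        using P[OF x] mult_mat_index_sum[OF _ Lc[OF x] i that, of "P (Suc k) x"] by simp
      then have "(\<Sum>j<m. Lg g m (Psi (Suc k)) x $$ (i, j) * L x $$ (a, j)) =
          (\<Sum>j<m. \<Sum>l<r. L x $$ (a, j) * L x $$ (l, j) * P (Suc k) x $$ (i, l))"
        by (intro sum.cong refl) (simp add: sum_distrib_left sum_distrib_right mult_ac)
      also have "\<dots> = (\<Sum>l<r. (\<Sum>j<m. L x $$ (a, j) * L x $$ (l, j)) * P (Suc k) x $$ (i, l))"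
        by (subst sum.swap) (simp add: sum_distrib_right)
      finally show ?thesis by simp
    qed
    show "l < r" using il by (simp add: r_def)
  qed
  have "smooth_vec_on U (p - r) (Th (Suc k))"
  proof (rule smooth_vec_onI[where G="\<lambda>i x. Lf f (Psi (Suc k)) x $ i - (\<Sum>l<r. P (Suc k) x $$ (i, l) * Lf f (Om (Suc k)) x $ l)"])
    note s1 = smooth_vec_on_Lf[OF U(1) sPsi f] and s2 = smooth_vec_on_Lf[OF U(1) sOm' f]
    have PO: "P (Suc k) x *\<^sub>v Lf f (Om (Suc k)) x \<in> carrier_vec (p - r)" if "x \<in> U" for x
      using mult_mat_vec_carrier[OF conjunct1[OF P[OF that]] smooth_vec_onD(1)[OF s2 that]] .
    show "Th (Suc k) x \<in> carrier_vec (p - r)" if "x \<in> U" for x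
      using smooth_vec_onD(1)[OF s1 that] PO[OF that] by (simp add: Th_Suc)
    show "Th (Suc k) x $ i = Lf f (Psi (Suc k)) x $ i - (\<Sum>l<r. P (Suc k) x $$ (i, l) * Lf f (Om (Suc k)) x $ l)"
      if "i < p - r" "x \<in> U" for i x
      using smooth_vec_onD(2)[OF s1 that(2)] carrier_matD(1)[OF conjunct1[OF P[OF that(2)]]] P[OF that(2)] that
        mult_mat_vec_index_sum[OF _ smooth_vec_onD(1)[OF s2 that(2)] that(1), of "P (Suc k) x"]
      by (simp add: Th_Suc)
    show "smooth_on U (\<lambda>x. Lf f (Psi (Suc k)) x $ i - (\<Sum>l<r. P (Suc k) x $$ (i, l) * Lf f (Om (Suc k)) x $ l))" if "i < p - r" for i
      by (intro smooth_on_diff smooth_on_sum smooth_on_mult U(1) smooth_vec_onD(3)[OF s1] smooth_vec_onD(3)[OF s2] Ps)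
        (use that in \<open>auto simp: r_def\<close>)
  qed (rule U(1))
  then show "regular_at (Suc k)"
    unfolding regular_at_def using sOm' indep by (simp add: r_def L_def)
qed

lemma regular_at: "k \<le> kstar \<Longrightarrow> regular_at k"
proof (induction k)
  case 0
  have "smooth_vec_on U 0 (Om 0)" by (simp add: smooth_vec_on_def Om_0)
  then show ?case using h by (simp add: regular_at_def Th_0 rho_0 independent_rows_def)
next
  case (Suc k)
  then show ?case using regular_at_Suc[of k] by simp
qed

end

section \<open>The integrator chains\<close>

lemma infinite_zeros_Suc:
  "infinite_zeros \<rho> (Suc k) = infinite_zeros \<rho> k @ replicate (\<rho> (Suc k) - \<rho> k) (Suc k)"
  by (simp add: infinite_zeros_def)

text \<open>All index estimates for the chains rest on this localisation: position \<open>i\<close>,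
  counted from 0, lies in the block of rows that step \<open>infinite_zeros \<rho> k ! i\<close>
  adds.\<close>

lemma infinite_zeros_nth:
  assumes "\<rho> 0 = 0" "\<And>j. j < k \<Longrightarrow> \<rho> j \<le> \<rho> (Suc j)"
  shows "length (infinite_zeros \<rho> k) = \<rho> k"
    and "i < \<rho> k \<Longrightarrow> 1 \<le> infinite_zeros \<rho> k ! i \<and> infinite_zeros \<rho> k ! i \<le> k \<and>
      \<rho> (infinite_zeros \<rho> k ! i - 1) \<le> i \<and> i < \<rho> (infinite_zeros \<rho> k ! i)"
proof -
  have "length (infinite_zeros \<rho> k) = \<rho> k \<and> (\<forall>i<\<rho> k. 1 \<le> infinite_zeros \<rho> k ! i \<and> infinite_zeros \<rho> k ! i \<le> k \<and>
      \<rho> (infinite_zeros \<rho> k ! i - 1) \<le> i \<and> i < \<rho> (infinite_zeros \<rho> k ! i))"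
    using assms(2)
  proof (induction k)
    case 0
    then show ?case using assms(1) by (simp add: infinite_zeros_def)
  next
    case (Suc k)
    then have IH: "length (infinite_zeros \<rho> k) = \<rho> k" "\<And>i. i < \<rho> k \<Longrightarrow> 1 \<le> infinite_zeros \<rho> k ! i \<and> infinite_zeros \<rho> k ! i \<le> k \<and>
      \<rho> (infinite_zeros \<rho> k ! i - 1) \<le> i \<and> i < \<rho> (infinite_zeros \<rho> k ! i)" by auto
    have le: "\<rho> k \<le> \<rho> (Suc k)" using Suc.prems by simp
    show ?case
    proof (intro conjI allI impI)
      show "length (infinite_zeros \<rho> (Suc k)) = \<rho> (Suc k)" using IH(1) le by (simp add: infinite_zeros_Suc)
      fix i assume i: "i < \<rho> (Suc k)"
      define z where "z = infinite_zeros \<rho> (Suc k) ! i"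
      have "(i < \<rho> k \<and> z = infinite_zeros \<rho> k ! i) \<or> (\<rho> k \<le> i \<and> z = Suc k)"
        using IH(1) i by (auto simp: z_def infinite_zeros_Suc nth_append)
      then have "1 \<le> z \<and> z \<le> Suc k \<and> \<rho> (z - 1) \<le> i \<and> i < \<rho> z" using IH(2)[of i] i by auto
      then show "1 \<le> infinite_zeros \<rho> (Suc k) ! i" "infinite_zeros \<rho> (Suc k) ! i \<le> Suc k"
        "\<rho> (infinite_zeros \<rho> (Suc k) ! i - 1) \<le> i" "i < \<rho> (infinite_zeros \<rho> (Suc k) ! i)"
        by (simp_all add: z_def)
    qed
  qed
  then show "length (infinite_zeros \<rho> k) = \<rho> k"
    and "i < \<rho> k \<Longrightarrow> 1 \<le> infinite_zeros \<rho> k ! i \<and> infinite_zeros \<rho> k ! i \<le> k \<and>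
      \<rho> (infinite_zeros \<rho> k ! i - 1) \<le> i \<and> i < \<rho> (infinite_zeros \<rho> k ! i)" by auto
qed

lemma deriv_along_sum:
  assumes "\<theta> differentiable (at x)"
  shows "deriv_along f g m \<theta> x u = frechet_derivative \<theta> (at x) (f x) + (\<Sum>j<m. u $ j * frechet_derivative \<theta> (at x) (g j x))"
  using has_derivative_linear[OF has_derivative_frechet[OF assms]]
  by (simp add: deriv_along_def linear_add linear_sum linear_scale)

lemma deriv_along_vec:
  assumes "smooth_vec_on U r \<Theta>" "x \<in> U" "i < r"
  shows "deriv_along f g m (\<lambda>z. \<Theta> z $ i) x u = Lf f \<Theta> x $ i + (\<Sum>j<m. u $ j * Lg g m \<Theta> x $$ (i, j))"
  using deriv_along_sum[OF smooth_on_differentiable[OF smooth_vec_onD(3)[OF assms(1,3)] assms(2)]]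
    Lf_index[OF assms] Lg_index[OF assms] by simp

lemma deriv_along_mult:
  assumes "open U" "A \<in> carrier_mat a b" "smooth_vec_on U b \<Theta>" "x \<in> U" "i < a"
  shows "deriv_along f g m (\<lambda>z. (A *\<^sub>v \<Theta> z) $ i) x u = (\<Sum>l<b. A $$ (i, l) * deriv_along f g m (\<lambda>z. \<Theta> z $ l) x u)"
  unfolding deriv_along_def by (rule frechet_mult_mat_vec[OF assms])

locale square_system = regular_system U f g h m p \<rho> R S kstar
  for U :: "(real ^ 'n::finite) set" and f g h m p \<rho> R S kstar +
  fixes q :: "nat \<Rightarrow> nat"
  assumes mp: "m = p" and p: "p = \<rho> kstar"
    and q: "\<forall>i\<in>{1..m}. q i = infinite_zeros \<rho> kstar ! (i - 1)"
begin

lemma q_range: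
  assumes "i \<in> {1..m}"
  shows "1 \<le> q i" "q i \<le> kstar" "\<rho> (q i - 1) < i" "i \<le> \<rho> (q i)"
proof -
  have "i - 1 < \<rho> kstar" using assms mp p by auto
  from infinite_zeros_nth(2)[OF rho_0 _ this] q[rule_format, OF assms] rho_step
  have "1 \<le> q i \<and> q i \<le> kstar \<and> \<rho> (q i - 1) \<le> i - 1 \<and> i - 1 < \<rho> (q i)" by simp
  then show "1 \<le> q i" "q i \<le> kstar" "\<rho> (q i - 1) < i" "i \<le> \<rho> (q i)" using assms by auto
qed

text \<open>The row of chain \<open>i\<close> inside the block of its level. Chains are counted from
  1 and rows from 0, hence \<open>i - 1\<close>.\<close>

definition c where "c i = i - 1 - \<rho> (q i - 1)"
definition K where "K i j = R i * Sprod p \<rho> S (i - 1) j"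

lemma c_less: "i \<in> {1..m} \<Longrightarrow> c i < \<rho> (q i) - \<rho> (q i - 1)"
  using q_range[of i] by (auto simp: c_def)

lemma R_carrier: "1 \<le> k \<Longrightarrow> k \<le> kstar \<Longrightarrow> R k \<in> carrier_mat (\<rho> k - \<rho> (k - 1)) (p - \<rho> (k - 1))"
  and S_carrier: "1 \<le> k \<Longrightarrow> k \<le> kstar \<Longrightarrow> S k \<in> carrier_mat (p - \<rho> k) (p - \<rho> (k - 1))"
  using step[of "k - 1"] by auto

lemma Sprod_carrier: "1 \<le> j \<Longrightarrow> j \<le> Suc i \<Longrightarrow> i \<le> kstar \<Longrightarrow> Sprod p \<rho> S i j \<in> carrier_mat (p - \<rho> i) (p - \<rho> (j - 1))"
proof (induction i)
  case (Suc i)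
  show ?case
  proof (cases "j = Suc (Suc i)")
    case False
    then show ?thesis using Suc S_carrier[of "Suc i"] by (auto intro: mult_carrier_mat)
  qed simp
qed simp

lemma Sprod_last: "Sprod p \<rho> S i (Suc i) = 1\<^sub>m (p - \<rho> i)"
  by (cases i) auto

text \<open>The recursion of \<open>Sprod\<close> grows on the left, while a step along a chain
  removes the rightmost factor.\<close>

lemma Sprod_split: "1 \<le> j \<Longrightarrow> j \<le> i \<Longrightarrow> i \<le> kstar \<Longrightarrow> Sprod p \<rho> S i j = Sprod p \<rho> S i (Suc j) * S j"
proof (induction i)
  case (Suc i)
  note Sc = S_carrier[of "Suc i"]
  show ?case
  proof (cases "j = Suc i")
    case True
    then show ?thesis using Sc Suc.prems Sprod_last[of i] by simp
  next
    case False
    then have j: "j \<le> i" using Suc.prems by simp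
    have 1: "S (Suc i) \<in> carrier_mat (p - \<rho> (Suc i)) (p - \<rho> i)"
      "Sprod p \<rho> S i (Suc j) \<in> carrier_mat (p - \<rho> i) (p - \<rho> j)"
      "S j \<in> carrier_mat (p - \<rho> j) (p - \<rho> (j - 1))"
      using Sc Sprod_carrier[of "Suc j" i] S_carrier[of j] Suc.prems j by auto
    then show ?thesis using assoc_mult_mat[OF 1] Suc j by simp
  qed
qed simp

lemma K_carrier:
  assumes "1 \<le> j" "j \<le> i" "i \<le> kstar"
  shows "K i j \<in> carrier_mat (\<rho> i - \<rho> (i - 1)) (p - \<rho> (j - 1))"
  unfolding K_def using R_carrier[of i] Sprod_carrier[of j "i - 1"] assms by (auto intro: mult_carrier_mat)

lemma K_last:
  assumes "1 \<le> i" "i \<le> kstar"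
  shows "K i i = R i"
  unfolding K_def using R_carrier[OF assms] Sprod_last[of "i - 1"] assms(1) by simp

text \<open>Hence \<open>K i j\<close> applied to \<open>Th (j - 1)\<close> is
  \<open>K i (Suc j)\<close> applied to \<open>Psi j\<close>, the function whose derivative leads to
  \<open>Th j\<close>.\<close>

lemma K_split:
  assumes "1 \<le> j" "j < i" "i \<le> kstar"
  shows "K i j = K i (Suc j) * S j"
proof -
  have "Sprod p \<rho> S (i - 1) j = Sprod p \<rho> S (i - 1) (Suc j) * S j"
    by (rule Sprod_split) (use assms in auto)
  moreover have 1: "R i \<in> carrier_mat (\<rho> i - \<rho> (i - 1)) (p - \<rho> (i - 1))"
    "Sprod p \<rho> S (i - 1) (Suc j) \<in> carrier_mat (p - \<rho> (i - 1)) (p - \<rho> j)"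
    "S j \<in> carrier_mat (p - \<rho> j) (p - \<rho> (j - 1))"
    using R_carrier[of i] Sprod_carrier[of "Suc j" "i - 1"] S_carrier[of j] assms by auto
  ultimately show ?thesis using assoc_mult_mat[OF 1] by (simp add: K_def)
qed

lemma smooth_Th: "k \<le> kstar \<Longrightarrow> smooth_vec_on U (p - \<rho> k) (Th k)"
  and smooth_Om: "k \<le> kstar \<Longrightarrow> smooth_vec_on U (\<rho> k) (Om k)"
  using regular_at[of k] by (auto simp: regular_at_def)

text \<open>Row \<open>c i\<close> of \<open>zeta\<close> at level \<open>q i\<close> and position
  \<open>j\<close>.\<close>

definition xi where "xi i j x = (K (q i) j *\<^sub>v Th (j - 1) x) $ c i"
definition a where "a i x = Lf f (Om kstar) x $ (i - 1)"
definition b where "b i x = row (Lg g m (Om kstar) x) (i - 1)"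

lemma smooth_Om_kstar: "smooth_vec_on U m (Om kstar)"
  using smooth_Om[of kstar] mp p by simp

lemma Om_derivative:
  assumes "x \<in> U" "i < m" "u \<in> carrier_vec m"
  shows "deriv_along f g m (\<lambda>z. Om kstar z $ i) x u = a (Suc i) x + b (Suc i) x \<bullet> u"
proof -
  have "b (Suc i) x \<bullet> u = (\<Sum>j<m. u $ j * Lg g m (Om kstar) x $$ (i, j))"
    using Lg_carrier[OF smooth_Om_kstar assms(1), of g m] assms(2,3)
    by (auto simp: b_def scalar_prod_def atLeast0LessThan mult.commute intro!: sum.cong)
  then show ?thesis using deriv_along_vec[OF smooth_Om_kstar assms(1,2)] by (simp add: a_def)
qed

lemma Om_prefix: "k \<le> l \<Longrightarrow> l \<le> kstar \<Longrightarrow> i < \<rho> k \<Longrightarrow> z \<in> U \<Longrightarrow> Om l z $ i = Om k z $ i"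
proof (induction l rule: dec_induct)
  case (step l)
  have "i < \<rho> l" using step rho_mono[of k l] by simp
  then have "Om (Suc l) z $ i = Om l z $ i"
    using smooth_vec_onD(2)[OF smooth_Om[of l] \<open>z \<in> U\<close>] step by (simp add: Om_Suc)
  then show ?case using step by simp
qed simp

lemma Om_level:
  assumes "k < kstar" "i < \<rho> (Suc k) - \<rho> k" "z \<in> U"
  shows "Om kstar z $ (\<rho> k + i) = (R (Suc k) *\<^sub>v Th k z) $ i"
proof -
  have "\<rho> k + i < \<rho> (Suc k)" using assms by simp
  then have "Om kstar z $ (\<rho> k + i) = Om (Suc k) z $ (\<rho> k + i)" using Om_prefix[of "Suc k" kstar] assms by simp
  then show ?thesis using smooth_vec_onD(2)[OF smooth_Om[of k] assms(3)] assms R_carrier[of "Suc k"] by (simp add: Om_Suc)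
qed

text \<open>Replacing the drift part of \<open>Psi\<close> by \<open>Th\<close> plus
  \<open>P\<close> times the drift part of \<open>Om\<close>, and the input part by \<open>P\<close>
  times that of \<open>Om\<close>, collects \<open>P\<close> times the complete derivative of
  \<open>Om\<close>. The components of that derivative are the new inputs.\<close>

lemma Psi_derivative:
  assumes j: "j < kstar" and x: "x \<in> U" and i: "i < p - \<rho> (Suc j)" and u: "u \<in> carrier_vec m"
  shows "deriv_along f g m (\<lambda>z. Psi (Suc j) z $ i) x u =
    Th (Suc j) x $ i + (\<Sum>l<\<rho> (Suc j). P (Suc j) x $$ (i, l) * (a (Suc l) x + b (Suc l) x \<bullet> u))"
proof -
  note reg = regular_at[of j]
  have Pc: "P (Suc j) x \<in> carrier_mat (p - \<rho> (Suc j)) (\<rho> (Suc j))" using P_carrier[OF j reg x] j by simp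
  have sPsi: "smooth_vec_on U (p - \<rho> (Suc j)) (Psi (Suc j))"
    unfolding Psi_def using smooth_vec_on_mult[OF U(1) S_carrier[of "Suc j"]] smooth_Th[of j] j by simp
  have sOm: "smooth_vec_on U (\<rho> (Suc j)) (Om (Suc j))" using smooth_Om j by simp
  have LO: "Lf f (Om (Suc j)) x \<in> carrier_vec (\<rho> (Suc j))"
    using smooth_vec_onD(1)[OF smooth_vec_on_Lf[OF U(1) sOm f] x] .
  have LgO: "Lg g m (Om (Suc j)) x \<in> carrier_mat (\<rho> (Suc j)) m" using Lg_carrier[OF sOm x] .
  have Lg: "Lg g m (Psi (Suc j)) x $$ (i, t) = (\<Sum>l<\<rho> (Suc j). P (Suc j) x $$ (i, l) * Lg g m (Om (Suc j)) x $$ (l, t))" if "t < m" for t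
    using Lg_Psi[OF j reg x] mult_mat_index_sum[OF Pc LgO i that] j by simp
  have Th: "Th (Suc j) x $ i = Lf f (Psi (Suc j)) x $ i - (\<Sum>l<\<rho> (Suc j). P (Suc j) x $$ (i, l) * Lf f (Om (Suc j)) x $ l)"
    unfolding Th_Suc using mult_mat_vec_index_sum[OF Pc LO i] i Pc by simp
  have v: "deriv_along f g m (\<lambda>z. Om (Suc j) z $ l) x u = a (Suc l) x + b (Suc l) x \<bullet> u" if l: "l < \<rho> (Suc j)" for l
  proof -
    have lm: "l < m" using l rho_le[of "Suc j"] j mp by simp
    have "frechet_derivative (\<lambda>z. Om (Suc j) z $ l) (at x) = frechet_derivative (\<lambda>z. Om kstar z $ l) (at x)"
      by (rule frechet_derivative_cong_open[OF U(1) x]) (use Om_prefix[of "Suc j" kstar] j l in simp)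
    then show ?thesis using Om_derivative[OF x lm u] by (simp add: deriv_along_def)
  qed
  have "deriv_along f g m (\<lambda>z. Psi (Suc j) z $ i) x u =
      Lf f (Psi (Suc j)) x $ i + (\<Sum>t<m. u $ t * (\<Sum>l<\<rho> (Suc j). P (Suc j) x $$ (i, l) * Lg g m (Om (Suc j)) x $$ (l, t)))"
    using deriv_along_vec[OF sPsi x i, of f g m u] Lg by simp
  also have "(\<Sum>t<m. u $ t * (\<Sum>l<\<rho> (Suc j). P (Suc j) x $$ (i, l) * Lg g m (Om (Suc j)) x $$ (l, t))) =
      (\<Sum>l<\<rho> (Suc j). P (Suc j) x $$ (i, l) * (\<Sum>t<m. u $ t * Lg g m (Om (Suc j)) x $$ (l, t)))"
    by (simp add: sum_distrib_left mult.left_commute) (rule sum.swap)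
  also have "Lf f (Psi (Suc j)) x $ i + \<dots> = Th (Suc j) x $ i +
      (\<Sum>l<\<rho> (Suc j). P (Suc j) x $$ (i, l) * (Lf f (Om (Suc j)) x $ l + (\<Sum>t<m. u $ t * Lg g m (Om (Suc j)) x $$ (l, t))))"
    by (simp add: Th distrib_left sum.distrib)
  also have "(\<Sum>l<\<rho> (Suc j). P (Suc j) x $$ (i, l) * (Lf f (Om (Suc j)) x $ l + (\<Sum>t<m. u $ t * Lg g m (Om (Suc j)) x $$ (l, t)))) =
      (\<Sum>l<\<rho> (Suc j). P (Suc j) x $$ (i, l) * (a (Suc l) x + b (Suc l) x \<bullet> u))"
    using deriv_along_vec[OF sOm x, of _ f g m u] v by (intro sum.cong) auto
  finally show ?thesis .
qed

text \<open>The condition \<open>l \<le> \<rho> j\<close> says that \<open>P j\<close> has a column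
  for the input \<open>l\<close>; inputs are counted from 1 and columns from 0.\<close>

definition del where
  "del i j l x = (if l \<le> \<rho> j then \<Sum>t<p - \<rho> j. K (q i) (Suc j) $$ (c i, t) * P j x $$ (t, l - 1) else 0)"

lemma xi_derivative:
  assumes i: "i \<in> {1..m}" and j: "j \<in> {1..<q i}" and x: "x \<in> U" and u: "u \<in> carrier_vec m"
  shows "deriv_along f g m (xi i j) x u = xi i (j + 1) x + (\<Sum>l\<in>{1..<i}. del i j l x * (a l x + b l x \<bullet> u))"
proof -
  note qi = q_range[OF i]
  obtain k where k: "j = Suc k" using j by (cases j) auto
  have kk: "k < kstar" "Suc k \<le> kstar" "j \<le> kstar" using j k qi by auto
  have Kc: "K (q i) (Suc j) \<in> carrier_mat (\<rho> (q i) - \<rho> (q i - 1)) (p - \<rho> j)"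
    using K_carrier[of "Suc j" "q i"] j qi by simp
  have Sc: "S j \<in> carrier_mat (p - \<rho> j) (p - \<rho> k)" using S_carrier[of j] k kk by simp
  have sTh: "smooth_vec_on U (p - \<rho> k) (Th k)" using smooth_Th kk by simp
  have sPsi: "smooth_vec_on U (p - \<rho> j) (Psi j)" unfolding Psi_def using smooth_vec_on_mult[OF U(1) Sc] sTh k by simp
  define w where "w l = a (Suc l) x + b (Suc l) x \<bullet> u" for l
  have "deriv_along f g m (xi i j) x u = deriv_along f g m (\<lambda>z. (K (q i) (Suc j) *\<^sub>v Psi j z) $ c i) x u"
    unfolding deriv_along_def
  proof (rule fun_cong[where x="f x + (\<Sum>j<m. u $ j *\<^sub>R g j x)"], rule frechet_derivative_cong_open[OF U(1) x])
    fix z assume z: "z \<in> U"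
    have "K (q i) (Suc j) * S j *\<^sub>v Th k z = K (q i) (Suc j) *\<^sub>v (S j *\<^sub>v Th k z)"
      by (rule assoc_mult_mat_vec[OF Kc Sc smooth_vec_onD(1)[OF sTh z]])
    moreover have "K (q i) j = K (q i) (Suc j) * S j" by (rule K_split) (use j qi in auto)
    ultimately show "xi i j z = (K (q i) (Suc j) *\<^sub>v Psi j z) $ c i"
      by (simp add: xi_def Psi_def k)
  qed
  also have "\<dots> = (\<Sum>t<p - \<rho> j. K (q i) (Suc j) $$ (c i, t) * deriv_along f g m (\<lambda>z. Psi j z $ t) x u)"
    by (rule deriv_along_mult[OF U(1) Kc sPsi x c_less[OF i]])
  also have "\<dots> = (\<Sum>t<p - \<rho> j. K (q i) (Suc j) $$ (c i, t) * Th j x $ t +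
      (\<Sum>l<\<rho> j. K (q i) (Suc j) $$ (c i, t) * P j x $$ (t, l) * w l))"
    using Psi_derivative[OF kk(1) x _ u] by (intro sum.cong) (auto simp: k w_def distrib_left sum_distrib_left mult.assoc)
  also have "\<dots> = (\<Sum>t<p - \<rho> j. K (q i) (Suc j) $$ (c i, t) * Th j x $ t) +
      (\<Sum>l<\<rho> j. (\<Sum>t<p - \<rho> j. K (q i) (Suc j) $$ (c i, t) * P j x $$ (t, l)) * w l)"
    unfolding sum.distrib by (subst sum.swap) (simp add: sum_distrib_right)
  also have "(\<Sum>t<p - \<rho> j. K (q i) (Suc j) $$ (c i, t) * Th j x $ t) = xi i (j + 1) x"
    using mult_mat_vec_index_sum[OF Kc smooth_vec_onD(1)[OF smooth_Th[OF kk(3)] x] c_less[OF i]] by (simp add: xi_def)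
  also have "(\<Sum>l<\<rho> j. (\<Sum>t<p - \<rho> j. K (q i) (Suc j) $$ (c i, t) * P j x $$ (t, l)) * w l) =
      (\<Sum>l<\<rho> j. del i j (Suc l) x * w l)"
    by (intro sum.cong) (auto simp: del_def)
  also have "\<dots> = (\<Sum>l\<in>Suc ` {..<\<rho> j}. del i j l x * (a l x + b l x \<bullet> u))"
    by (simp add: sum.reindex w_def)
  \<comment> \<open>Since \<open>\<rho> j \<le> \<rho> (q i - 1) < i\<close>, all inputs with a
    nonzero coefficient come before \<open>i\<close>; this is the triangular structure of the normal
    form.\<close>
  also have "\<dots> = (\<Sum>l\<in>{1..<i}. del i j l x * (a l x + b l x \<bullet> u))"
  proof (rule sum.mono_neutral_left)
    have "\<rho> j \<le> \<rho> (q i - 1)" by (rule rho_mono) (use j qi in auto)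
    then have "\<rho> j < i" using qi(3) by simp
    then show "Suc ` {..<\<rho> j} \<subseteq> {1..<i}" by auto
    show "\<forall>l\<in>{1..<i} - Suc ` {..<\<rho> j}. del i j l x * (a l x + b l x \<bullet> u) = 0"
    proof
      fix l assume l: "l \<in> {1..<i} - Suc ` {..<\<rho> j}"
      have "\<not> l \<le> \<rho> j"
      proof
        assume "l \<le> \<rho> j"
        then have "l - 1 < \<rho> j" "l = Suc (l - 1)" using l by auto
        then have "l \<in> Suc ` {..<\<rho> j}" by blast
        then show False using l by blast
      qed
      then show "del i j l x * (a l x + b l x \<bullet> u) = 0" by (simp add: del_def)
    qed
  qed simp
  finally show ?thesis .
qed

text \<open>At the end of a chain \<open>K\<close> reduces to \<open>R\<close>, so the last
  positions are the components of \<open>Om kstar\<close>. This gives the last equation of each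
  chain and later ties the chains to the first integrals.\<close>

lemma xi_last: "i \<in> {1..m} \<Longrightarrow> z \<in> U \<Longrightarrow> xi i (q i) z = Om kstar z $ (i - 1)"
  using Om_level[of "q i - 1" "c i" z] q_range[of i] c_less[of i] K_last[of "q i"] by (simp add: xi_def c_def)

section \<open>The constant output transformation\<close>

definition Gam where "Gam = mat p p (\<lambda>(i, t). K (q (Suc i)) 1 $$ (c (Suc i), t))"

text \<open>For \<open>v\<close> in the kernel let \<open>w k\<close> be its image under the product
  of \<open>S k\<close> down to \<open>S 1\<close>. The rows of \<open>Gam\<close> say that
  \<open>R (Suc k)\<close> kills \<open>w k\<close>, and \<open>S (Suc k)\<close> maps it to
  \<open>w (Suc k)\<close>. As \<open>R\<close> stacked on \<open>S\<close> is invertible, vanishing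
  passes from \<open>w (Suc k)\<close> back to \<open>w k\<close>, and finally to
  \<open>w 0 = v\<close>.\<close>

lemma Gam_invertible: "invertible_mat Gam"
proof -
  have G: "Gam \<in> carrier_mat p p" by (simp add: Gam_def)
  have "det Gam \<noteq> 0"
  proof
    assume "det Gam = 0"
    then obtain v where v: "v \<in> carrier_vec p" "v \<noteq> 0\<^sub>v p" "Gam *\<^sub>v v = 0\<^sub>v p"
      using det_0_iff_vec_prod_zero_field[OF G] by auto
    define w where "w k = Sprod p \<rho> S k 1 *\<^sub>v v" for k
    have wc: "w k \<in> carrier_vec (p - \<rho> k)" if "k \<le> kstar" for k
      unfolding w_def using mult_mat_vec_carrier[OF Sprod_carrier[of 1 k]] v(1) that rho_0 by simp
    have Sw: "S (Suc k) *\<^sub>v w k = w (Suc k)" if "k < kstar" for k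
    proof -
      have 1: "S (Suc k) \<in> carrier_mat (p - \<rho> (Suc k)) (p - \<rho> k)" "Sprod p \<rho> S k 1 \<in> carrier_mat (p - \<rho> k) p"
        using S_carrier[of "Suc k"] Sprod_carrier[of 1 k] that rho_0 by auto
      show ?thesis using assoc_mult_mat_vec[OF 1 v(1)] by (simp add: w_def)
    qed
    have Rw: "R (Suc k) *\<^sub>v w k = 0\<^sub>v (\<rho> (Suc k) - \<rho> k)" if k: "k < kstar" for k
    proof -
      have Kv: "R (Suc k) *\<^sub>v w k = K (Suc k) 1 *\<^sub>v v"
      proof -
        have 1: "R (Suc k) \<in> carrier_mat (\<rho> (Suc k) - \<rho> k) (p - \<rho> k)" "Sprod p \<rho> S k 1 \<in> carrier_mat (p - \<rho> k) p"
          using R_carrier[of "Suc k"] Sprod_carrier[of 1 k] k rho_0 by auto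
        show ?thesis using assoc_mult_mat_vec[OF 1 v(1)] by (simp add: w_def K_def)
      qed
      have Kc: "K (Suc k) 1 \<in> carrier_mat (\<rho> (Suc k) - \<rho> k) p" using K_carrier[of 1 "Suc k"] k rho_0 by simp
      show ?thesis unfolding Kv
      proof (rule eq_vecI)
        fix t assume "t < dim_vec (0\<^sub>v (\<rho> (Suc k) - \<rho> k) :: real vec)"
        then have t: "t < \<rho> (Suc k) - \<rho> k" by simp
        define i where "i = Suc (\<rho> k + t)"
        have ip: "\<rho> k + t < p" using t rho_le[of "Suc k"] k by simp
        then have i: "i \<in> {1..m}" using mp by (simp add: i_def)
        \<comment> \<open>By monotonicity of \<open>\<rho>\<close>, the blocks of different levels
          do not overlap.\<close>
        have "q i = Suc k"
        proof (rule antisym)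
          show "q i \<le> Suc k"
          proof (rule ccontr)
            assume "\<not> q i \<le> Suc k"
            then have "\<rho> (Suc k) \<le> \<rho> (q i - 1)" using rho_mono[of "Suc k" "q i - 1"] q_range(2)[OF i] by simp
            then show False using q_range(3)[OF i] t by (simp add: i_def)
          qed
          show "Suc k \<le> q i"
          proof (rule ccontr)
            assume "\<not> Suc k \<le> q i"
            then have "\<rho> (q i) \<le> \<rho> k" using rho_mono[of "q i" k] k by simp
            then show False using q_range(4)[OF i] by (simp add: i_def)
          qed
        qed
        then have ci: "q (Suc (\<rho> k + t)) = Suc k" "c (Suc (\<rho> k + t)) = t" by (simp_all add: i_def c_def)
        have "(K (Suc k) 1 *\<^sub>v v) $ t = (\<Sum>l<p. K (Suc k) 1 $$ (t, l) * v $ l)"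
          by (rule mult_mat_vec_index_sum[OF Kc v(1) t])
        also have "\<dots> = (Gam *\<^sub>v v) $ (\<rho> k + t)"
          using mult_mat_vec_index_sum[OF G v(1) ip] ip ci by (simp add: Gam_def)
        finally show "(K (Suc k) 1 *\<^sub>v v) $ t = 0\<^sub>v (\<rho> (Suc k) - \<rho> k) $ t" using v(3) ip t by simp
      qed (use Kc in simp)
    qed
    \<comment> \<open>Descending induction, written with \<open>kstar - k\<close>. It starts from
      the empty vector because \<open>p = \<rho> kstar\<close>.\<close>
    have "w (kstar - k) = 0\<^sub>v (p - \<rho> (kstar - k))" if "k \<le> kstar" for k
      using that
    proof (induction k)
      case 0
      then show ?case using wc[of kstar] p by auto
    next
      case (Suc k)
      define l where "l = kstar - Suc k"
      have l: "l < kstar" "Suc l = kstar - k" using Suc.prems by (auto simp: l_def)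
      have w': "w (Suc l) = 0\<^sub>v (p - \<rho> (Suc l))" using Suc l by simp
      define A where "A = R (Suc l) @\<^sub>r S (Suc l)"
      have le: "\<rho> (Suc l) - \<rho> l + (p - \<rho> (Suc l)) = p - \<rho> l" using rho_step[OF l(1)] by simp
      have A: "A \<in> carrier_mat (p - \<rho> l) (p - \<rho> l)"
        using carrier_append_rows[OF step(2)[OF l(1)] step(4)[OF l(1)]] le by (simp add: A_def)
      have wl: "w l \<in> carrier_vec (p - \<rho> l)" using wc l by simp
      have "A *\<^sub>v w l = (R (Suc l) *\<^sub>v w l) @\<^sub>v (S (Suc l) *\<^sub>v w l)"
        unfolding A_def by (rule mat_mult_append[OF step(2)[OF l(1)] step(4)[OF l(1)] wl])
      also have "\<dots> = 0\<^sub>v (p - \<rho> l)" using Rw[OF l(1)] Sw[OF l(1)] w' le by auto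
      finally have "A *\<^sub>v w l = 0\<^sub>v (p - \<rho> l)" .
      moreover have "det A \<noteq> 0" using invertible_mat_det[OF A] step(5)[OF l(1)] by (simp add: A_def)
      ultimately have "w l = 0\<^sub>v (p - \<rho> l)" using det_0_iff_vec_prod_zero_field[OF A] wl by blast
      then show ?case by (simp add: l_def)
    qed
    from this[of kstar] have "w 0 = 0\<^sub>v p" using rho_0 by simp
    then show False using v by (simp add: w_def rho_0)
  qed
  then show ?thesis using invertible_mat_det[OF G] by simp
qed

lemma smooth_xi:
  assumes i: "i \<in> {1..m}" and j: "j \<in> {1..q i}"
  shows "smooth_on U (xi i j)"
proof -
  have "smooth_vec_on U (\<rho> (q i) - \<rho> (q i - 1)) (\<lambda>x. K (q i) j *\<^sub>v Th (j - 1) x)"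
    by (rule smooth_vec_on_mult[OF U(1) K_carrier smooth_Th]) (use j q_range[OF i] in auto)
  from smooth_vec_onD(3)[OF this c_less[OF i]] show ?thesis by (simp add: xi_def[abs_def])
qed

text \<open>For a square invertible system \<open>Om kstar\<close> has \<open>m\<close> components,
  so independence of the rows is nonsingularity.\<close>

lemma Lg_Om_det:
  assumes "x \<in> U"
  shows "det (Lg g m (Om kstar) x) \<noteq> 0"
proof
  have L: "Lg g m (Om kstar) x \<in> carrier_mat m m" using Lg_carrier[OF smooth_Om_kstar assms] .
  assume "det (Lg g m (Om kstar) x) = 0"
  then have "det (transpose_mat (Lg g m (Om kstar) x)) = 0" using det_transpose[OF L] by simp
  then obtain v where v: "v \<in> carrier_vec m" "v \<noteq> 0\<^sub>v m" "transpose_mat (Lg g m (Om kstar) x) *\<^sub>v v = 0\<^sub>v m"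
    using det_0_iff_vec_prod_zero_field[of "transpose_mat (Lg g m (Om kstar) x)" m] L by auto
  have "(\<Sum>i<m. v $ i * Lg g m (Om kstar) x $$ (i, j)) = 0" if j: "j < m" for j
  proof -
    have "(transpose_mat (Lg g m (Om kstar) x) *\<^sub>v v) $ j = (\<Sum>i<m. transpose_mat (Lg g m (Om kstar) x) $$ (j, i) * v $ i)"
      by (rule mult_mat_vec_index_sum[OF _ v(1) j]) (use L in simp)
    also have "\<dots> = (\<Sum>i<m. v $ i * Lg g m (Om kstar) x $$ (i, j))"
      using L j by (intro sum.cong) (auto simp: mult.commute)
    finally show ?thesis using v(3) j by simp
  qed
  moreover have km: "\<rho> kstar = m" using mp p by simp
  have "regular_at kstar" by (rule regular_at) simp
  then have "independent_rows (Lg g m (Om kstar) x) m m"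
    using assms unfolding regular_at_def km by blast
  ultimately have "\<forall>i<m. v $ i = 0" using independent_rows_def[THEN iffD1, rule_format, of _ m m "\<lambda>i. v $ i"] by blast
  then have "v = 0\<^sub>v m" using v(1) by (intro eq_vecI) auto
  then show False using v(2) by simp
qed

lemma chain_form_xi: "chain_form U f g (\<lambda>x. Gam *\<^sub>v h x) m q xi a b del"
  unfolding chain_form_def
proof (intro conjI ballI impI)
  fix i assume i: "i \<in> {1..m}"
  note qi = q_range[OF i]
  have im: "i - 1 < m" using i by auto
  show "smooth_on U (xi i j)" if "j \<in> {1..q i}" for j using smooth_xi[OF i that] .
  show "smooth_on U (a i)"
    unfolding a_def[abs_def] by (rule smooth_vec_onD(3)[OF smooth_vec_on_Lf[OF U(1) smooth_Om_kstar f] im])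
  show "smooth_vec_on U m (b i)"
  proof (rule smooth_vec_onI[where G="\<lambda>j x. frechet_derivative (\<lambda>z. Om kstar z $ (i - 1)) (at x) (g j x)", OF _ U(1)])
    show "b i x \<in> carrier_vec m" if "x \<in> U" for x
      unfolding b_def by (rule row_carrier_vec[OF im Lg_carrier[OF smooth_Om_kstar that]])
    show "b i x $ j = frechet_derivative (\<lambda>z. Om kstar z $ (i - 1)) (at x) (g j x)" if "j < m" "x \<in> U" for j x
      using Lg_index[OF smooth_Om_kstar that(2) im that(1), of g] Lg_carrier[OF smooth_Om_kstar that(2), of g m] im that(1)
      by (simp add: b_def)
    show "smooth_on U (\<lambda>x. frechet_derivative (\<lambda>z. Om kstar z $ (i - 1)) (at x) (g j x))" if "j < m" for j
      by (rule smooth_on_frechet_apply[OF U(1) smooth_vec_onD(3)[OF smooth_Om_kstar im] g[OF that]])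
  qed
  fix j l assume j: "j \<in> {1..<q i}" and l: "l \<in> {1..<i}"
  obtain k where k: "j = Suc k" "k < kstar" using j qi by (cases j) auto
  show "smooth_on U (del i j l)"
  proof (cases "l \<le> \<rho> j")
    case True
    have "smooth_on U (\<lambda>x. \<Sum>t<p - \<rho> j. K (q i) (Suc j) $$ (c i, t) * P j x $$ (t, l - 1))"
      unfolding k(1)
      by (intro smooth_on_sum smooth_on_mult smooth_on_const U(1) P_smooth[OF k(2) regular_at])
        (use True l k in auto)
    then show ?thesis using True by (simp add: del_def[abs_def])
  next
    case False
    then show ?thesis using smooth_on_const[OF U(1)] by (simp add: del_def[abs_def])
  qed
next
  fix x assume x: "x \<in> U"
  have L: "Lg g m (Om kstar) x \<in> carrier_mat m m" using Lg_carrier[OF smooth_Om_kstar x] .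
  have "mat_of_rows m (map (\<lambda>i. b i x) [1..<Suc m]) = Lg g m (Om kstar) x"
  proof (rule eq_matI)
    fix i j assume "i < dim_row (Lg g m (Om kstar) x)" "j < dim_col (Lg g m (Om kstar) x)"
    then have "[1..<Suc m] ! i = Suc i" "i < m" "j < m" using L by (auto simp del: upt_Suc)
    then show "mat_of_rows m (map (\<lambda>i. b i x) [1..<Suc m]) $$ (i, j) = Lg g m (Om kstar) x $$ (i, j)"
      using L by (simp add: mat_of_rows_def b_def del: upt_Suc)
  qed (use L in \<open>auto simp del: upt_Suc\<close>)
  then show "invertible_mat (mat_of_rows m (map (\<lambda>i. b i x) [1..<Suc m]))"
    using invertible_mat_det[OF L] Lg_Om_det[OF x] by (simp del: upt_Suc)
next
  fix x i and u :: "real vec" assume x: "x \<in> U" and u: "u \<in> carrier_vec m" and i: "i \<in> {1..m}"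
  show "deriv_along f g m (xi i j) x u = xi i (j + 1) x + (\<Sum>l\<in>{1..<i}. del i j l x * (a l x + b l x \<bullet> u))" if "j \<in> {1..<q i}" for j
    using xi_derivative[OF i that x u] .
  have "frechet_derivative (xi i (q i)) (at x) = frechet_derivative (\<lambda>z. Om kstar z $ (i - 1)) (at x)"
    by (rule frechet_derivative_cong_open[OF U(1) x xi_last[OF i]])
  moreover have "i - 1 < m" "Suc (i - 1) = i" using i by auto
  ultimately show "deriv_along f g m (xi i (q i)) x u = a i x + b i x \<bullet> u"
    using Om_derivative[OF x _ u, of "i - 1"] by (simp add: deriv_along_def)
next
  fix x i assume x: "x \<in> U" and i: "i \<in> {1..m}"
  have ip: "i - 1 < p" using i mp by auto
  have "Gam \<in> carrier_mat p p" by (simp add: Gam_def)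
  from mult_mat_vec_index_sum[OF this smooth_vec_onD(1)[OF h x] ip]
  have "(Gam *\<^sub>v h x) $ (i - 1) = (\<Sum>t<p. K (q i) 1 $$ (c i, t) * h x $ t)" using i ip by (simp add: Gam_def)
  moreover have "K (q i) 1 \<in> carrier_mat (\<rho> (q i) - \<rho> (q i - 1)) p" using K_carrier[of 1 "q i"] q_range[OF i] rho_0 by simp
  from mult_mat_vec_index_sum[OF this smooth_vec_onD(1)[OF h x] c_less[OF i]]
  have "xi i 1 x = (\<Sum>t<p. K (q i) 1 $$ (c i, t) * h x $ t)" by (simp add: xi_def Th_0)
  ultimately show "(Gam *\<^sub>v h x) $ (i - 1) = xi i 1 x" by simp
next
  \<comment> \<open>Component \<open>l\<close> enters \<open>Om\<close> at step \<open>q l\<close>,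
    so for \<open>j < q l\<close> the matrix \<open>P j\<close> has no column for it.\<close>
  fix x i j l assume x: "x \<in> U" and i: "i \<in> {1..m}" and j: "j \<in> {1..<q i}" and l: "l \<in> {1..<i}" and jl: "j < q l"
  have lm: "l \<in> {1..m}" using l i by auto
  have "\<rho> j \<le> \<rho> (q l - 1)" using rho_mono[of j "q l - 1"] jl q_range(2)[OF lm] by simp
  then have "\<not> l \<le> \<rho> j" using q_range(3)[OF lm] by simp
  then show "del i j l x = 0" by (simp add: del_def)
qed

end

section \<open>Coordinates\<close>

lemma distinct_concat_pairs:
  assumes "distinct xs" "\<And>x. x \<in> set xs \<Longrightarrow> distinct (F x)"
  shows "distinct (concat (map (\<lambda>x. map (Pair x) (F x)) xs))"
  using assms by (induction xs) (auto simp: distinct_map inj_on_def)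

text \<open>Through the adjoint, differentials become vectors of the state space, to which the
  theory of independent sets and spans applies.\<close>

lemma gradient:
  fixes \<theta> :: "'a::euclidean_space \<Rightarrow> real"
  assumes "\<theta> differentiable (at x)"
  shows "inner w (adjoint (frechet_derivative \<theta> (at x)) 1) = frechet_derivative \<theta> (at x) w"
  using adjoint_works[OF has_derivative_linear[OF has_derivative_frechet[OF assms]], of w 1] by simp

text \<open>Independence of a set does not see repetitions, that of a family excludes them. The
  injectivity allows the gradients to be counted.\<close>

lemma independent_familyD:
  fixes v :: "'i \<Rightarrow> 'a::real_vector"
  assumes "finite I" and ind: "\<And>s i. (\<Sum>i\<in>I. s i *\<^sub>R v i) = 0 \<Longrightarrow> i \<in> I \<Longrightarrow> s i = 0"
  shows "inj_on v I" "independent (v ` I)"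
proof -
  show inj: "inj_on v I"
  proof (rule inj_onI, rule ccontr)
    fix i k assume ik: "i \<in> I" "k \<in> I" "v i = v k" "i \<noteq> k"
    define s :: "'i \<Rightarrow> real" where "s l = (if l = i then 1 else if l = k then - 1 else 0)" for l
    have "(\<Sum>l\<in>I. s l *\<^sub>R v l) = (\<Sum>l\<in>{i, k}. s l *\<^sub>R v l)"
      by (rule sum.mono_neutral_right) (use assms(1) ik in \<open>auto simp: s_def\<close>)
    also have "\<dots> = 0" using ik by (simp add: s_def)
    finally have "s i = 0" using ind ik(1) by blast
    then show False by (simp add: s_def)
  qed
  show "independent (v ` I)"
  proof
    assume "dependent (v ` I)"
    then obtain u y where y: "y \<in> v ` I" "u y \<noteq> 0" and s: "(\<Sum>x\<in>v ` I. u x *\<^sub>R x) = 0"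
      using dependent_finite[of "v ` I"] assms(1) by auto
    from s have "(\<Sum>i\<in>I. u (v i) *\<^sub>R v i) = 0" by (simp add: sum.reindex[OF inj])
    then have "u (v i) = 0" if "i \<in> I" for i using ind[of "\<lambda>i. u (v i)"] that by blast
    then show False using y by auto
  qed
qed

lemma orthogonal_zero_span:
  fixes C :: "'a::euclidean_space set"
  assumes "\<And>w. (\<And>v. v \<in> C \<Longrightarrow> inner w v = 0) \<Longrightarrow> w = 0"
  shows "span C = UNIV"
proof (rule ccontr)
  assume "span C \<noteq> UNIV"
  then obtain a where a: "a \<noteq> 0" "\<And>x. x \<in> span C \<Longrightarrow> inner a x = 0" using span_not_UNIV_orthogonal by blast
  have "a = 0" by (rule assms) (rule a(2)[OF span_base])
  then show False using a(1) by simp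
qed

lemma smooth_on_cart:
  fixes F :: "'a::real_normed_vector \<Rightarrow> real ^ 'n::finite"
  assumes "open U" "\<And>i. smooth_on U (\<lambda>x. vec_nth (F x) i)"
  shows "smooth_on U F"
proof (rule smooth_on_Basis_comp[OF assms(1)])
  fix b :: "real ^ 'n" assume "b \<in> Basis"
  then obtain i where "b = axis i 1" by (auto simp: Basis_vec_def)
  then show "smooth_on U (\<lambda>x. inner (F x) b)" using assms(2)[of i] by (simp add: inner_axis)
qed

lemma frechet_inner_left:
  assumes "F differentiable (at x)"
  shows "frechet_derivative (\<lambda>z. inner (F z) b) (at x) w = inner (frechet_derivative F (at x) w) b"
  using frechet_derivative_eq[OF has_derivative_inner_left[OF has_derivative_frechet[OF assms]]] by metis

lemma sum_list_concat_replicate: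
  "sum_list (concat (map (\<lambda>j. replicate (n j) (j::nat)) xs)) = (\<Sum>j\<leftarrow>xs. j * n j)"
  by (induction xs) (simp_all add: sum_list_replicate mult.commute)

context square_system
begin

section \<open>Enumeration of the chain functions and of the entries of \<open>Phi_d\<close>\<close>

definition chain_index where "chain_index = Sigma {1..m} (\<lambda>i. {1..q i})"

definition chain_list where
  "chain_list = concat (map (\<lambda>i. map (Pair i) [1..<Suc (q i)]) [1..<Suc m])"

lemma chain_list: "set chain_list = chain_index" "distinct chain_list"
proof -
  show "set chain_list = chain_index"
    by (fastforce simp: chain_list_def chain_index_def atLeastLessThanSuc_atLeastAtMost simp del: upt_Suc)
  show "distinct chain_list" unfolding chain_list_def by (rule distinct_concat_pairs) (simp_all del: upt_Suc)
qed

lemma finite_chain_index: "finite chain_index"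
  by (simp add: chain_index_def)

lemma xi_vec_list: "xi_vec m q xi x = vec_of_list (map (\<lambda>(i, j). xi i j x) chain_list)"
  by (simp add: xi_vec_def chain_list_def map_concat comp_def del: upt_Suc)

text \<open>The chain lengths are the entries of \<open>infinite_zeros\<close>, where
  \<open>j\<close> occurs \<open>\<rho> j - \<rho> (j - 1)\<close> times; grouping by
  \<open>j\<close> gives \<open>nd\<close>.\<close>

lemma length_chain_list: "length chain_list = nd \<rho> kstar"
proof -
  have len: "length (infinite_zeros \<rho> kstar) = m"
    using infinite_zeros_nth(1)[of \<rho> kstar] rho_0 rho_step mp p by simp
  have "length chain_list = (\<Sum>i\<leftarrow>[1..<Suc m]. q i)"
    by (simp add: chain_list_def length_concat comp_def del: upt_Suc)
  also have "\<dots> = (\<Sum>i\<in>{1..<Suc m}. q i)" by (simp add: sum_list_distinct_conv_sum_set del: upt_Suc)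
  also have "\<dots> = (\<Sum>i\<in>{0..<m}. infinite_zeros \<rho> kstar ! i)"
    unfolding One_nat_def sum.atLeast_Suc_lessThan_Suc_shift using q by (intro sum.cong) auto
  also have "\<dots> = sum_list (infinite_zeros \<rho> kstar)" using len by (simp add: sum_list_sum_nth)
  also have "\<dots> = (\<Sum>j\<leftarrow>[1..<Suc kstar]. j * (\<rho> j - \<rho> (j - 1)))"
    unfolding infinite_zeros_def by (rule sum_list_concat_replicate)
  also have "\<dots> = nd \<rho> kstar"
    by (simp add: nd_def sum_list_distinct_conv_sum_set atLeastLessThanSuc_atLeastAtMost del: upt_Suc)
  finally show ?thesis .
qed

text \<open>Labels the entries of \<open>Phi_d\<close>, in their order, by level, position and row.
  The Jacobian condition then becomes the independence of a labelled family, which can be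
  rearranged.\<close>

definition zeta_list where
  "zeta_list = concat (map (\<lambda>i. map (Pair i) (concat (map (\<lambda>j. map (Pair j) [0..<\<rho> i - \<rho> (i - 1)]) [1..<Suc i]))) [1..<Suc kstar])"

definition zeta_fun where "zeta_fun = (\<lambda>(i, j, c) x. (K i j *\<^sub>v Th (j - 1) x) $ c)"

lemma distinct_zeta_list: "distinct zeta_list"
  unfolding zeta_list_def by (intro distinct_concat_pairs) (simp_all del: upt_Suc)

lemma Phi_d_list:
  assumes "x \<in> U"
  shows "Phi_d f g h m p \<rho> R S kstar x = vec_of_list (map (\<lambda>z. zeta_fun z x) zeta_list)"
proof -
  have "list_of_vec (zeta f g h m p \<rho> R S i j x) = map (\<lambda>c. zeta_fun (i, j, c) x) [0..<\<rho> i - \<rho> (i - 1)]"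
    if "i \<in> {1..kstar}" "j \<in> {1..i}" for i j
  proof -
    have "dim_vec (K i j *\<^sub>v Th (j - 1) x) = \<rho> i - \<rho> (i - 1)" using K_carrier[of j i] that by simp
    then show ?thesis unfolding zeta_def K_def[symmetric] list_of_vec_map zeta_fun_def by simp
  qed
  then have "map (\<lambda>j. list_of_vec (zeta f g h m p \<rho> R S i j x)) [1..<Suc i] =
      map (\<lambda>j. map (\<lambda>c. zeta_fun (i, j, c) x) [0..<\<rho> i - \<rho> (i - 1)]) [1..<Suc i]" if "i \<in> {1..kstar}" for i
    using that by (intro map_cong refl) (auto simp del: upt_Suc)
  then have *: "map (\<lambda>i. concat (map (\<lambda>j. list_of_vec (zeta f g h m p \<rho> R S i j x)) [1..<Suc i])) [1..<Suc kstar] =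
      map (\<lambda>i. concat (map (\<lambda>j. map (\<lambda>c. zeta_fun (i, j, c) x) [0..<\<rho> i - \<rho> (i - 1)]) [1..<Suc i])) [1..<Suc kstar]"
    by (intro map_cong refl arg_cong[where f=concat]) (auto simp del: upt_Suc)
  show ?thesis unfolding Phi_d_def * by (simp add: zeta_list_def map_concat comp_def del: upt_Suc)
qed

lemma zeta_independent:
  assumes jac: "full_row_rank (vec_jacobian (Phi_d f g h m p \<rho> R S kstar) x)" and x: "x \<in> U"
    and s: "\<And>w. (\<Sum>z\<in>set zeta_list. s z * frechet_derivative (zeta_fun z) (at x) w) = 0" and z: "z \<in> set zeta_list"
  shows "s z = 0"
proof -
  let ?\<Phi> = "Phi_d f g h m p \<rho> R S kstar" and ?J = "vec_jacobian (Phi_d f g h m p \<rho> R S kstar) x" and ?l = "length zeta_list"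
  have dim: "dim_vec (?\<Phi> x) = ?l" using Phi_d_list[OF x] by simp
  have primitive: "?J \<in> carrier_mat ?l CARD('n)" by (simp add: vec_jacobian_def dim)
  have D: "frechet_derivative (\<lambda>y. ?\<Phi> y $ k) (at x) = frechet_derivative (zeta_fun (zeta_list ! k)) (at x)" if "k < ?l" for k
    by (rule frechet_derivative_cong_open[OF U(1) x]) (use Phi_d_list that in \<open>simp add: vec_of_list_index\<close>)
  obtain k where k: "k < ?l" "z = zeta_list ! k" using z by (auto simp: in_set_conv_nth)
  have "s (zeta_list ! k) = 0"
  proof (rule full_row_rank_rows[OF primitive jac _ k(1)])
    fix j assume j: "j < CARD('n)"
    let ?e = "axis (from_nat_into (UNIV :: 'n set) j) 1 :: real ^ 'n"
    have "(\<Sum>i<?l. s (zeta_list ! i) * ?J $$ (i, j)) = (\<Sum>i<?l. s (zeta_list ! i) * frechet_derivative (zeta_fun (zeta_list ! i)) (at x) ?e)"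
      using D j by (intro sum.cong) (simp_all add: vec_jacobian_def dim)
    also have "\<dots> = (\<Sum>z\<in>set zeta_list. s z * frechet_derivative (zeta_fun z) (at x) ?e)"
      by (rule sum.reindex_bij_betw[OF bij_betw_nth[OF distinct_zeta_list refl refl]])
    finally show "(\<Sum>i<?l. s (zeta_list ! i) * ?J $$ (i, j)) = 0" using s by simp
  qed
  then show ?thesis by (simp add: k(2))
qed

text \<open>The chain functions are entries of \<open>Phi_d\<close> in another order. The
  relabelling \<open>e\<close> is injective, since level and row determine the chain, and it carries
  a relation among chain gradients to one among rows of the Jacobian.\<close>

lemma chain_independent:
  assumes jac: "full_row_rank (vec_jacobian (Phi_d f g h m p \<rho> R S kstar) x)" and x: "x \<in> U"
    and s: "\<And>w. (\<Sum>z\<in>chain_index. s z * frechet_derivative (xi (fst z) (snd z)) (at x) w) = 0" and z: "z \<in> chain_index"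
  shows "s z = 0"
proof -
  define e where "e = (\<lambda>(i, j::nat). (q i, j, c i))"
  have inj: "inj_on e chain_index"
  proof (rule inj_onI)
    fix y y' assume y: "y \<in> chain_index" "y' \<in> chain_index" "e y = e y'"
    obtain i j i' j' where ij: "y = (i, j)" "y' = (i', j')" by (cases y, cases y')
    have "i \<in> {1..m}" "i' \<in> {1..m}" "q i = q i'" "c i = c i'" "j = j'" using y by (auto simp: ij e_def chain_index_def)
    then show "y = y'" using q_range(3)[of i] q_range(3)[of i'] by (simp add: ij c_def)
  qed
  have img: "e ` chain_index \<subseteq> set zeta_list"
  proof
    fix y assume "y \<in> e ` chain_index"
    then obtain i j where ij: "y = (q i, j, c i)" "i \<in> {1..m}" "j \<in> {1..q i}" by (auto simp: e_def chain_index_def)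
    then show "y \<in> set zeta_list" using q_range[OF ij(2)] c_less[OF ij(2)]
      by (auto simp: zeta_list_def image_iff simp del: upt_Suc)
  qed
  define t where "t y = (if y \<in> e ` chain_index then s (inv_into chain_index e y) else 0)" for y
  have "t (e z) = 0"
  proof (rule zeta_independent[OF jac x])
    fix w
    have "(\<Sum>z\<in>set zeta_list. t z * frechet_derivative (zeta_fun z) (at x) w) =
        (\<Sum>z\<in>e ` chain_index. t z * frechet_derivative (zeta_fun z) (at x) w)"
      by (rule sum.mono_neutral_right) (use img in \<open>auto simp: t_def\<close>)
    also have "\<dots> = (\<Sum>z\<in>chain_index. t (e z) * frechet_derivative (zeta_fun (e z)) (at x) w)"
      by (simp add: sum.reindex[OF inj])
    also have "\<dots> = (\<Sum>z\<in>chain_index. s z * frechet_derivative (xi (fst z) (snd z)) (at x) w)"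
    proof (rule sum.cong[OF refl])
      fix y assume y: "y \<in> chain_index"
      have "zeta_fun (e y) = xi (fst y) (snd y)" by (cases y) (simp add: e_def zeta_fun_def xi_def[abs_def])
      then show "t (e y) * frechet_derivative (zeta_fun (e y)) (at x) w = s y * frechet_derivative (xi (fst y) (snd y)) (at x) w"
        using y inv_into_f_f[OF inj y] by (simp add: t_def)
    qed
    finally show "(\<Sum>z\<in>set zeta_list. t z * frechet_derivative (zeta_fun z) (at x) w) = 0" using s by simp
  qed (use img z in blast)
  then show ?thesis using inv_into_f_f[OF inj z] z by (simp add: t_def)
qed

end

section \<open>Completion of the chains to local coordinates\<close>

context square_system
begin

lemma xi_differentiable: "z \<in> chain_index \<Longrightarrow> x \<in> U \<Longrightarrow> xi (fst z) (snd z) differentiable (at x)"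
  by (rule smooth_on_differentiable[OF smooth_xi]) (auto simp: chain_index_def)

text \<open>\<open>lam\<close> has as many components as the state, so a selection is needed. By
  \<open>ker\<close> no nonzero vector is orthogonal to all gradients of the chains
  (\<open>A\<close>) and of \<open>lam\<close> (\<open>B\<close>), hence they span. A basis
  \<open>C\<close> that contains \<open>A\<close> and is contained in the union picks the directions
  \<open>\<beta>\<close> of \<open>lam\<close> that serve as internal coordinates.\<close>

lemma local_coordinates:
  fixes lam :: "real ^ 'n \<Rightarrow> real ^ 'n"
  assumes jac: "full_row_rank (vec_jacobian (Phi_d f g h m p \<rho> R S kstar) x0)"
    and V: "open V" "x0 \<in> V" "V \<subseteq> U" and lam: "smooth_on V lam"
    and ker: "\<And>w. frechet_derivative lam (at x0) w = 0 \<Longrightarrow>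
      (\<And>i. i < m \<Longrightarrow> frechet_derivative (\<lambda>z. Om kstar z $ i) (at x0) w = 0) \<Longrightarrow> w = 0"
  obtains W \<beta> where "open W" "x0 \<in> W" "W \<subseteq> V"
    "diffeo_on W (\<lambda>x. cart_of_vec (vec (CARD('n) - nd \<rho> kstar) (\<lambda>k. inner (lam x) (\<beta> k)) @\<^sub>v xi_vec m q xi x) :: real ^ 'n)"
proof -
  have x0: "x0 \<in> U" using V by auto
  define r where "r = CARD('n) - nd \<rho> kstar"
  define grad :: "(real ^ 'n \<Rightarrow> real) \<Rightarrow> real ^ 'n" where "grad \<theta> = adjoint (frechet_derivative \<theta> (at x0)) 1" for \<theta>
  define v where "v z = grad (xi (fst z) (snd z))" for z
  define e where "e b = grad (\<lambda>x. inner (lam x) b)" for b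
  have dlam: "lam differentiable (at x0)" by (rule smooth_on_differentiable[OF lam V(2)])
  have v: "inner w (v z) = frechet_derivative (xi (fst z) (snd z)) (at x0) w" if "z \<in> chain_index" for w z
    unfolding v_def grad_def by (rule gradient[OF xi_differentiable[OF that x0]])
  have e: "inner w (e b) = inner (frechet_derivative lam (at x0) w) b" for w b
  proof -
    have "(\<lambda>x. inner (lam x) b) differentiable (at x0)"
      using has_derivative_inner_left[OF has_derivative_frechet[OF dlam]] by (rule differentiableI)
    then show ?thesis unfolding e_def grad_def by (simp add: gradient frechet_inner_left[OF dlam])
  qed
  have ind: "s z = 0" if s: "(\<Sum>z\<in>chain_index. s z *\<^sub>R v z) = 0" and z: "z \<in> chain_index" for s z
  proof (rule chain_independent[OF jac x0 _ z])
    fix w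
    have "(\<Sum>z\<in>chain_index. s z * frechet_derivative (xi (fst z) (snd z)) (at x0) w) = inner w (\<Sum>z\<in>chain_index. s z *\<^sub>R v z)"
      by (simp add: inner_sum_right v)
    then show "(\<Sum>z\<in>chain_index. s z * frechet_derivative (xi (fst z) (snd z)) (at x0) w) = 0" using s by simp
  qed
  have inj: "inj_on v chain_index" and indA: "independent (v ` chain_index)"
    by (rule independent_familyD[OF finite_chain_index]; (rule ind; assumption))+
  define A where "A = v ` chain_index"
  define B where "B = e ` Basis"
  have cardA: "card A = nd \<rho> kstar"
    using card_image[OF inj] distinct_card[OF chain_list(2)] by (simp add: A_def chain_list(1) length_chain_list)
  have zero: "w = 0" if "\<And>y. y \<in> A \<union> B \<Longrightarrow> inner w y = 0" for w
  proof (rule ker)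
    show "frechet_derivative lam (at x0) w = 0"
    proof (rule euclidean_eqI)
      fix b :: "real ^ 'n" assume "b \<in> Basis"
      then show "inner (frechet_derivative lam (at x0) w) b = inner 0 b" using that[of "e b"] e by (simp add: B_def)
    qed
    fix i assume i: "i < m"
    then have 1: "Suc i \<in> {1..m}" by simp
    \<comment> \<open>The end of chain \<open>Suc i\<close> is component \<open>i\<close> of
      \<open>Om kstar\<close>, so orthogonality to \<open>A\<close> supplies the second hypothesis
      of \<open>ker\<close>.\<close>
    then have z: "(Suc i, q (Suc i)) \<in> chain_index" using q_range(1)[OF 1] by (simp add: chain_index_def)
    have "frechet_derivative (\<lambda>z. Om kstar z $ i) (at x0) = frechet_derivative (xi (Suc i) (q (Suc i))) (at x0)"
      by (rule frechet_derivative_cong_open[OF U(1) x0]) (use xi_last[OF 1] in simp)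
    then show "frechet_derivative (\<lambda>z. Om kstar z $ i) (at x0) w = 0"
      using v[OF z, of w] that[of "v (Suc i, q (Suc i))"] z by (simp add: A_def)
  qed
  have spanAB: "span (A \<union> B) = UNIV" by (rule orthogonal_zero_span[OF zero])
  obtain C where C: "A \<subseteq> C" "C \<subseteq> A \<union> B" "independent C" "A \<union> B \<subseteq> span C"
    using maximal_independent_subset_extend[of A "A \<union> B"] indA by (auto simp: A_def)
  have spanC: "span C = UNIV"
  proof -
    have "span (A \<union> B) \<subseteq> span C" using C(4) by (simp add: span_minimal)
    then show ?thesis using spanAB by auto
  qed
  have cardC: "card C = CARD('n)"
    using dim_unique[of C UNIV "card C"] C(3) spanC by simp
  have finC: "finite C" using C(3) by (rule independent_imp_finite)
  have "card (C - A) = r" using card_Diff_subset[OF finite_subset[OF C(1) finC] C(1)] cardA cardC by (simp add: r_def)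
  moreover have "nd \<rho> kstar \<le> CARD('n)" using card_mono[OF finC C(1)] cardA cardC by simp
  then have rn: "r + nd \<rho> kstar = CARD('n)" by (simp add: r_def)
  moreover obtain \<gamma> where "bij_betw \<gamma> {0..<card (C - A)} (C - A)"
    using ex_bij_betw_nat_finite[of "C - A"] finC by blast
  ultimately have \<gamma>: "\<gamma> ` {..<r} = C - A" by (simp add: bij_betw_def atLeast0LessThan)
  have "\<forall>k\<in>{..<r}. \<exists>b. e b = \<gamma> k"
  proof
    fix k assume "k \<in> {..<r}"
    then have "\<gamma> k \<in> C - A" unfolding \<gamma>[symmetric] by (rule imageI)
    then have "\<gamma> k \<in> B" using C(2) by blast
    then show "\<exists>b. e b = \<gamma> k" unfolding B_def by (elim imageE) (rule exI, rule sym)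
  qed
  then obtain \<beta> where \<beta>: "\<And>k. k < r \<Longrightarrow> e (\<beta> k) = \<gamma> k" using bchoice[of "{..<r}" "\<lambda>k b. e b = \<gamma> k"] by auto
  define y where "y x = vec r (\<lambda>k. inner (lam x) (\<beta> k)) @\<^sub>v xi_vec m q xi x" for x
  define F where "F x = (cart_of_vec (y x) :: real ^ 'n)" for x
  have y1: "y x $ k = inner (lam x) (\<beta> k)" if "k < r" for x k
    using that by (simp add: y_def)
  have y2: "y x $ (r + k) = xi (fst (chain_list ! k)) (snd (chain_list ! k)) x" if "k < nd \<rho> kstar" for x k
    using that by (simp add: y_def xi_vec_list length_chain_list vec_of_list_index case_prod_unfold)
  have ci: "chain_list ! k \<in> chain_index" if "k < nd \<rho> kstar" for k
    using nth_mem[of k chain_list] that by (simp add: length_chain_list chain_list(1))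
  have smooth_y: "smooth_on V (\<lambda>x. y x $ k)" if "k < CARD('n)" for k
  proof (cases "k < r")
    case True
    show ?thesis unfolding y1[OF True] by (rule smooth_on_compose_linear[OF V(1) bounded_linear_inner_left lam])
  next
    case False
    then obtain l where l: "k = r + l" "l < nd \<rho> kstar" using rn \<open>k < CARD('n)\<close> by (metis add_diff_inverse_nat nat_add_left_cancel_less)
    have "smooth_on U (xi (fst (chain_list ! l)) (snd (chain_list ! l)))"
      by (rule smooth_xi) (use ci[OF l(2)] in \<open>auto simp: chain_index_def\<close>)
    then show ?thesis unfolding l(1) y2[OF l(2)] by (rule smooth_on_subset[OF _ U(1) V(1,3)])
  qed
  have bij: "bij_betw (to_nat_on (UNIV :: 'n set)) UNIV {..<CARD('n)}" by (rule to_nat_on_finite) simp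
  have Fi: "vec_nth (F x) i = y x $ to_nat_on (UNIV :: 'n set) i" for x i
    by (simp add: F_def cart_of_vec_def)
  have smooth_F: "smooth_on V F"
    by (rule smooth_on_cart[OF V(1)], unfold Fi, rule smooth_y) (use bij in \<open>auto simp: bij_betw_def\<close>)
  \<comment> \<open>A vector killed by the derivative of \<open>F\<close> is orthogonal to every
    element of the basis \<open>C\<close>.\<close>
  have inj_F: "w = 0" if w: "frechet_derivative F (at x0) w = 0" for w
  proof -
    have dy: "frechet_derivative (\<lambda>x. y x $ k) (at x0) w = 0" if k: "k < CARD('n)" for k
    proof -
      obtain i where i: "k = to_nat_on (UNIV :: 'n set) i" using bij k unfolding bij_betw_def by blast
      have "((\<lambda>x. vec_nth (F x) i) has_derivative (\<lambda>w. vec_nth (frechet_derivative F (at x0) w) i)) (at x0)"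
        by (rule bounded_linear.has_derivative[OF bounded_linear_vec_nth smooth_on_has_derivative[OF smooth_F V(2)]])
      then have "frechet_derivative (\<lambda>x. y x $ k) (at x0) = (\<lambda>w. vec_nth (frechet_derivative F (at x0) w) i)"
        unfolding Fi i by (rule frechet_derivative_eq)
      then show ?thesis using w by simp
    qed
    have "inner w z = 0" if z: "z \<in> C" for z
    proof (cases "z \<in> A")
      case True
      then obtain l where l: "l < nd \<rho> kstar" "z = v (chain_list ! l)"
        unfolding A_def chain_list(1)[symmetric] length_chain_list[symmetric] by (auto simp: in_set_conv_nth)
      have "frechet_derivative (\<lambda>x. y x $ (r + l)) (at x0) w = inner w z"
        unfolding y2[OF l(1)] l(2) by (rule v[OF ci[OF l(1)], symmetric])
      then show ?thesis using dy[of "r + l"] rn l(1) by simp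
    next
      case False
      then obtain k where k: "k < r" "z = e (\<beta> k)" using \<gamma> z \<beta> by (metis DiffI imageE lessThan_iff)
      have "frechet_derivative (\<lambda>x. y x $ k) (at x0) w = inner w z"
        unfolding y1[OF k(1)] k(2) e by (rule frechet_inner_left[OF dlam])
      then show ?thesis using dy[of k] rn k(1) by simp
    qed
    then have "C \<subseteq> {z. inner w z = 0}" by blast
    then have "span C \<subseteq> {z. inner w z = 0}" using span_minimal subspace_hyperplane by blast
    then have "w \<in> {z. inner w z = 0}" using spanC by blast
    then show ?thesis by simp
  qed
  obtain W where W: "open W" "x0 \<in> W" "W \<subseteq> V" "diffeo_on W F"
    by (rule local_diffeo[OF V(1,2) smooth_F inj_F]) (assumption | (rule that; assumption))+
  show thesis
    by (rule that[OF W(1-3)]) (use W(4) in \<open>simp add: F_def[abs_def] y_def r_def\<close>)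
qed

text \<open>A linear relation among the input fields would lie in the kernel of the nonsingular
  matrix \<open>Lg g m (Om kstar) x\<close>. The bound is what
  \<open>commuting_first_integrals\<close> asks in order to store the flow times.\<close>

lemma inputs_le_states:
  assumes "x \<in> U"
  shows "m \<le> CARD('n)"
proof -
  have L: "Lg g m (Om kstar) x \<in> carrier_mat m m" using Lg_carrier[OF smooth_Om_kstar assms] .
  have ind: "s j = 0" if s: "(\<Sum>j<m. s j *\<^sub>R g j x) = 0" and j: "j \<in> {..<m}" for s j
  proof -
    have "Lg g m (Om kstar) x *\<^sub>v vec m s = 0\<^sub>v m"
    proof (rule eq_vecI)
      fix i assume "i < dim_vec (0\<^sub>v m :: real vec)"
      then have i: "i < m" by simp
      note d = smooth_on_differentiable[OF smooth_vec_onD(3)[OF smooth_Om_kstar i] assms]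
      have "(Lg g m (Om kstar) x *\<^sub>v vec m s) $ i = (\<Sum>j<m. frechet_derivative (\<lambda>z. Om kstar z $ i) (at x) (g j x) * s j)"
        using mult_mat_vec_index_sum[OF L _ i, of "vec m s"] Lg_index[OF smooth_Om_kstar assms i, of _ m g] by simp
      also have "\<dots> = frechet_derivative (\<lambda>z. Om kstar z $ i) (at x) (\<Sum>j<m. s j *\<^sub>R g j x)"
        using has_derivative_linear[OF has_derivative_frechet[OF d]] by (simp add: linear_sum linear_scale mult.commute)
      also have "\<dots> = 0" using s has_derivative_linear[OF has_derivative_frechet[OF d]] by (simp add: linear_0)
      finally show "(Lg g m (Om kstar) x *\<^sub>v vec m s) $ i = 0\<^sub>v m $ i" using i by simp
    qed (use L in simp)
    then have "vec m s = 0\<^sub>v m"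
      using Lg_Om_det[OF assms] det_0_iff_vec_prod_zero_field[OF L] vec_carrier[of m s] by blast
    moreover have "vec m s $ j = s j" using j by simp
    ultimately show ?thesis using j by simp
  qed
  have inj: "inj_on (\<lambda>j. g j x) {..<m}" and ind': "independent ((\<lambda>j. g j x) ` {..<m})"
    by (rule independent_familyD[OF finite_lessThan]; (rule ind; assumption))+
  show ?thesis using independent_card_le[OF ind'] card_image[OF inj] by simp
qed

lemma eta_form_exists:
  assumes jac: "\<forall>x\<in>U. full_row_rank (vec_jacobian (Phi_d f g h m p \<rho> R S kstar) x)"
    and inv: "involutive_on U (\<lambda>x. span {g j x | j. j < m})" and x0: "x0 \<in> U"
  obtains V \<eta> fe \<phi> where "open V" "x0 \<in> V" "V \<subseteq> U"
    "eta_form V f g m q xi a b (CARD('n) - nd \<rho> kstar) \<eta> fe \<phi>"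
    "\<forall>l\<in>{1..m}. \<forall>x\<in>V. \<phi> l x = 0\<^sub>v (CARD('n) - nd \<rho> kstar)"
proof -
  define r where "r = CARD('n) - nd \<rho> kstar"
  have nz: "det (mat m m (\<lambda>(i, j). frechet_derivative (\<lambda>z. Om kstar z $ i) (at x) (g j x))) \<noteq> 0" if x: "x \<in> U" for x
  proof -
    have "mat m m (\<lambda>(i, j). frechet_derivative (\<lambda>z. Om kstar z $ i) (at x) (g j x)) = Lg g m (Om kstar) x"
      using Lg_carrier[OF smooth_Om_kstar x, of g m] Lg_index[OF smooth_Om_kstar x] by (intro eq_matI) auto
    then show ?thesis using Lg_Om_det[OF x] by simp
  qed
  have mn: "m \<le> DIM(real ^ 'n)" using inputs_le_states[OF x0] by simp
  obtain V and lam :: "real ^ 'n \<Rightarrow> real ^ 'n" where V: "open V" "x0 \<in> V" "V \<subseteq> U" and lam: "smooth_on V lam"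
    and lam_g: "\<And>x j. x \<in> V \<Longrightarrow> j < m \<Longrightarrow> frechet_derivative lam (at x) (g j x) = 0"
    and ker: "\<And>w. frechet_derivative lam (at x0) w = 0 \<Longrightarrow>
      (\<And>i. i < m \<Longrightarrow> frechet_derivative (\<lambda>z. Om kstar z $ i) (at x0) w = 0) \<Longrightarrow> w = 0"
  proof (rule involutive_first_integrals[OF U(1) x0 mn g smooth_vec_onD(3)[OF smooth_Om_kstar] nz inv], goal_cases)
    case (4 V lam)
    from that[OF 4(2-7)] show ?case .
  qed
  obtain W \<beta> where W: "open W" "x0 \<in> W" "W \<subseteq> V"
    and diffeo: "diffeo_on W (\<lambda>x. cart_of_vec (vec (CARD('n) - nd \<rho> kstar) (\<lambda>k. inner (lam x) (\<beta> k)) @\<^sub>v xi_vec m q xi x) :: real ^ 'n)"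
    by (rule local_coordinates[OF jac[rule_format, OF x0] V lam ker]) (assumption | (rule that; assumption))+
  define \<eta> where "\<eta> x = vec r (\<lambda>k. inner (lam x) (\<beta> k))" for x
  have WU: "W \<subseteq> U" using W(3) V(3) by (rule subset_trans)
  have s_eta: "smooth_vec_on W r \<eta>"
  proof (rule smooth_vec_onI[where G="\<lambda>k x. inner (lam x) (\<beta> k)", OF _ W(1)])
    show "smooth_on W (\<lambda>x. inner (lam x) (\<beta> k))" for k
      by (rule smooth_on_compose_linear[OF W(1) bounded_linear_inner_left smooth_on_subset[OF lam V(1) W(1,3)]])
  qed (simp_all add: \<eta>_def)
  have eta_g: "frechet_derivative (\<lambda>z. \<eta> z $ k) (at x) (g j x) = 0" if "x \<in> W" "k < r" "j < m" for x k j
  proof -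
    have x: "x \<in> V" using W(3) that(1) by (rule subsetD)
    have "(\<lambda>z. \<eta> z $ k) = (\<lambda>z. inner (lam z) (\<beta> k))" using that(2) by (simp add: \<eta>_def)
    then show ?thesis using frechet_inner_left[OF smooth_on_differentiable[OF lam x]] lam_g[OF x that(3)] by simp
  qed
  \<comment> \<open>The components of \<open>\<eta>\<close> are first integrals, so their derivative
    along the system is the drift part alone.\<close>
  have "eta_form W f g m q xi a b r \<eta> (Lf f \<eta>) (\<lambda>l x. 0\<^sub>v r)"
    unfolding eta_form_def
  proof (intro conjI ballI allI impI)
    show "smooth_vec_on W r (Lf f \<eta>)"
      by (rule smooth_vec_on_Lf[OF W(1) s_eta smooth_on_subset[OF f U(1) W(1) WU]])
    show "smooth_vec_on W r (\<lambda>x. 0\<^sub>v r)" for l :: nat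
      by (rule smooth_vec_onI[where G="\<lambda>k x. 0", OF _ W(1)]) (simp_all add: smooth_on_const[OF W(1)])
    show "diffeo_on W (\<lambda>x. cart_of_vec (\<eta> x @\<^sub>v xi_vec m q xi x) :: real ^ 'n)"
      using diffeo by (simp add: \<eta>_def r_def)
    fix x k and u :: "real vec" assume x: "x \<in> W" and k: "k < r"
    have "Lg g m \<eta> x $$ (k, j) = 0" if "j < m" for j
      using Lg_index[OF s_eta x k that] eta_g[OF x k that] by simp
    then show "deriv_along f g m (\<lambda>z. \<eta> z $ k) x u = Lf f \<eta> x $ k + (\<Sum>l=1..m. (0\<^sub>v r $ k) * (a l x + b l x \<bullet> u))"
      using deriv_along_vec[OF s_eta x k, of f g m u] k by simp
  qed (rule s_eta)
  then show thesis
    by (rule that[OF W(1,2) WU, folded r_def]) simp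
qed

end

theorem corollary3p2p1:
  fixes U :: "(real ^ 'n::finite) set"
    and f :: "real ^ 'n \<Rightarrow> real ^ 'n"
    and g :: "nat \<Rightarrow> real ^ 'n \<Rightarrow> real ^ 'n"
    and h :: "real ^ 'n \<Rightarrow> real vec"
    and m p kstar :: nat and \<rho> q :: "nat \<Rightarrow> nat" and R S :: "nat \<Rightarrow> real mat"
  assumes "affine_system U f g h m p"
    and "regular_run U f g h m p \<rho> R S kstar"
    and "m = p" and "p = \<rho> kstar"
    and "\<forall>i\<in>{1..m}. q i = infinite_zeros \<rho> kstar ! (i - 1)"
    and "\<forall>x\<in>U. full_row_rank (vec_jacobian (Phi_d f g h m p \<rho> R S kstar) x)"
    and "involutive_on U (\<lambda>x. span {g j x | j. j < m})"
  shows "\<exists>\<Gamma> \<xi> a b \<delta>.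
    \<Gamma> \<in> carrier_mat p p \<and> invertible_mat \<Gamma> \<and>
    chain_form U f g (\<lambda>x. \<Gamma> *\<^sub>v h x) m q \<xi> a b \<delta> \<and>
    (\<forall>x\<^sub>0\<in>U. \<exists>V \<eta> fe \<phi>. open V \<and> x\<^sub>0 \<in> V \<and> V \<subseteq> U \<and>
       eta_form V f g m q \<xi> a b (CARD('n) - nd \<rho> kstar) \<eta> fe \<phi>) \<and>
    (\<forall>x\<^sub>0\<in>U. \<exists>V \<eta> fe \<phi>. open V \<and> x\<^sub>0 \<in> V \<and> V \<subseteq> U \<and>
       eta_form V f g m q \<xi> a b (CARD('n) - nd \<rho> kstar) \<eta> fe \<phi> \<and>
       (\<forall>l\<in>{1..m}. \<forall>x\<in>V. \<phi> l x = 0\<^sub>v (CARD('n) - nd \<rho> kstar)))"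
proof -
  interpret square_system U f g h m p \<rho> R S kstar q
    using assms(1-5) by unfold_locales
  \<comment> \<open>Coordinates with \<open>\<phi> = 0\<close> serve both local claims. The output
    transformation, the chains and the inputs are fixed on all of \<open>U\<close> beforehand; the
    neighbourhood and the completion vary with \<open>x\<^sub>0\<close>.\<close>
  have coordinates: "\<exists>V \<eta> fe \<phi>. open V \<and> x\<^sub>0 \<in> V \<and> V \<subseteq> U \<and>
       eta_form V f g m q xi a b (CARD('n) - nd \<rho> kstar) \<eta> fe \<phi> \<and>
       (\<forall>l\<in>{1..m}. \<forall>x\<in>V. \<phi> l x = 0\<^sub>v (CARD('n) - nd \<rho> kstar))" if "x\<^sub>0 \<in> U" for x\<^sub>0
    by (rule eta_form_exists[OF assms(6,7) that], intro exI conjI)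
  show ?thesis
  proof (rule exI[of _ Gam], rule exI[of _ xi], rule exI[of _ a], rule exI[of _ b], rule exI[of _ del], intro conjI ballI)
    show "Gam \<in> carrier_mat p p" by (simp add: Gam_def)
    show "invertible_mat Gam" by (rule Gam_invertible)
    show "chain_form U f g (\<lambda>x. Gam *\<^sub>v h x) m q xi a b del" by (rule chain_form_xi)
    fix x\<^sub>0 assume "x\<^sub>0 \<in> U"
    note c = coordinates[OF this]
    from c show "\<exists>V \<eta> fe \<phi>. open V \<and> x\<^sub>0 \<in> V \<and> V \<subseteq> U \<and>
       eta_form V f g m q xi a b (CARD('n) - nd \<rho> kstar) \<eta> fe \<phi> \<and>
       (\<forall>l\<in>{1..m}. \<forall>x\<in>V. \<phi> l x = 0\<^sub>v (CARD('n) - nd \<rho> kstar))" .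
    from c show "\<exists>V \<eta> fe \<phi>. open V \<and> x\<^sub>0 \<in> V \<and> V \<subseteq> U \<and>
       eta_form V f g m q xi a b (CARD('n) - nd \<rho> kstar) \<eta> fe \<phi>"
      by (elim exE conjE) (intro exI conjI)
  qed
qed

end
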